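(* Let $R$ be a commutative noetherian ring. If the Balmer spectrum $\mathrm{Spc}\, D^-(\mathrm{mod}\, R)$ is a noetherian topological space, then the Zariski spectrum $\mathrm{Spec}\, R$ is a finite set.
   Context: For a commutative noetherian ring $R$, $D^-(\mathrm{mod}\, R)$ denotes the right bounded derived category of finitely generated $R$-modules: the derived category of complexes $X$ of finitely generated $R$-modules with $H^i(X)=0$ for all $i\gg 0$. It is an essentially small tensor triangulated category under $\otimes^{\mathbf L}_R$ with unit $R$. For an essentially small tensor triangulated category $(\mathcal T,\otimes,\mathbf 1)$, a thick tensor ideal is a thick subcategory $\mathcal X$ of $\mathcal T$ with $T\otimes X\in\mathcal X$ for all $T\in\mathcal T$, $X\in\mathcal X$. A proper thick tensor ideal $\mathcal P$ is prime if $X\otimes Y\in\mathcal P$ implies $X\in\mathcal P$ or $Y\in\mathcal P$. The Balmer spectrum $\mathrm{Spc}\,\mathcal T$ is the set of prime thick tensor ideals, with the topology having open basis $\{\mathtt U(X)\mid X\in\mathcal T\}$, where $\mathtt U(X)=\{\mathcal P\in\mathrm{Spc}\,\mathcal T\mid X\in\mathcal P\}$. A topological space is noetherian if every descending chain of closed subspaces stabilizes. *)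

theory Defs
  imports "HOL-Algebra.Module" "HOL-Algebra.Ring_Divisibility" "HOL-Analysis.Abstract_Topology"
begin

section \<open>Balmer spectra\<close>

text \<open>
  The part of the structure of a tensor triangulated category that enters the definition of its
  Balmer spectrum. \<open>Cmp T X Y Z g f\<close> is the composite of \<open>f : X \<rightarrow> Y\<close> and \<open>g : Y \<rightarrow> Z\<close>,
  and \<open>(X, Y, Z, f, g, h) \<in> Tri T\<close> is an exact triangle
  \<open>X \<rightarrow> Y \<rightarrow> Z \<rightarrow> X[1]\<close>. A tensor product is only determined up to isomorphism;
  \<open>Tns T X Y Z\<close> says that \<open>Z\<close> is a model of \<open>X \<otimes> Y\<close>. Since thick subcategories are
  closed under isomorphism, it does not matter for membership which model is used.
\<close>

record ('o, 'm) ttcat =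
  Ob :: "'o set"
  Mor :: "'o \<Rightarrow> 'o \<Rightarrow> 'm set"
  Idt :: "'o \<Rightarrow> 'm"
  Cmp :: "'o \<Rightarrow> 'o \<Rightarrow> 'o \<Rightarrow> 'm \<Rightarrow> 'm \<Rightarrow> 'm"
  Shf :: "'o \<Rightarrow> 'o"
  Tri :: "('o \<times> 'o \<times> 'o \<times> 'm \<times> 'm \<times> 'm) set"
  Tns :: "'o \<Rightarrow> 'o \<Rightarrow> 'o \<Rightarrow> bool"

definition iso_mor :: "('o, 'm, 'z) ttcat_scheme \<Rightarrow> 'o \<Rightarrow> 'o \<Rightarrow> 'm \<Rightarrow> bool" where
  "iso_mor T X Y f \<longleftrightarrow> f \<in> Mor T X Y \<and>
     (\<exists>g\<in>Mor T Y X. Cmp T X Y X g f = Idt T X \<and> Cmp T Y X Y f g = Idt T Y)"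

definition isomorphic_obj :: "('o, 'm, 'z) ttcat_scheme \<Rightarrow> 'o \<Rightarrow> 'o \<Rightarrow> bool" where
  "isomorphic_obj T X Y \<longleftrightarrow> (\<exists>f. iso_mor T X Y f)"

definition coproduct :: "('o, 'm, 'z) ttcat_scheme \<Rightarrow> 'o \<Rightarrow> 'o \<Rightarrow> 'o \<Rightarrow> bool" where
  "coproduct T X Y S \<longleftrightarrow> X \<in> Ob T \<and> Y \<in> Ob T \<and> S \<in> Ob T \<and>
     (\<exists>i\<in>Mor T X S. \<exists>j\<in>Mor T Y S. \<forall>W\<in>Ob T. \<forall>f\<in>Mor T X W. \<forall>g\<in>Mor T Y W.
        \<exists>!h. h \<in> Mor T S W \<and> Cmp T X S W h i = f \<and> Cmp T Y S W h j = g)"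

text \<open>Full subcategories are identified with their sets of objects.\<close>

definition triangulated_subcat :: "('o, 'm, 'z) ttcat_scheme \<Rightarrow> 'o set \<Rightarrow> bool" where
  "triangulated_subcat T \<X> \<longleftrightarrow> \<X> \<subseteq> Ob T \<and> \<X> \<noteq> {} \<and>
     (\<forall>X\<in>\<X>. \<forall>Y\<in>Ob T. isomorphic_obj T X Y \<longrightarrow> Y \<in> \<X>) \<and>
     (\<forall>X\<in>Ob T. X \<in> \<X> \<longleftrightarrow> Shf T X \<in> \<X>) \<and>
     (\<forall>X Y Z f g h. (X, Y, Z, f, g, h) \<in> Tri T \<longrightarrow> X \<in> \<X> \<longrightarrow> Y \<in> \<X> \<longrightarrow> Z \<in> \<X>)"

definition thick_subcat :: "('o, 'm, 'z) ttcat_scheme \<Rightarrow> 'o set \<Rightarrow> bool" where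
  "thick_subcat T \<X> \<longleftrightarrow> triangulated_subcat T \<X> \<and>
     (\<forall>X Y S. coproduct T X Y S \<longrightarrow> S \<in> \<X> \<longrightarrow> X \<in> \<X> \<and> Y \<in> \<X>)"

definition thick_tensor_ideal :: "('o, 'm, 'z) ttcat_scheme \<Rightarrow> 'o set \<Rightarrow> bool" where
  "thick_tensor_ideal T \<X> \<longleftrightarrow> thick_subcat T \<X> \<and>
     (\<forall>A\<in>Ob T. \<forall>X\<in>\<X>. \<forall>Z\<in>Ob T. Tns T A X Z \<longrightarrow> Z \<in> \<X>)"

definition prime_tensor_ideal :: "('o, 'm, 'z) ttcat_scheme \<Rightarrow> 'o set \<Rightarrow> bool" where
  "prime_tensor_ideal T \<P> \<longleftrightarrow> thick_tensor_ideal T \<P> \<and> \<P> \<noteq> Ob T \<and>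
     (\<forall>X\<in>Ob T. \<forall>Y\<in>Ob T. \<forall>Z\<in>Ob T. Tns T X Y Z \<longrightarrow> Z \<in> \<P> \<longrightarrow> X \<in> \<P> \<or> Y \<in> \<P>)"

definition Spc :: "('o, 'm, 'z) ttcat_scheme \<Rightarrow> 'o set set" where
  "Spc T = {\<P>. prime_tensor_ideal T \<P>}"

definition Spc_U :: "('o, 'm, 'z) ttcat_scheme \<Rightarrow> 'o \<Rightarrow> 'o set set" where
  "Spc_U T X = {\<P>\<in>Spc T. X \<in> \<P>}"

text \<open>
  The sets \<open>U(X)\<close> cover \<open>Spc T\<close> because \<open>U(0) = Spc T\<close>, and they are closed under finite
  intersections because \<open>U(X) \<inter> U(Y) = U(X \<oplus> Y)\<close>, so they are a basis of the
  topology they generate.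
\<close>

definition Spc_top :: "('o, 'm, 'z) ttcat_scheme \<Rightarrow> 'o set topology" where
  "Spc_top T = topology_generated_by (Spc_U T ` Ob T)"

definition noetherian_space :: "'p topology \<Rightarrow> bool" where
  "noetherian_space X \<longleftrightarrow>
     (\<forall>C :: nat \<Rightarrow> 'p set. (\<forall>n. closedin X (C n)) \<and> (\<forall>n. C (Suc n) \<subseteq> C n)
        \<longrightarrow> (\<exists>N. \<forall>n\<ge>N. C n = C N))"


section \<open>Modules\<close>

text \<open>A module in HOL-Algebra extends the ring record; its multiplication and unit are unused.\<close>

definition mk_module ::
  "'b set \<Rightarrow> 'b \<Rightarrow> ('b \<Rightarrow> 'b \<Rightarrow> 'b) \<Rightarrow> ('a \<Rightarrow> 'b \<Rightarrow> 'b) \<Rightarrow> ('a, 'b) module" where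
  "mk_module C z p s =
     \<lparr>carrier = C, mult = (\<lambda>_ _. z), one = z, zero = z, add = p, smult = s\<rparr>"

definition mod_hom :: "('a, 'r) ring_scheme \<Rightarrow> ('a, 'b) module \<Rightarrow> ('a, 'c) module \<Rightarrow> ('b \<Rightarrow> 'c) set"
  where "mod_hom R M N = {f. f \<in> carrier M \<rightarrow> carrier N \<and>
     (\<forall>x\<in>carrier M. \<forall>y\<in>carrier M. f (x \<oplus>\<^bsub>M\<^esub> y) = f x \<oplus>\<^bsub>N\<^esub> f y) \<and>
     (\<forall>a\<in>carrier R. \<forall>x\<in>carrier M. f (a \<odot>\<^bsub>M\<^esub> x) = a \<odot>\<^bsub>N\<^esub> f x)}"

definition mod_iso :: "('a, 'r) ring_scheme \<Rightarrow> ('a, 'b) module \<Rightarrow> ('a, 'c) module \<Rightarrow> ('b \<Rightarrow> 'c) set"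
  where "mod_iso R M N = {f\<in>mod_hom R M N. bij_betw f (carrier M) (carrier N)}"

definition submod_gen :: "('a, 'r) ring_scheme \<Rightarrow> ('a, 'b) module \<Rightarrow> 'b set \<Rightarrow> 'b set" where
  "submod_gen R M A = \<Inter>{N. submodule N R M \<and> A \<subseteq> N}"

definition fg_module :: "('a, 'r) ring_scheme \<Rightarrow> ('a, 'b) module \<Rightarrow> bool" where
  "fg_module R M \<longleftrightarrow> Module.module R M \<and>
     (\<exists>A. finite A \<and> A \<subseteq> carrier M \<and> submod_gen R M A = carrier M)"

text \<open>
  \<open>coset_map M' N' f\<close> is the map \<open>M/N \<rightarrow> M'/N'\<close> induced by a homomorphism
  \<open>f : M \<rightarrow> M'\<close> with \<open>f N \<subseteq> N'\<close>.
\<close>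

definition coset_map :: "('a, 'c) module \<Rightarrow> 'c set \<Rightarrow> ('b \<Rightarrow> 'c) \<Rightarrow> 'b set \<Rightarrow> 'c set" where
  "coset_map M' N' f C = (\<Union>x\<in>C. N' +>\<^bsub>M'\<^esub> f x)"

definition quot_module :: "('a, 'b) module \<Rightarrow> 'b set \<Rightarrow> ('a, 'b set) module" where
  "quot_module M N = mk_module (a_rcosets\<^bsub>M\<^esub> N) N (set_add M)
     (\<lambda>a. coset_map M N (\<lambda>x. a \<odot>\<^bsub>M\<^esub> x))"

definition prod_module :: "('a, 'b) module \<Rightarrow> ('a, 'c) module \<Rightarrow> ('a, 'b \<times> 'c) module" where
  "prod_module M N = mk_module (carrier M \<times> carrier N) (\<zero>\<^bsub>M\<^esub>, \<zero>\<^bsub>N\<^esub>)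
     (\<lambda>(x, y) (x', y'). (x \<oplus>\<^bsub>M\<^esub> x', y \<oplus>\<^bsub>N\<^esub> y')) (\<lambda>a (x, y). (a \<odot>\<^bsub>M\<^esub> x, a \<odot>\<^bsub>N\<^esub> y))"

definition dsum_module :: "('i \<Rightarrow> ('a, 'b) module) \<Rightarrow> ('a, 'i \<Rightarrow> 'b) module" where
  "dsum_module M = mk_module
     {z. finite {i. z i \<noteq> \<zero>\<^bsub>M i\<^esub>} \<and> (\<forall>i. z i \<in> carrier (M i))}
     (\<lambda>i. \<zero>\<^bsub>M i\<^esub>) (\<lambda>z w i. z i \<oplus>\<^bsub>M i\<^esub> w i) (\<lambda>a z i. a \<odot>\<^bsub>M i\<^esub> z i)"

definition free_module :: "('a, 'r) ring_scheme \<Rightarrow> 's set \<Rightarrow> ('a, 's \<Rightarrow> 'a) module" where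
  "free_module R S = mk_module
     {c. finite {s. c s \<noteq> \<zero>\<^bsub>R\<^esub>} \<and> (\<forall>s\<in>S. c s \<in> carrier R) \<and> (\<forall>s. s \<notin> S \<longrightarrow> c s = \<zero>\<^bsub>R\<^esub>)}
     (\<lambda>s. \<zero>\<^bsub>R\<^esub>) (\<lambda>c d s. c s \<oplus>\<^bsub>R\<^esub> d s) (\<lambda>a c s. a \<otimes>\<^bsub>R\<^esub> c s)"

definition free_gen :: "('a, 'r) ring_scheme \<Rightarrow> 's \<Rightarrow> 's \<Rightarrow> 'a" where
  "free_gen R s = (\<lambda>t. if t = s then \<one>\<^bsub>R\<^esub> else \<zero>\<^bsub>R\<^esub>)"

definition lin_ext :: "('a, 'r) ring_scheme \<Rightarrow> ('a, 'b) module \<Rightarrow> ('s \<Rightarrow> 'b) \<Rightarrow> ('s \<Rightarrow> 'a) \<Rightarrow> 'b" where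
  "lin_ext R L \<phi> c = finsum L (\<lambda>s. c s \<odot>\<^bsub>L\<^esub> \<phi> s) {s. c s \<noteq> \<zero>\<^bsub>R\<^esub>}"

definition fin_free :: "('a, 'r) ring_scheme \<Rightarrow> ('a, 'b) module \<Rightarrow> bool" where
  "fin_free R M \<longleftrightarrow> Module.module R M \<and>
     (\<exists>(k::nat) \<phi>. \<phi> \<in> mod_iso R (free_module R {..<k}) M)"


subsection \<open>Tensor products of modules\<close>

text \<open>
  \<open>M \<otimes> N\<close> is the free module on the set \<open>M \<times> N\<close> modulo the bilinearity relations; the class
  of \<open>free_gen R (x, y)\<close> is \<open>x \<otimes> y\<close>.
\<close>

abbreviation tensor_free ::
  "('a, 'r) ring_scheme \<Rightarrow> ('a, 'b) module \<Rightarrow> ('a, 'c) module \<Rightarrow> ('a, 'b \<times> 'c \<Rightarrow> 'a) module" where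
  "tensor_free R M N \<equiv> free_module R (carrier M \<times> carrier N)"

definition tensor_rels ::
  "('a, 'r) ring_scheme \<Rightarrow> ('a, 'b) module \<Rightarrow> ('a, 'c) module \<Rightarrow> ('b \<times> 'c \<Rightarrow> 'a) set" where
  "tensor_rels R M N = (let F = tensor_free R M N; e = (\<lambda>x y. free_gen R (x, y)) in
     {e (x \<oplus>\<^bsub>M\<^esub> x') y \<ominus>\<^bsub>F\<^esub> (e x y \<oplus>\<^bsub>F\<^esub> e x' y) | x x' y.
        x \<in> carrier M \<and> x' \<in> carrier M \<and> y \<in> carrier N} \<union>
     {e x (y \<oplus>\<^bsub>N\<^esub> y') \<ominus>\<^bsub>F\<^esub> (e x y \<oplus>\<^bsub>F\<^esub> e x y') | x y y'.
        x \<in> carrier M \<and> y \<in> carrier N \<and> y' \<in> carrier N} \<union>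
     {e (a \<odot>\<^bsub>M\<^esub> x) y \<ominus>\<^bsub>F\<^esub> a \<odot>\<^bsub>F\<^esub> e x y | a x y.
        a \<in> carrier R \<and> x \<in> carrier M \<and> y \<in> carrier N} \<union>
     {e x (a \<odot>\<^bsub>N\<^esub> y) \<ominus>\<^bsub>F\<^esub> a \<odot>\<^bsub>F\<^esub> e x y | a x y.
        a \<in> carrier R \<and> x \<in> carrier M \<and> y \<in> carrier N})"

definition tensor_ker ::
  "('a, 'r) ring_scheme \<Rightarrow> ('a, 'b) module \<Rightarrow> ('a, 'c) module \<Rightarrow> ('b \<times> 'c \<Rightarrow> 'a) set" where
  "tensor_ker R M N = submod_gen R (tensor_free R M N) (tensor_rels R M N)"

definition tensor_module ::
  "('a, 'r) ring_scheme \<Rightarrow> ('a, 'b) module \<Rightarrow> ('a, 'c) module \<Rightarrow> ('a, ('b \<times> 'c \<Rightarrow> 'a) set) module"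
  where "tensor_module R M N = quot_module (tensor_free R M N) (tensor_ker R M N)"

text \<open>\<open>tensor_map R M' N' f g\<close> is \<open>f \<otimes> g\<close> for \<open>f : M \<rightarrow> M'\<close>, \<open>g : N \<rightarrow> N'\<close>.\<close>

definition tensor_map ::
  "('a, 'r) ring_scheme \<Rightarrow> ('a, 'd) module \<Rightarrow> ('a, 'e) module \<Rightarrow> ('b \<Rightarrow> 'd) \<Rightarrow> ('c \<Rightarrow> 'e)
     \<Rightarrow> ('b \<times> 'c \<Rightarrow> 'a) set \<Rightarrow> ('d \<times> 'e \<Rightarrow> 'a) set" where
  "tensor_map R M' N' f g = coset_map (tensor_free R M' N') (tensor_ker R M' N')
     (lin_ext R (tensor_free R M' N') (\<lambda>(x, y). free_gen R (f x, g y)))"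


section \<open>Complexes\<close>

text \<open>Cohomological indexing: \<open>cx_diff X n : X\<^sup>n \<rightarrow> X\<^sup>n\<^sup>+\<^sup>1\<close>.\<close>

record ('a, 'b) cpx =
  cx_mod :: "int \<Rightarrow> ('a, 'b) module"
  cx_diff :: "int \<Rightarrow> 'b \<Rightarrow> 'b"

type_synonym 'b cmap = "int \<Rightarrow> 'b \<Rightarrow> 'b"

definition is_cpx :: "('a, 'r) ring_scheme \<Rightarrow> ('a, 'b) cpx \<Rightarrow> bool" where
  "is_cpx R X \<longleftrightarrow> (\<forall>n. Module.module R (cx_mod X n)) \<and>
     (\<forall>n. cx_diff X n \<in> mod_hom R (cx_mod X n) (cx_mod X (n + 1))) \<and>
     (\<forall>n. \<forall>x\<in>carrier (cx_mod X n). cx_diff X (n + 1) (cx_diff X n x) = \<zero>\<^bsub>cx_mod X (n + 2)\<^esub>)"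

definition chain_map ::
  "('a, 'r) ring_scheme \<Rightarrow> ('a, 'b) cpx \<Rightarrow> ('a, 'c) cpx \<Rightarrow> (int \<Rightarrow> 'b \<Rightarrow> 'c) \<Rightarrow> bool" where
  "chain_map R X Y f \<longleftrightarrow> (\<forall>n. f n \<in> mod_hom R (cx_mod X n) (cx_mod Y n)) \<and>
     (\<forall>n. \<forall>x\<in>carrier (cx_mod X n). f (n + 1) (cx_diff X n x) = cx_diff Y n (f n x))"

definition cpx_iso ::
  "('a, 'r) ring_scheme \<Rightarrow> ('a, 'b) cpx \<Rightarrow> ('a, 'c) cpx \<Rightarrow> (int \<Rightarrow> 'b \<Rightarrow> 'c) \<Rightarrow> bool" where
  "cpx_iso R X Y f \<longleftrightarrow> chain_map R X Y f \<and> (\<forall>n. f n \<in> mod_iso R (cx_mod X n) (cx_mod Y n))"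

definition homotopic ::
  "('a, 'r) ring_scheme \<Rightarrow> ('a, 'b) cpx \<Rightarrow> ('a, 'c) cpx
     \<Rightarrow> (int \<Rightarrow> 'b \<Rightarrow> 'c) \<Rightarrow> (int \<Rightarrow> 'b \<Rightarrow> 'c) \<Rightarrow> bool" where
  "homotopic R X Y f g \<longleftrightarrow> (\<exists>h. (\<forall>n. h n \<in> mod_hom R (cx_mod X n) (cx_mod Y (n - 1))) \<and>
     (\<forall>n. \<forall>x\<in>carrier (cx_mod X n).
        f n x \<ominus>\<^bsub>cx_mod Y n\<^esub> g n x =
          cx_diff Y (n - 1) (h n x) \<oplus>\<^bsub>cx_mod Y n\<^esub> h (n + 1) (cx_diff X n x)))"

definition cocycles :: "('a, 'b) cpx \<Rightarrow> int \<Rightarrow> ('a, 'b) module" where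
  "cocycles X n = (cx_mod X n)\<lparr>carrier :=
     {x\<in>carrier (cx_mod X n). cx_diff X n x = \<zero>\<^bsub>cx_mod X (n + 1)\<^esub>}\<rparr>"

definition coboundaries :: "('a, 'b) cpx \<Rightarrow> int \<Rightarrow> 'b set" where
  "coboundaries X n = cx_diff X (n - 1) ` carrier (cx_mod X (n - 1))"

definition cohomology :: "('a, 'b) cpx \<Rightarrow> int \<Rightarrow> ('a, 'b set) module" where
  "cohomology X n = quot_module (cocycles X n) (coboundaries X n)"

definition quasi_iso ::
  "('a, 'r) ring_scheme \<Rightarrow> ('a, 'b) cpx \<Rightarrow> ('a, 'c) cpx \<Rightarrow> (int \<Rightarrow> 'b \<Rightarrow> 'c) \<Rightarrow> bool" where
  "quasi_iso R X Y f \<longleftrightarrow> chain_map R X Y f \<and>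
     (\<forall>n. coset_map (cocycles Y n) (coboundaries Y n) (f n)
            \<in> mod_iso R (cohomology X n) (cohomology Y n))"

definition shift_cpx :: "('a, 'b) cpx \<Rightarrow> ('a, 'b) cpx" where
  "shift_cpx X = \<lparr>cx_mod = (\<lambda>n. cx_mod X (n + 1)),
     cx_diff = (\<lambda>n x. \<ominus>\<^bsub>cx_mod X (n + 2)\<^esub> cx_diff X (n + 1) x)\<rparr>"

definition mapping_cone :: "('a, 'b) cpx \<Rightarrow> ('a, 'c) cpx \<Rightarrow> (int \<Rightarrow> 'b \<Rightarrow> 'c) \<Rightarrow> ('a, 'b \<times> 'c) cpx" where
  "mapping_cone X Y f = \<lparr>cx_mod = (\<lambda>n. prod_module (cx_mod X (n + 1)) (cx_mod Y n)),
     cx_diff = (\<lambda>n (x, y). (\<ominus>\<^bsub>cx_mod X (n + 2)\<^esub> cx_diff X (n + 1) x,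
                          f (n + 1) x \<oplus>\<^bsub>cx_mod Y (n + 1)\<^esub> cx_diff Y n y))\<rparr>"

text \<open>
  The total complex of \<open>P \<otimes> Q\<close>: degree \<open>n\<close> is the direct sum over \<open>i\<close> of
  \<open>P\<^sup>i \<otimes> Q\<^sup>n\<^sup>-\<^sup>i\<close>, and \<open>d(x \<otimes> y) = d x \<otimes> y + (-1)\<^sup>i x \<otimes> d y\<close> for \<open>x \<in> P\<^sup>i\<close>. Below, the
  component at \<open>i\<close> of the differential of \<open>z\<close> is assembled from \<open>z (i - 1)\<close> and \<open>z i\<close>.
\<close>

definition tot_tensor :: "('a, 'r) ring_scheme \<Rightarrow> ('a, 'b) cpx \<Rightarrow> ('a, 'c) cpx
     \<Rightarrow> ('a, int \<Rightarrow> ('b \<times> 'c \<Rightarrow> 'a) set) cpx" where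
  "tot_tensor R P Q = \<lparr>
     cx_mod = (\<lambda>n. dsum_module (\<lambda>i. tensor_module R (cx_mod P i) (cx_mod Q (n - i)))),
     cx_diff = (\<lambda>n z i.
       let N = tensor_module R (cx_mod P i) (cx_mod Q (n + 1 - i));
           u = tensor_map R (cx_mod P i) (cx_mod Q (n + 1 - i)) (cx_diff P (i - 1)) (\<lambda>y. y) (z (i - 1));
           v = tensor_map R (cx_mod P i) (cx_mod Q (n + 1 - i)) (\<lambda>x. x) (cx_diff Q (n - i)) (z i)
       in u \<oplus>\<^bsub>N\<^esub> (if even i then v else \<ominus>\<^bsub>N\<^esub> v))\<rparr>"


section \<open>The right bounded derived category\<close>

text \<open>
  A small model of the category of finitely generated \<open>R\<close>-modules: those whose carrier is a set
  of elements of the type \<open>(nat \<Rightarrow> 'a) set\<close>. Every finitely generated \<open>R\<close>-module is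
  isomorphic to one of these, because the fibres of a surjection from \<open>R\<^sup>k\<close> are elements of this
  type; see \<open>fg_module_small_model\<close> below.
\<close>

type_synonym 'a elt = "(nat \<Rightarrow> 'a) set"
type_synonym 'a dcpx = "('a, 'a elt) cpx"

lemma module_transport:
  fixes M :: "('a, 'b) module" and F :: "'b \<Rightarrow> 'c"
  assumes M: "Module.module R M" and inj: "inj_on F (carrier M)"
  defines "G \<equiv> inv_into (carrier M) F"
  defines "N \<equiv> mk_module (F ` carrier M) (F \<zero>\<^bsub>M\<^esub>)
      (\<lambda>u v. F (G u \<oplus>\<^bsub>M\<^esub> G v)) (\<lambda>a u. F (a \<odot>\<^bsub>M\<^esub> G u))"
  shows "Module.module R N" and "F \<in> mod_iso R M N"
proof -
  interpret M: Module.module R M by (rule M)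
  have GF: "G (F x) = x" if "x \<in> carrier M" for x
    unfolding G_def using inj that by simp
  have sel: "carrier N = F ` carrier M" "\<zero>\<^bsub>N\<^esub> = F \<zero>\<^bsub>M\<^esub>"
    unfolding N_def mk_module_def by simp_all
  have add: "F x \<oplus>\<^bsub>N\<^esub> F y = F (x \<oplus>\<^bsub>M\<^esub> y)" if "x \<in> carrier M" "y \<in> carrier M" for x y
    unfolding N_def mk_module_def by (simp add: GF that)
  have sm: "a \<odot>\<^bsub>N\<^esub> F x = F (a \<odot>\<^bsub>M\<^esub> x)" if "x \<in> carrier M" for a x
    unfolding N_def mk_module_def by (simp add: GF that)
  have "abelian_group N"
  proof (rule abelian_groupI)
    fix u assume "u \<in> carrier N"
    then obtain x where x: "x \<in> carrier M" "u = F x" by (auto simp: sel)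
    show "\<exists>y\<in>carrier N. y \<oplus>\<^bsub>N\<^esub> u = \<zero>\<^bsub>N\<^esub>"
      by (rule bexI[of _ "F (\<ominus>\<^bsub>M\<^esub> x)"]) (use x in \<open>auto simp: sel add M.M.l_neg\<close>)
  qed (auto simp: sel add M.M.a_ac)
  then show "Module.module R N"
    by (intro Module.moduleI M.is_cring)
      (auto simp: sel add sm M.smult_l_distr M.smult_r_distr M.smult_assoc1)
  show "F \<in> mod_iso R M N"
    using inj by (auto simp: mod_iso_def mod_hom_def bij_betw_def sel add sm)
qed

lemma fg_module_small_model:
  fixes M :: "('a, 'b) module"
  assumes "fg_module R M"
  obtains N :: "('a, 'a elt) module" and F where "fg_module R N" "F \<in> mod_iso R M N"
proof -
  from assms obtain A where M: "Module.module R M" and A: "finite A" "A \<subseteq> carrier M"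
    "submod_gen R M A = carrier M" by (auto simp: fg_module_def)
  interpret M: Module.module R M by (rule M)
  obtain xs where xs: "set xs = A" using A(1) finite_list by blast
  have xsc: "xs ! i \<in> carrier M" if "i < length xs" for i
    using that xs A(2) nth_mem by blast
  define C where "C = {c :: nat \<Rightarrow> 'a. \<forall>i. c i \<in> carrier R}"
  define ev where "ev c = finsum M (\<lambda>i. c i \<odot>\<^bsub>M\<^esub> xs ! i) {..<length xs}" for c
  define F where "F m = {c\<in>C. ev c = m}" for m
  have evc: "ev c \<in> carrier M" if "c \<in> C" for c
    unfolding ev_def using that xsc by (auto simp: C_def intro!: M.M.finsum_closed)
  have ev_add: "ev (\<lambda>i. c i \<oplus>\<^bsub>R\<^esub> d i) = ev c \<oplus>\<^bsub>M\<^esub> ev d" if "c \<in> C" "d \<in> C" for c d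
  proof -
    have "ev (\<lambda>i. c i \<oplus>\<^bsub>R\<^esub> d i) =
        finsum M (\<lambda>i. c i \<odot>\<^bsub>M\<^esub> xs ! i \<oplus>\<^bsub>M\<^esub> d i \<odot>\<^bsub>M\<^esub> xs ! i) {..<length xs}"
      unfolding ev_def using that xsc
      by (intro M.M.finsum_cong') (auto simp: C_def M.smult_l_distr)
    also have "\<dots> = ev c \<oplus>\<^bsub>M\<^esub> ev d"
      unfolding ev_def using that xsc by (intro M.M.finsum_addf) (auto simp: C_def)
    finally show ?thesis .
  qed
  have ev_sm: "ev (\<lambda>i. a \<otimes>\<^bsub>R\<^esub> c i) = a \<odot>\<^bsub>M\<^esub> ev c" if "a \<in> carrier R" "c \<in> C" for a c
  proof -
    have "a \<odot>\<^bsub>M\<^esub> ev c = finsum M (\<lambda>i. a \<odot>\<^bsub>M\<^esub> (c i \<odot>\<^bsub>M\<^esub> xs ! i)) {..<length xs}"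
      unfolding ev_def using that xsc by (intro M.finsum_smult_ldistr) (auto simp: C_def)
    also have "\<dots> = ev (\<lambda>i. a \<otimes>\<^bsub>R\<^esub> c i)"
      unfolding ev_def using that xsc
      by (intro M.M.finsum_cong') (auto simp: C_def M.smult_assoc1)
    finally show ?thesis by simp
  qed
  have "submodule (ev ` C) R M"
  proof (rule M.submoduleI)
    have "ev (\<lambda>i. \<zero>\<^bsub>R\<^esub>) = \<zero>\<^bsub>M\<^esub>"
      unfolding ev_def by (rule M.M.add.finprod_one_eqI) (use xsc in auto)
    then show "\<zero>\<^bsub>M\<^esub> \<in> ev ` C" by (intro image_eqI[of _ _ "\<lambda>i. \<zero>\<^bsub>R\<^esub>"]) (auto simp: C_def)
    show "\<ominus>\<^bsub>M\<^esub> u \<in> ev ` C" if "u \<in> ev ` C" for u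
    proof -
      from that obtain c where c: "c \<in> C" "u = ev c" by auto
      have "\<ominus>\<^bsub>M\<^esub> u = (\<ominus>\<^bsub>R\<^esub> \<one>\<^bsub>R\<^esub>) \<odot>\<^bsub>M\<^esub> ev c"
        using c evc by (simp add: M.smult_l_minus)
      also have "\<dots> = ev (\<lambda>i. (\<ominus>\<^bsub>R\<^esub> \<one>\<^bsub>R\<^esub>) \<otimes>\<^bsub>R\<^esub> c i)"
        by (rule ev_sm[symmetric]) (use c in auto)
      finally show ?thesis using c(1) by (auto simp: C_def intro!: image_eqI)
    qed
    show "u \<oplus>\<^bsub>M\<^esub> v \<in> ev ` C" if u: "u \<in> ev ` C" and v: "v \<in> ev ` C" for u v
    proof -
      from u obtain c where c: "c \<in> C" "u = ev c" by auto
      from v obtain d where d: "d \<in> C" "v = ev d" by auto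
      have "(\<lambda>i. c i \<oplus>\<^bsub>R\<^esub> d i) \<in> C" using c(1) d(1) by (auto simp: C_def)
      then show ?thesis using ev_add[OF c(1) d(1)] c d by (metis imageI)
    qed
    show "a \<odot>\<^bsub>M\<^esub> u \<in> ev ` C" if a: "a \<in> carrier R" and u: "u \<in> ev ` C" for a u
    proof -
      from u obtain c where c: "c \<in> C" "u = ev c" by auto
      have "(\<lambda>i. a \<otimes>\<^bsub>R\<^esub> c i) \<in> C" using c(1) a by (auto simp: C_def)
      then show ?thesis using ev_sm[OF a c(1)] c by (metis imageI)
    qed
  qed (auto simp: evc)
  moreover have "A \<subseteq> ev ` C"
  proof
    fix x assume "x \<in> A"
    then obtain j where j: "j < length xs" "xs ! j = x" using xs by (metis in_set_conv_nth)
    define c where "c i = (if i = j then \<one>\<^bsub>R\<^esub> else \<zero>\<^bsub>R\<^esub>)" for i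
    have "ev c = finsum M (\<lambda>i. if j = i then xs ! i else \<zero>\<^bsub>M\<^esub>) {..<length xs}"
      unfolding ev_def using xsc by (intro M.M.finsum_cong') (auto simp: c_def)
    also have "\<dots> = x" using j xsc by (subst M.M.finsum_singleton) auto
    finally show "x \<in> ev ` C" by (intro image_eqI[of _ _ c]) (auto simp: C_def c_def)
  qed
  ultimately have surj: "carrier M \<subseteq> ev ` C" using A(3) by (auto simp: submod_gen_def)
  have inj: "inj_on F (carrier M)"
  proof
    fix x y assume "x \<in> carrier M" "y \<in> carrier M" and e: "F x = F y"
    then obtain c where "c \<in> C" "ev c = x" using surj by auto
    then have "c \<in> F y" using e by (auto simp: F_def)
    then show "x = y" using \<open>ev c = x\<close> by (simp add: F_def)
  qed
  obtain N :: "('a, 'a elt) module" where N: "Module.module R N" and iso: "F \<in> mod_iso R M N"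
    using module_transport[OF M inj] by blast
  interpret N: Module.module R N by (rule N)
  have hom: "\<And>x. x \<in> carrier M \<Longrightarrow> F x \<in> carrier N"
    "\<And>x y. x \<in> carrier M \<Longrightarrow> y \<in> carrier M \<Longrightarrow> F (x \<oplus>\<^bsub>M\<^esub> y) = F x \<oplus>\<^bsub>N\<^esub> F y"
    "\<And>a x. a \<in> carrier R \<Longrightarrow> x \<in> carrier M \<Longrightarrow> F (a \<odot>\<^bsub>M\<^esub> x) = a \<odot>\<^bsub>N\<^esub> F x"
    "F ` carrier M = carrier N"
    using iso by (auto simp: mod_iso_def mod_hom_def bij_betw_def)
  have F0: "F \<zero>\<^bsub>M\<^esub> = \<zero>\<^bsub>N\<^esub>"
    using hom(3)[of "\<zero>\<^bsub>R\<^esub>" "\<zero>\<^bsub>M\<^esub>"] hom(1)[of "\<zero>\<^bsub>M\<^esub>"] by simp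
  have Fm: "F (\<ominus>\<^bsub>M\<^esub> x) = \<ominus>\<^bsub>N\<^esub> F x" if "x \<in> carrier M" for x
    using hom(3)[of "\<ominus>\<^bsub>R\<^esub> \<one>\<^bsub>R\<^esub>" x] hom(1)[of x] that
    by (simp add: M.smult_l_minus N.smult_l_minus)
  have "submod_gen R N (F ` A) = carrier N"
  proof
    show "submod_gen R N (F ` A) \<subseteq> carrier N"
      unfolding submod_gen_def using N.carrier_is_submodule hom(1) A(2) by (intro Inter_lower) auto
    show "carrier N \<subseteq> submod_gen R N (F ` A)"
      unfolding submod_gen_def
    proof safe
      fix u H assume u: "u \<in> carrier N" and H: "submodule H R N" "F ` A \<subseteq> H"
      note HE = N.submoduleE[OF H(1)]
      have "\<zero>\<^bsub>N\<^esub> \<in> H"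
        using HE(1,2) HE(4)[of "\<zero>\<^bsub>R\<^esub>"] by (metis M.R.zero_closed N.smult_l_null all_not_in_conv subsetD)
      then have "submodule {x\<in>carrier M. F x \<in> H} R M"
        using HE(3,4,5) by (intro M.submoduleI) (auto simp: hom F0 Fm)
      then have "carrier M \<subseteq> {x\<in>carrier M. F x \<in> H}"
        using A(2,3) H(2) unfolding submod_gen_def by blast
      moreover obtain x where "x \<in> carrier M" "u = F x" using u hom(4) by (metis imageE)
      ultimately show "u \<in> H" by blast
    qed
  qed
  then have "fg_module R N"
    unfolding fg_module_def using N A(1,2) hom(1) by (intro conjI exI[of _ "F ` A"]) auto
  with iso show thesis by (rule that[rotated])
qed

definition Dminus_ob :: "('a, 'r) ring_scheme \<Rightarrow> 'a dcpx set" where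
  "Dminus_ob R = {X. is_cpx R X \<and> (\<forall>n. fg_module R (cx_mod X n)) \<and>
     (\<exists>N. \<forall>n>N. carrier (cohomology X n) = {\<zero>\<^bsub>cohomology X n\<^esub>})}"

text \<open>
  The derived category is the localization of the homotopy category at the quasi-isomorphisms.
  A roof \<open>(Z, s, f)\<close> stands for the morphism \<open>f s\<^sup>-\<^sup>1\<close> given by
  \<open>X \<leftarrow> Z \<rightarrow> Y\<close> with \<open>s\<close> a quasi-isomorphism; a morphism is an equivalence class of roofs.
\<close>

type_synonym 'a roof = "'a dcpx \<times> 'a elt cmap \<times> 'a elt cmap"

definition roofs :: "('a, 'r) ring_scheme \<Rightarrow> 'a dcpx \<Rightarrow> 'a dcpx \<Rightarrow> 'a roof set" where
  "roofs R X Y = {(Z, s, f). Z \<in> Dminus_ob R \<and> quasi_iso R Z X s \<and> chain_map R Z Y f}"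

definition roof_equiv ::
  "('a, 'r) ring_scheme \<Rightarrow> 'a dcpx \<Rightarrow> 'a dcpx \<Rightarrow> 'a roof \<Rightarrow> 'a roof \<Rightarrow> bool" where
  "roof_equiv R X Y = (\<lambda>(Z, s, f) (Z', s', f').
     \<exists>W\<in>Dminus_ob R. \<exists>u u'. chain_map R W Z u \<and> chain_map R W Z' u' \<and>
       quasi_iso R W X (\<lambda>n. s n \<circ> u n) \<and>
       homotopic R W X (\<lambda>n. s n \<circ> u n) (\<lambda>n. s' n \<circ> u' n) \<and>
       homotopic R W Y (\<lambda>n. f n \<circ> u n) (\<lambda>n. f' n \<circ> u' n))"

definition roof_class ::
  "('a, 'r) ring_scheme \<Rightarrow> 'a dcpx \<Rightarrow> 'a dcpx \<Rightarrow> 'a roof \<Rightarrow> 'a roof set" where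
  "roof_class R X Y r = {r'\<in>roofs R X Y. roof_equiv R X Y r r'}"

definition Dminus_mor :: "('a, 'r) ring_scheme \<Rightarrow> 'a dcpx \<Rightarrow> 'a dcpx \<Rightarrow> 'a roof set set" where
  "Dminus_mor R X Y = roof_class R X Y ` roofs R X Y"

definition loc :: "('a, 'r) ring_scheme \<Rightarrow> 'a dcpx \<Rightarrow> 'a dcpx \<Rightarrow> 'a elt cmap \<Rightarrow> 'a roof set" where
  "loc R X Y f = roof_class R X Y (X, (\<lambda>n x. x), f)"

text \<open>
  Roofs \<open>X \<leftarrow> Z \<rightarrow> Y\<close> and \<open>Y \<leftarrow> W \<rightarrow> V\<close> are composed by completing
  \<open>Z \<rightarrow> Y \<leftarrow> W\<close> to a square, commutative up to homotopy, with vertex \<open>U\<close>. The class obtained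
  does not depend on the choices, so the union below is a single class.
\<close>

definition Dminus_comp ::
  "('a, 'r) ring_scheme \<Rightarrow> 'a dcpx \<Rightarrow> 'a dcpx \<Rightarrow> 'a dcpx
     \<Rightarrow> 'a roof set \<Rightarrow> 'a roof set \<Rightarrow> 'a roof set" where
  "Dminus_comp R X Y V \<beta> \<alpha> =
     \<Union>{roof_class R X V (U, (\<lambda>n. s n \<circ> t' n), (\<lambda>n. g n \<circ> f' n)) | U s t' g f'.
        \<exists>Z f W t. (Z, s, f) \<in> \<alpha> \<and> (W, t, g) \<in> \<beta> \<and> U \<in> Dminus_ob R \<and>
          quasi_iso R U Z t' \<and> chain_map R U W f' \<and>
          homotopic R U Y (\<lambda>n. f n \<circ> t' n) (\<lambda>n. t n \<circ> f' n)}"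

definition shift_mor ::
  "('a, 'r) ring_scheme \<Rightarrow> 'a dcpx \<Rightarrow> 'a dcpx \<Rightarrow> 'a roof set \<Rightarrow> 'a roof set" where
  "shift_mor R X Y \<alpha> =
     \<Union>{roof_class R (shift_cpx X) (shift_cpx Y) (shift_cpx Z, (\<lambda>n. s (n + 1)), (\<lambda>n. f (n + 1)))
        | Z s f. (Z, s, f) \<in> \<alpha>}"

text \<open>
  The standard triangle \<open>A \<rightarrow> B \<rightarrow> C \<rightarrow> A[1]\<close> of a chain map \<open>u\<close>, where \<open>\<phi>\<close> identifies the
  mapping cone of \<open>u\<close> with a complex \<open>C\<close> of the small model.
\<close>

definition std_triangle :: "('a, 'r) ring_scheme \<Rightarrow> 'a dcpx \<Rightarrow> 'a dcpx \<Rightarrow> 'a dcpx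
     \<Rightarrow> 'a roof set \<Rightarrow> 'a roof set \<Rightarrow> 'a roof set \<Rightarrow> bool" where
  "std_triangle R A B C f g h \<longleftrightarrow> A \<in> Dminus_ob R \<and> B \<in> Dminus_ob R \<and> C \<in> Dminus_ob R \<and>
     (\<exists>u \<phi>. chain_map R A B u \<and> cpx_iso R (mapping_cone A B u) C \<phi> \<and>
        f = loc R A B u \<and>
        g = loc R B C (\<lambda>n y. \<phi> n (\<zero>\<^bsub>cx_mod A (n + 1)\<^esub>, y)) \<and>
        h = loc R C (shift_cpx A)
              (\<lambda>n z. fst (inv_into (carrier (cx_mod (mapping_cone A B u) n)) (\<phi> n) z)))"

text \<open>The category without its triangles and tensor product, which are added below.\<close>

definition Dminus_cat :: "('a, 'r) ring_scheme \<Rightarrow> ('a dcpx, 'a roof set) ttcat" where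
  "Dminus_cat R = \<lparr>Ob = Dminus_ob R, Mor = Dminus_mor R, Idt = (\<lambda>X. loc R X X (\<lambda>n x. x)),
     Cmp = Dminus_comp R, Shf = shift_cpx, Tri = {}, Tns = (\<lambda>_ _ _. False)\<rparr>"

definition Dminus_tri :: "('a, 'r) ring_scheme \<Rightarrow>
     ('a dcpx \<times> 'a dcpx \<times> 'a dcpx \<times> 'a roof set \<times> 'a roof set \<times> 'a roof set) set" where
  "Dminus_tri R = {(X, Y, Z, f, g, h).
     X \<in> Dminus_ob R \<and> Y \<in> Dminus_ob R \<and> Z \<in> Dminus_ob R \<and>
     f \<in> Dminus_mor R X Y \<and> g \<in> Dminus_mor R Y Z \<and> h \<in> Dminus_mor R Z (shift_cpx X) \<and>
     (\<exists>A B C f' g' h' a b c. std_triangle R A B C f' g' h' \<and>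
        iso_mor (Dminus_cat R) X A a \<and> iso_mor (Dminus_cat R) Y B b \<and>
        iso_mor (Dminus_cat R) Z C c \<and>
        Dminus_comp R X Y B b f = Dminus_comp R X A B f' a \<and>
        Dminus_comp R Y Z C c g = Dminus_comp R Y B C g' b \<and>
        Dminus_comp R Z (shift_cpx X) (shift_cpx A) (shift_mor R X A a) h
          = Dminus_comp R Z C (shift_cpx A) h' c)}"

text \<open>
  The derived tensor product of \<open>X\<close> and \<open>Y\<close> is the total tensor product of resolutions by
  bounded above complexes of finitely generated free modules; these exist because \<open>R\<close> is
  noetherian. Both factors are resolved since an object need not itself vanish in large degrees.
\<close>

definition free_resolution ::
  "('a, 'r) ring_scheme \<Rightarrow> 'a dcpx \<Rightarrow> 'a elt cmap \<Rightarrow> 'a dcpx \<Rightarrow> bool" where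
  "free_resolution R P f X \<longleftrightarrow> is_cpx R P \<and> (\<forall>n. fin_free R (cx_mod P n)) \<and>
     (\<exists>N. \<forall>n>N. carrier (cx_mod P n) = {\<zero>\<^bsub>cx_mod P n\<^esub>}) \<and> quasi_iso R P X f"

definition derived_tensor ::
  "('a, 'r) ring_scheme \<Rightarrow> 'a dcpx \<Rightarrow> 'a dcpx \<Rightarrow> 'a dcpx \<Rightarrow> bool" where
  "derived_tensor R X Y Z \<longleftrightarrow>
     X \<in> Dminus_ob R \<and> Y \<in> Dminus_ob R \<and> Z \<in> Dminus_ob R \<and>
     (\<exists>P f Q g \<phi>. free_resolution R P f X \<and> free_resolution R Q g Y \<and>
        cpx_iso R (tot_tensor R P Q) Z \<phi>)"

definition Dminus :: "('a, 'r) ring_scheme \<Rightarrow> ('a dcpx, 'a roof set) ttcat" where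
  "Dminus R = (Dminus_cat R)\<lparr>Tri := Dminus_tri R, Tns := derived_tensor R\<rparr>"

end

theory Submission
  imports Defs
begin

text \<open>
  For a prime \<open>p\<close>, the complexes \<open>X\<close> with \<open>X\<^sub>p = 0\<close> form a prime tensor ideal \<open>S(p)\<close>: if the
  cohomology of \<open>X\<^sub>p\<close> and of \<open>Y\<^sub>p\<close> does not vanish, then by Nakayama's lemma neither does the product
  of the top cohomology modules, which is the top cohomology of \<open>(X \<otimes> Y)\<^sub>p\<close>. Sums
  \<open>X\<^sub>k = \<Oplus>\<^sub>i\<^sub>\<ge>\<^sub>k R/p\<^sub>i[i]\<close> of infinitely many shifted cyclic modules are right bounded. If
  the \<open>p\<^sub>i\<close> are pairwise incomparable, then \<open>S(p\<^sub>m) \<in> U(X\<^sub>k)\<close> exactly for \<open>m < k\<close>, so the unions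
  \<open>U(X\<^sub>0) \<union> \<dots> \<union> U(X\<^sub>n)\<close> form a strictly ascending chain of open sets.

  It remains to find an infinite antichain in an infinite \<open>Spec R\<close>. Let \<open>p\<close> be maximal among the
  ideals contained in infinitely many primes; \<open>p\<close> is prime. By Krull's principal ideal
  theorem every prime strictly above \<open>p\<close> contains one of height one over \<open>p\<close>, and each of these is
  contained in finitely many primes only, so there are infinitely many of them.
\<close>

section \<open>Primes in noetherian rings\<close>

text \<open>Right bounded complexes may have cohomology in infinitely many degrees, so the support
  of X_k is an infinite union of closed sets V(p_i) and need not be closed itself; the strictly
  ascending chain of open sets comes from this. The hard point is that S(p) is prime. Comparing the
  top cohomology of the total complex with a tensor product of cohomology modules over R_p would
  need a Kuenneth argument for localised modules. A dual form replaces it: failure of local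
  exactness in degree a is witnessed by a linear map \<alpha> from P^a to R that sends coboundaries
  into p and some cocycle outside p. Then \<alpha> \<otimes> \<beta> does the same for the total
  complex, by a computation on pure tensors. The map \<alpha> has to live on all of P^a and not only
  on cocycles, because \<alpha> \<otimes> \<beta> is evaluated on arbitrary elements of P^a
  \<otimes> Q^b. This dictates the use of free modules and of the top degree: above it the complex
  is locally exact, hence locally split, so the cocycles are locally a direct summand of P^a.
  Nakayama's lemma survives as the choice of a maximal set of generators that still fails to
  generate.\<close>

text \<open>The localisation \<open>R\<^sub>q\<close> is not constructed; \<open>loc_sat R q I\<close> is the preimage of \<open>I R\<^sub>q\<close> in \<open>R\<close>.\<close>

definition loc_sat :: "('a, 'r) ring_scheme \<Rightarrow> 'a set \<Rightarrow> 'a set \<Rightarrow> 'a set" where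
  "loc_sat R q I = {a\<in>carrier R. \<exists>s\<in>carrier R - q. s \<otimes>\<^bsub>R\<^esub> a \<in> I}"

lemma loc_satI: "\<lbrakk>s \<in> carrier R - q; s \<otimes>\<^bsub>R\<^esub> a \<in> I; a \<in> carrier R\<rbrakk> \<Longrightarrow> a \<in> loc_sat R q I"
  by (auto simp: loc_sat_def)

lemma loc_satE:
  assumes "a \<in> loc_sat R q I"
  obtains s where "s \<in> carrier R - q" "s \<otimes>\<^bsub>R\<^esub> a \<in> I" "a \<in> carrier R"
  using assms by (auto simp: loc_sat_def)

lemma primeidealE:
  assumes "primeideal q R"
  shows "ideal q R" "\<And>a. a \<in> q \<Longrightarrow> a \<in> carrier R" "\<one>\<^bsub>R\<^esub> \<notin> q" "\<zero>\<^bsub>R\<^esub> \<in> q"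
    "\<And>a b. \<lbrakk>a \<in> carrier R; b \<in> carrier R; a \<otimes>\<^bsub>R\<^esub> b \<in> q\<rbrakk> \<Longrightarrow> a \<in> q \<or> b \<in> q"
    "\<And>s t. \<lbrakk>s \<in> carrier R - q; t \<in> carrier R - q\<rbrakk> \<Longrightarrow> s \<otimes>\<^bsub>R\<^esub> t \<in> carrier R - q"
proof -
  interpret primeideal q R by (rule assms)
  show "ideal q R" by (rule is_ideal)
  show "a \<in> q \<Longrightarrow> a \<in> carrier R" for a by (rule Icarr)
  show "\<one>\<^bsub>R\<^esub> \<notin> q" using one_imp_carrier I_notcarr by blast
  show "\<zero>\<^bsub>R\<^esub> \<in> q" by simp
  show "\<lbrakk>a \<in> carrier R; b \<in> carrier R; a \<otimes>\<^bsub>R\<^esub> b \<in> q\<rbrakk> \<Longrightarrow> a \<in> q \<or> b \<in> q" for a b by (rule I_prime)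
  then show "\<lbrakk>s \<in> carrier R - q; t \<in> carrier R - q\<rbrakk> \<Longrightarrow> s \<otimes>\<^bsub>R\<^esub> t \<in> carrier R - q" for s t by auto
qed

section \<open>Arithmetic of ideals and of their localisations\<close>

context cring
begin

lemma idealI':
  assumes "I \<subseteq> carrier R" "\<zero> \<in> I" "\<And>a b. \<lbrakk>a \<in> I; b \<in> I\<rbrakk> \<Longrightarrow> a \<oplus> b \<in> I"
    "\<And>a x. \<lbrakk>a \<in> I; x \<in> carrier R\<rbrakk> \<Longrightarrow> x \<otimes> a \<in> I"
  shows "ideal I R"
proof (rule idealI)
  show "ring R" by (rule ring_axioms)
  have "\<ominus> a \<in> I" if "a \<in> I" for a
  proof -
    have "(\<ominus> \<one>) \<otimes> a \<in> I" using assms(4)[OF that] by simp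
    moreover have "(\<ominus> \<one>) \<otimes> a = \<ominus> a" using that assms(1) by (simp add: l_minus subset_iff)
    ultimately show ?thesis by simp
  qed
  then show "subgroup I (add_monoid R)"
    using assms by (intro add.subgroupI) auto
  show "x \<otimes> a \<in> I" if "a \<in> I" "x \<in> carrier R" for a x using assms(4) that by blast
  then show "a \<otimes> x \<in> I" if "a \<in> I" "x \<in> carrier R" for a x
    using assms(4)[OF that] m_comm[of a x] that assms(1) by auto
qed

lemma idealE:
  assumes "ideal I R"
  shows "I \<subseteq> carrier R" "\<zero> \<in> I" "\<And>a b. \<lbrakk>a \<in> I; b \<in> I\<rbrakk> \<Longrightarrow> a \<oplus> b \<in> I"
    "\<And>a b. \<lbrakk>a \<in> I; b \<in> I\<rbrakk> \<Longrightarrow> a \<ominus> b \<in> I"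
    "\<And>a x. \<lbrakk>a \<in> I; x \<in> carrier R\<rbrakk> \<Longrightarrow> x \<otimes> a \<in> I"
    "\<And>a x. \<lbrakk>a \<in> I; x \<in> carrier R\<rbrakk> \<Longrightarrow> a \<otimes> x \<in> I"
proof -
  interpret ideal I R by (rule assms)
  show "I \<subseteq> carrier R" by (rule a_subset)
  show "\<zero> \<in> I" by simp
  show "\<lbrakk>a \<in> I; b \<in> I\<rbrakk> \<Longrightarrow> a \<oplus> b \<in> I" for a b by simp
  show "\<lbrakk>a \<in> I; b \<in> I\<rbrakk> \<Longrightarrow> a \<ominus> b \<in> I" for a b by (simp add: a_minus_def)
  show "\<lbrakk>a \<in> I; x \<in> carrier R\<rbrakk> \<Longrightarrow> x \<otimes> a \<in> I" for a x by (rule I_l_closed)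
  show "\<lbrakk>a \<in> I; x \<in> carrier R\<rbrakk> \<Longrightarrow> a \<otimes> x \<in> I" for a x by (rule I_r_closed)
qed

lemma add_eq_imp_minus_eq:
  assumes "u = v \<oplus> w" "v \<in> carrier R" "w \<in> carrier R"
  shows "w = u \<ominus> v"
proof -
  have "u \<ominus> v = (\<ominus> v \<oplus> v) \<oplus> w" unfolding assms(1) using assms(2,3) by (simp add: a_minus_def a_ac)
  then show ?thesis using assms(2,3) by (simp add: l_neg)
qed

lemma mem_add_PIdl:
  "c \<in> I <+>\<^bsub>R\<^esub> PIdl a \<longleftrightarrow> (\<exists>i\<in>I. \<exists>r\<in>carrier R. c = i \<oplus> r \<otimes> a)"
  by (auto simp: set_add_def' cgenideal_def)

lemma ideal_add_PIdl:
  assumes "ideal I R" "a \<in> carrier R"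
  shows "ideal (I <+>\<^bsub>R\<^esub> PIdl a) R" "I \<subseteq> I <+>\<^bsub>R\<^esub> PIdl a" "a \<in> I <+>\<^bsub>R\<^esub> PIdl a"
proof -
  note I = idealE[OF assms(1)]
  show "ideal (I <+>\<^bsub>R\<^esub> PIdl a) R" using assms by (intro add_ideals cgenideal_ideal)
  show "I \<subseteq> I <+>\<^bsub>R\<^esub> PIdl a"
  proof
    fix x assume x: "x \<in> I"
    then show "x \<in> I <+>\<^bsub>R\<^esub> PIdl a"
      unfolding mem_add_PIdl using I(1) assms(2) by (intro bexI[of _ x] bexI[of _ \<zero>]) auto
  qed
  show "a \<in> I <+>\<^bsub>R\<^esub> PIdl a"
    unfolding mem_add_PIdl using I(2) assms(2) by (intro bexI[of _ \<zero>] bexI[of _ \<one>]) auto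
qed

lemma loc_sat_add_PIdlE:
  assumes "c \<in> loc_sat R q (I <+>\<^bsub>R\<^esub> PIdl a)"
  obtains s i r where "s \<in> carrier R - q" "i \<in> I" "r \<in> carrier R" "s \<otimes> c = i \<oplus> r \<otimes> a"
  using assms unfolding loc_sat_def mem_add_PIdl by auto

lemma add_PIdl_mono: "I \<subseteq> J \<Longrightarrow> I <+>\<^bsub>R\<^esub> PIdl a \<subseteq> J <+>\<^bsub>R\<^esub> PIdl a"
  by (auto simp: set_add_def')

lemma add_PIdl_subset:
  assumes "ideal J R" "I \<subseteq> J" "a \<in> J"
  shows "I <+>\<^bsub>R\<^esub> PIdl a \<subseteq> J"
proof
  fix c assume "c \<in> I <+>\<^bsub>R\<^esub> PIdl a"
  then obtain i r where c: "i \<in> I" "r \<in> carrier R" "c = i \<oplus> r \<otimes> a" unfolding mem_add_PIdl by blast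
  show "c \<in> J" unfolding c(3) by (rule idealE(3,5)[OF assms(1)] c assms(3) subsetD[OF assms(2)])+
qed

context
  fixes q assumes q: "primeideal q R"
begin

lemma loc_sat_ideal:
  assumes "ideal I R" shows "ideal (loc_sat R q I) R"
proof (rule idealI')
  note I = idealE[OF assms] and q' = primeidealE[OF q]
  show "loc_sat R q I \<subseteq> carrier R" by (auto simp: loc_sat_def)
  have "\<one> \<otimes> \<zero> \<in> I" using I(2) by simp
  then show "\<zero> \<in> loc_sat R q I" using q'(3) by (intro loc_satI[of \<one>]) auto
  show "a \<oplus> b \<in> loc_sat R q I" if "a \<in> loc_sat R q I" "b \<in> loc_sat R q I" for a b
  proof -
    from that(1) obtain s where s: "s \<in> carrier R - q" "s \<otimes> a \<in> I" "a \<in> carrier R"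
      by (rule loc_satE)
    from that(2) obtain t where t: "t \<in> carrier R - q" "t \<otimes> b \<in> I" "b \<in> carrier R"
      by (rule loc_satE)
    have "(s \<otimes> t) \<otimes> (a \<oplus> b) = t \<otimes> (s \<otimes> a) \<oplus> s \<otimes> (t \<otimes> b)"
      using s(1,3) t(1,3) by (simp add: r_distr m_assoc) (simp add: m_lcomm)
    also have "\<dots> \<in> I" using s t by (intro I(3) I(5)[OF s(2)] I(5)[OF t(2)]) auto
    finally show ?thesis using s(3) t(3) by (intro loc_satI[OF q'(6)[OF s(1) t(1)]]) auto
  qed
  show "x \<otimes> a \<in> loc_sat R q I" if "a \<in> loc_sat R q I" "x \<in> carrier R" for a x
  proof -
    from that(1) obtain s where s: "s \<in> carrier R - q" "s \<otimes> a \<in> I" and a: "a \<in> carrier R"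
      by (rule loc_satE)
    have "s \<otimes> (x \<otimes> a) = x \<otimes> (s \<otimes> a)" using s a that(2) by (simp add: m_lcomm)
    also have "\<dots> \<in> I" by (rule I(5)[OF s(2) that(2)])
    finally show ?thesis using a that(2) by (intro loc_satI[OF s(1)]) auto
  qed
qed

lemma loc_sat_incl: "I \<subseteq> carrier R \<Longrightarrow> I \<subseteq> loc_sat R q I"
proof
  fix a assume "a \<in> I" "I \<subseteq> carrier R"
  then show "a \<in> loc_sat R q I" using primeidealE(3)[OF q] by (intro loc_satI[of \<one>]) auto
qed

lemma loc_sat_mono: "I \<subseteq> J \<Longrightarrow> loc_sat R q I \<subseteq> loc_sat R q J"
  by (auto simp: loc_sat_def)

text \<open>Denominators compose: if \<open>t\<close> clears \<open>s \<otimes> a\<close>, then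
  \<open>t \<otimes> s\<close> clears \<open>a\<close>, and it is outside \<open>q\<close> because
  \<open>q\<close> is prime. Thus elements outside \<open>q\<close> may be cancelled modulo a
  saturated ideal.\<close>

lemma loc_sat_closed:
  assumes "a \<in> carrier R" "s \<in> carrier R - q" "s \<otimes> a \<in> loc_sat R q I"
  shows "a \<in> loc_sat R q I"
proof -
  obtain t where t: "t \<in> carrier R - q" "t \<otimes> (s \<otimes> a) \<in> I" using assms(3) by (rule loc_satE)
  then have "(t \<otimes> s) \<otimes> a \<in> I" using assms by (simp add: m_assoc)
  then show ?thesis using assms(1) by (rule loc_satI[OF primeidealE(6)[OF q t(1) assms(2)]])
qed

lemma loc_sat_idem: "loc_sat R q (loc_sat R q I) = loc_sat R q I"
proof -
  have "loc_sat R q I \<subseteq> carrier R" by (auto simp: loc_sat_def)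
  then have "loc_sat R q I \<subseteq> loc_sat R q (loc_sat R q I)" by (rule loc_sat_incl)
  moreover have "loc_sat R q (loc_sat R q I) \<subseteq> loc_sat R q I"
    by (auto elim!: loc_satE[of _ _ _ "loc_sat R q I"] intro: loc_sat_closed)
  ultimately show ?thesis by blast
qed

end

end

context noetherian_ring
begin

text \<open>Noetherian induction. In a noetherian ring the union of a nonempty chain of ideals
  belongs to the chain, so Zorn's lemma applies to an arbitrary predicate. Below it serves failure
  of a chain condition, annihilators, proper saturated ideals, and ideals contained in infinitely
  many primes.\<close>

lemma maximal_ideal_exists:
  assumes "ideal I R" "P I"
  obtains M where "ideal M R" "P M" "I \<subseteq> M" "\<forall>J. ideal J R \<longrightarrow> P J \<longrightarrow> M \<subseteq> J \<longrightarrow> J = M"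
proof -
  let ?A = "{J. ideal J R \<and> P J \<and> I \<subseteq> J}"
  have "\<exists>U\<in>?A. \<forall>J\<in>C. J \<subseteq> U" if C: "subset.chain ?A C" for C
  proof (cases "C = {}")
    case True then show ?thesis using assms by auto
  next
    case False
    have "subset.chain {I. ideal I R} C" using C by (auto simp: subset_chain_def)
    then have "\<Union>C \<in> C" by (rule ideal_chain_is_trivial[OF False])
    then show ?thesis using C by (auto simp: subset_chain_def)
  qed
  then obtain M where "M \<in> ?A" "\<forall>J\<in>?A. M \<subseteq> J \<longrightarrow> J = M" using subset_Zorn[of ?A] by auto
  then show thesis by (intro that[of M]) auto
qed

end

section \<open>Krull's principal ideal theorem\<close>

locale noetherian_cring = noetherian_ring + cring
begin

text \<open>If \<open>q\<close> is minimal over \<open>I\<^sub>0\<close>, then \<open>R\<^sub>q / I\<^sub>0 R\<^sub>q\<close> is artinian; its ideals are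
  represented by the \<open>q\<close>-saturated ideals of \<open>R\<close> containing \<open>I\<^sub>0\<close>.\<close>

lemma saturated_ideals_dcc:
  assumes q: "primeideal q R"
    and min: "\<And>P. \<lbrakk>primeideal P R; I0 \<subseteq> P; P \<subseteq> q\<rbrakk> \<Longrightarrow> P = q"
    and I: "ideal I R" "I0 \<subseteq> I"
    and C: "\<And>n. ideal (C n) R" "\<And>n. loc_sat R q (C n) = C n" "\<And>n. I \<subseteq> C n" "\<And>n. C (Suc n) \<subseteq> C n"
  shows "\<exists>N. \<forall>n\<ge>N. C n = C N"
proof (rule ccontr)
  assume neg: "\<not> ?thesis"
  \<comment> \<open>Noetherian induction on the lower bound of the chains: \<open>K\<close> will be
    maximal among the ideals above \<open>I\<close> for which chains of saturated ideals above them
    can fail to stabilise.\<close>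
  define stab where "stab I \<longleftrightarrow> (\<forall>C :: nat \<Rightarrow> 'a set. (\<forall>n. ideal (C n) R \<and> loc_sat R q (C n) = C n \<and> I \<subseteq> C n \<and> C (Suc n) \<subseteq> C n)
    \<longrightarrow> (\<exists>N. \<forall>n\<ge>N. C n = C N))" for I
  have "\<not> stab I" using neg C unfolding stab_def by blast
  with I(1) obtain K where K: "ideal K R" "\<not> stab K" "I \<subseteq> K"
    and Kmax: "\<forall>J. ideal J R \<longrightarrow> \<not> stab J \<longrightarrow> K \<subseteq> J \<longrightarrow> J = K"
    by (rule maximal_ideal_exists[of I "\<lambda>K. \<not> stab K"])
  have I0K: "I0 \<subseteq> K" using I(2) K(3) by (rule order_trans)
  note KE = idealE[OF K(1)]
  let ?S = "loc_sat R q K"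
  have S: "ideal ?S R" by (rule loc_sat_ideal[OF q K(1)])
  note SE = idealE[OF S]
  obtain C :: "nat \<Rightarrow> 'a set" where C:
      "\<forall>n. ideal (C n) R \<and> loc_sat R q (C n) = C n \<and> K \<subseteq> C n \<and> C (Suc n) \<subseteq> C n"
    and ns: "\<not> (\<exists>N. \<forall>n\<ge>N. C n = C N)"
    using K(2) unfolding stab_def by metis
  have Ci: "ideal (C n) R" and Csat: "loc_sat R q (C n) = C n"
    and KC: "K \<subseteq> C n" and Cd: "C (Suc n) \<subseteq> C n" for n using C by auto
  have Csat': "a \<in> C n" if "a \<in> carrier R" "s \<in> carrier R - q" "s \<otimes> a \<in> C n" for a s n
    using loc_satI[OF that(2,3,1)] Csat[of n] by simp
  have SC: "?S \<subseteq> C n" for n using loc_sat_mono[OF q KC[of n]] Csat by auto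
  have Cm: "C n \<subseteq> C m" if "m \<le> n" for m n using that Cd lift_Suc_antimono_le[of C] by blast
  \<comment> \<open>R/\<open>?S\<close> is nonzero, since otherwise the chain would be constant.
    This is what allows an associated prime to be chosen.\<close>
  have 1: "\<one> \<notin> ?S"
  proof
    assume "\<one> \<in> ?S"
    then have "C n = carrier R" for n
      using SC ideal.one_imp_carrier[OF Ci] by blast
    then show False using ns by auto
  qed
  \<comment> \<open>A maximal annihilator of a nonzero element of R/\<open>?S\<close> is prime. It
    contains \<open>I0\<close> and, as \<open>?S\<close> is saturated, lies in \<open>q\<close>;
    minimality of \<open>q\<close> makes it equal to \<open>q\<close>. So \<open>a\<close> spans a
    copy of the residue field of R_q.\<close>
  define ann where "ann a = {r\<in>carrier R. r \<otimes> a \<in> ?S}" for a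
  have annI: "ideal (ann a) R" if "a \<in> carrier R" for a
    using that SE(1,2) by (intro idealI') (auto simp: ann_def l_distr m_assoc intro: SE(3,5))
  have "\<exists>a\<in>carrier R - ?S. ann \<one> = ann a" using 1 by auto
  with annI[OF one_closed] obtain M where "ideal M R" and M: "\<exists>a\<in>carrier R - ?S. M = ann a" and "ann \<one> \<subseteq> M"
    and Mm: "\<forall>J. ideal J R \<longrightarrow> (\<exists>a\<in>carrier R - ?S. J = ann a) \<longrightarrow> M \<subseteq> J \<longrightarrow> J = M"
    by (rule maximal_ideal_exists[of "ann \<one>" "\<lambda>M. \<exists>a\<in>carrier R - ?S. M = ann a"])
  then obtain a where a: "a \<in> carrier R" "a \<notin> ?S" "M = ann a" by auto
  have "primeideal (ann a) R"
  proof (rule primeidealI[OF annI[OF a(1)] is_cring])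
    have "\<one> \<notin> ann a" using a by (simp add: ann_def)
    then show "carrier R \<noteq> ann a" by auto
    fix r s assume rs: "r \<in> carrier R" "s \<in> carrier R" "r \<otimes> s \<in> ann a"
    show "r \<in> ann a \<or> s \<in> ann a"
    proof (rule disjCI)
      assume "s \<notin> ann a"
      then have "s \<otimes> a \<in> carrier R - ?S" using rs a by (auto simp: ann_def)
      moreover have "M \<subseteq> ann (s \<otimes> a)"
      proof
        fix x assume "x \<in> M"
        then have x: "x \<in> carrier R" "x \<otimes> a \<in> ?S" using a(3) by (auto simp: ann_def)
        have "s \<otimes> (x \<otimes> a) \<in> ?S" by (rule SE(5)[OF x(2) rs(2)])
        also have "s \<otimes> (x \<otimes> a) = x \<otimes> (s \<otimes> a)" by (rule m_lcomm[OF rs(2) x(1) a(1)])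
        finally show "x \<in> ann (s \<otimes> a)" using x(1) by (simp add: ann_def)
      qed
      ultimately have "ann (s \<otimes> a) = ann a"
        using Mm[rule_format, OF annI, of "s \<otimes> a"] a(3) by auto
      then show "r \<in> ann a" using rs a(1) by (auto simp: ann_def m_assoc)
    qed
  qed
  moreover have "I0 \<subseteq> ann a"
    using I0K KE(1) a(1) loc_sat_incl[OF q KE(1)] KE(6)[OF _ a(1)] by (auto simp: ann_def)
  moreover have "ann a \<subseteq> q"
  proof
    fix r assume "r \<in> ann a"
    then have r: "r \<in> carrier R" "r \<otimes> a \<in> ?S" by (auto simp: ann_def)
    show "r \<in> q"
    proof (rule ccontr)
      assume "r \<notin> q"
      with r(1) have "r \<in> carrier R - q" by simp
      from loc_sat_closed[OF q a(1) this r(2)] a(2) show False by contradiction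
    qed
  qed
  ultimately have annq: "ann a = q" by (rule min)
  let ?J = "K <+>\<^bsub>R\<^esub> PIdl a"
  have J: "ideal ?J R" "K \<subseteq> ?J" "a \<in> ?J" using ideal_add_PIdl[OF K(1) a(1)] by auto
  have "?J \<noteq> K" using J(3) a(2) loc_sat_incl[OF q KE(1)] by blast
  then have stabJ: "stab ?J" using Kmax[rule_format, OF J(1) _ J(2)] by auto
  show False
  \<comment> \<open>Chains above the larger ideal \<open>?J\<close> stabilise. If \<open>a\<close>
    is in every \<open>C n\<close>, this applies to the chain itself. Otherwise it applies to the
    saturations \<open>D n\<close> of \<open>C n\<close> plus the principal ideal of
    \<open>a\<close>, and \<open>a\<close> contributes nothing new to \<open>C n\<close> for large
    n.\<close>
  proof (cases "\<forall>n. a \<in> C n")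
    case True
    have "?J \<subseteq> C n" for n
      using add_PIdl_subset[OF Ci KC] True by blast
    then show False using stabJ[unfolded stab_def, rule_format, of C] Ci Csat Cd ns by auto
  next
    case False
    then obtain n0 where n0: "a \<notin> C n0" by blast
    define D where "D n = loc_sat R q (C n <+>\<^bsub>R\<^esub> PIdl a)" for n
    have CD: "C n <+>\<^bsub>R\<^esub> PIdl a \<subseteq> D n" for n
      unfolding D_def using loc_sat_incl[OF q] idealE(1)[OF ideal_add_PIdl(1)[OF Ci a(1)]] by blast
    have "\<exists>N. \<forall>n\<ge>N. D n = D N"
    proof -
      have "ideal (D n) R \<and> loc_sat R q (D n) = D n" for n
        unfolding D_def using loc_sat_idem[OF q] loc_sat_ideal[OF q ideal_add_PIdl(1)[OF Ci a(1)]] by auto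
      moreover have "D (Suc n) \<subseteq> D n" for n
        unfolding D_def by (intro loc_sat_mono[OF q] add_PIdl_mono Cd)
      moreover have "?J \<subseteq> D n" for n
        using CD[of n] add_PIdl_mono[OF KC[of n]] by (meson order_trans)
      ultimately show ?thesis using stabJ[unfolded stab_def, rule_format, of D] by auto
    qed
    then obtain N1 where N1: "\<And>n. n \<ge> N1 \<Longrightarrow> D n = D N1" by blast
    let ?N = "max n0 N1"
    have "C ?N \<subseteq> C n" if n: "n \<ge> ?N" for n
    proof
      fix c assume c: "c \<in> C ?N"
      note CE = idealE[OF Ci[of n]] and CE' = idealE[OF Ci[of ?N]]
      have cR: "c \<in> carrier R" using c CE'(1) by blast
      have "N1 \<le> n" using n by simp
      then have "D ?N = D n" using N1[of n] N1[of ?N] by simp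
      then have "c \<in> D n" using CD[of ?N] ideal_add_PIdl(2)[OF Ci a(1)] c by blast
      then obtain s d r where s: "s \<in> carrier R - q" and d: "d \<in> C n" and r: "r \<in> carrier R"
        and e: "s \<otimes> c = d \<oplus> r \<otimes> a" unfolding D_def by (rule loc_sat_add_PIdlE)
      have dR: "d \<in> carrier R" using d CE(1) by blast
      have "r \<otimes> a = s \<otimes> c \<ominus> d" using add_eq_imp_minus_eq[OF e dR] r a(1) by simp
      also have "\<dots> \<in> C ?N" using s c d Cm[OF n] by (intro CE'(4,5)) auto
      \<comment> \<open>If \<open>r\<close> were outside \<open>q\<close>, saturation would put
        \<open>a\<close> into \<open>C n0\<close>. Hence \<open>r\<close> is in \<open>q\<close>,
        which is the annihilator of \<open>a\<close> modulo \<open>?S\<close>, and \<open>?S\<close>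
        lies in every member of the chain.\<close>
      finally have "r \<otimes> a \<in> C n0" using Cm[of n0 ?N] by auto
      then have "r \<in> q" using Csat'[OF a(1), of r n0] r n0 by auto
      then have "r \<otimes> a \<in> ?S" using annq by (auto simp: ann_def)
      then have "r \<otimes> a \<in> C n" using SC by auto
      then have "s \<otimes> c \<in> C n" unfolding e by (rule CE(3)[OF d])
      then show "c \<in> C n" by (rule Csat'[OF cR s])
    qed
    then have "\<forall>n\<ge>?N. C n = C ?N" using Cm by (metis subset_antisym)
    then show False using ns by metis
  qed
qed

text \<open>A maximal saturated ideal strictly between \<open>K\<close> and \<open>J\<close> would contain every element of \<open>J\<close>.\<close>

lemma local_nakayama:
  assumes q: "primeideal q R" and x: "x \<in> q"
    and K: "ideal K R" "loc_sat R q K = K" and J: "ideal J R" "loc_sat R q J = J" "K \<subseteq> J"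
    and *: "\<And>a. a \<in> J \<Longrightarrow> \<exists>s\<in>carrier R - q. \<exists>k\<in>K. \<exists>j\<in>J. s \<otimes> a = k \<oplus> x \<otimes> j"
  shows "J = K"
proof (rule ccontr)
  assume "J \<noteq> K"
  then have "loc_sat R q K = K \<and> K \<subset> J" using K J by auto
  with K(1) obtain L where L: "ideal L R" "loc_sat R q L = L \<and> L \<subset> J" "K \<subseteq> L"
    and max: "\<forall>L'. ideal L' R \<longrightarrow> loc_sat R q L' = L' \<and> L' \<subset> J \<longrightarrow> L \<subseteq> L' \<longrightarrow> L' = L"
    by (rule maximal_ideal_exists[of K "\<lambda>L. loc_sat R q L = L \<and> L \<subset> J"])
  obtain a where a: "a \<in> J" "a \<notin> L" using L(2) by blast
  note LE = idealE[OF L(1)] and JE = idealE[OF J(1)]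
  have aR: "a \<in> carrier R" and xR: "x \<in> carrier R" using a JE(1) primeidealE(2)[OF q x] by auto
  let ?L = "loc_sat R q (L <+>\<^bsub>R\<^esub> PIdl a)"
  have La: "ideal (L <+>\<^bsub>R\<^esub> PIdl a) R" "L \<subseteq> L <+>\<^bsub>R\<^esub> PIdl a" "a \<in> L <+>\<^bsub>R\<^esub> PIdl a"
    using ideal_add_PIdl[OF L(1) aR] by auto
  have inc: "L <+>\<^bsub>R\<^esub> PIdl a \<subseteq> ?L" by (rule loc_sat_incl[OF q idealE(1)[OF La(1)]])
  have "L <+>\<^bsub>R\<^esub> PIdl a \<subseteq> J" using add_PIdl_subset[OF J(1)] L(2) a(1) by blast
  then have "?L \<subseteq> J" using loc_sat_mono[OF q, of _ J] J(2) by auto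
  moreover have "?L \<noteq> L" using inc La(3) a(2) by blast
  ultimately have LJ: "?L = J"
    using max[rule_format, OF loc_sat_ideal[OF q La(1)]] loc_sat_idem[OF q] inc La(2) by blast
  obtain s k j where s: "s \<in> carrier R - q" and k: "k \<in> K" and j: "j \<in> J" and e1: "s \<otimes> a = k \<oplus> x \<otimes> j"
    using *[OF a(1)] by blast
  obtain t l r where t: "t \<in> carrier R - q" and l: "l \<in> L" and r: "r \<in> carrier R" and e2: "t \<otimes> j = l \<oplus> r \<otimes> a"
    using j unfolding LJ[symmetric] by (rule loc_sat_add_PIdlE)
  have R: "k \<in> carrier R" "l \<in> carrier R" "j \<in> carrier R" "s \<in> carrier R" "t \<in> carrier R"
    using k L(3) LE(1) l j JE(1) s t by auto
  have kL: "t \<otimes> k \<in> L" "x \<otimes> l \<in> L" using k L(3) l R xR by (auto intro: LE(5))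
  \<comment> \<open>Eliminating \<open>j\<close> between the two relations leaves a multiple of
    \<open>a\<close> in \<open>L\<close>. Its coefficient
    \<open>t \<otimes> s \<ominus> x \<otimes> r\<close> is outside \<open>q\<close> because
    \<open>x\<close> is in \<open>q\<close>: this is the unit 1 - x r of the usual Nakayama
    argument.\<close>
  have "t \<otimes> (s \<otimes> a) = t \<otimes> k \<oplus> x \<otimes> (t \<otimes> j)"
    unfolding e1 using R xR by (simp add: r_distr m_lcomm)
  also have "\<dots> = (t \<otimes> k \<oplus> x \<otimes> l) \<oplus> (x \<otimes> r) \<otimes> a"
    unfolding e2 using R xR r aR by (simp add: r_distr m_assoc a_assoc)
  finally have "(t \<otimes> s \<ominus> x \<otimes> r) \<otimes> a = t \<otimes> k \<oplus> x \<otimes> l"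
    using R xR r aR by (simp add: a_minus_def l_distr l_minus m_assoc a_assoc r_neg)
  also have "\<dots> \<in> L" using kL LE(3) by blast
  finally have "(t \<otimes> s \<ominus> x \<otimes> r) \<otimes> a \<in> L" .
  moreover have "t \<otimes> s \<ominus> x \<otimes> r \<in> carrier R - q"
  proof -
    have "x \<otimes> r \<in> q" using idealE(6)[OF primeidealE(1)[OF q] x r] .
    moreover have "t \<otimes> s = (t \<otimes> s \<ominus> x \<otimes> r) \<oplus> x \<otimes> r"
      using R xR r by (simp add: a_minus_def a_assoc l_neg)
    moreover have "t \<otimes> s \<notin> q" using primeidealE(6)[OF q t s] by blast
    ultimately have "t \<otimes> s \<ominus> x \<otimes> r \<notin> q" using idealE(3)[OF primeidealE(1)[OF q]] by metis
    then show ?thesis using R xR r by simp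
  qed
  then have "a \<in> loc_sat R q L" using aR calculation by (auto intro: loc_satI)
  then show False using L(2) a(2) by blast
qed

text \<open>Krull's principal ideal theorem in the domain \<open>R/p\<^sub>0\<close>. For \<open>y \<in> p\<^sub>1 - p\<^sub>0\<close>, the descending
  chain of ideals \<open>y\<^sup>n R\<close>, localised at \<open>p\<^sub>1\<close>, becomes stationary modulo \<open>x\<close> and then by Nakayama's
  lemma altogether.\<close>

lemma krull_pit:
  assumes p0: "primeideal p0 R" and p1: "primeideal p1 R" and q: "primeideal q R"
    and sub: "p0 \<subset> p1" "p1 \<subset> q" and x: "x \<in> q"
    and min: "\<And>P. \<lbrakk>primeideal P R; p0 \<subseteq> P; x \<in> P; P \<subseteq> q\<rbrakk> \<Longrightarrow> P = q"
  shows False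
proof -
  have xp: "x \<notin> p1" using min[OF p1] sub by blast
  have xR: "x \<in> carrier R" by (rule primeidealE(2)[OF q x])
  obtain y where y: "y \<in> p1" "y \<notin> p0" using sub(1) by blast
  have yR: "y \<in> carrier R" by (rule primeidealE(2)[OF p1 y(1)])
  note p0i = primeidealE(1)[OF p0]
  define J where "J n = loc_sat R p1 (p0 <+>\<^bsub>R\<^esub> PIdl (y [^] n))" for n :: nat
  have yn: "y [^] n \<in> carrier R" for n :: nat using yR by simp
  have base: "p0 <+>\<^bsub>R\<^esub> PIdl (y [^] n) \<subseteq> J n" for n
    unfolding J_def by (rule loc_sat_incl[OF p1 idealE(1)[OF ideal_add_PIdl(1)[OF p0i yn]]])
  have Ji: "ideal (J n) R" for n unfolding J_def by (rule loc_sat_ideal[OF p1 ideal_add_PIdl(1)[OF p0i yn]])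
  have p0J: "p0 \<subseteq> J n" for n using base ideal_add_PIdl(2)[OF p0i yn] by blast
  have Jsat1: "a \<in> J n" if "a \<in> carrier R" "s \<in> carrier R - p1" "s \<otimes> a \<in> J n" for a s n
    using loc_sat_closed[OF p1] that unfolding J_def by blast
  \<comment> \<open>Elements outside \<open>q\<close> are outside the smaller prime
    \<open>p1\<close>, so saturation at \<open>p1\<close> implies saturation at \<open>q\<close>.
    The chain condition is applied at \<open>q\<close>, cancellation of \<open>x\<close> takes place
    at \<open>p1\<close>.\<close>
  have Jsat: "loc_sat R q (J n) = J n" for n
  proof
    show "J n \<subseteq> loc_sat R q (J n)" by (rule loc_sat_incl[OF q idealE(1)[OF Ji]])
    show "loc_sat R q (J n) \<subseteq> J n" using Jsat1 sub(2) by (auto simp: loc_sat_def)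
  qed
  have Jd: "J (Suc n) \<subseteq> J n" for n
    unfolding J_def
  proof (rule loc_sat_mono[OF p1], rule subsetI)
    fix c assume "c \<in> p0 <+>\<^bsub>R\<^esub> PIdl (y [^] Suc n)"
    then obtain i r where "i \<in> p0" "r \<in> carrier R" "c = i \<oplus> r \<otimes> (y [^] Suc n)" by (auto simp: mem_add_PIdl)
    moreover have "r \<otimes> (y [^] Suc n) = (r \<otimes> y) \<otimes> y [^] n"
      using \<open>r \<in> carrier R\<close> yR by (simp add: m_ac)
    ultimately show "c \<in> p0 <+>\<^bsub>R\<^esub> PIdl (y [^] n)"
      using yR unfolding mem_add_PIdl by (intro bexI[of _ i] bexI[of _ "r \<otimes> y"]) auto
  qed
  define I0 where "I0 = p0 <+>\<^bsub>R\<^esub> PIdl x"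
  have I0: "ideal I0 R" unfolding I0_def by (rule ideal_add_PIdl[OF p0i xR])
  \<comment> \<open>The ideals \<open>J n\<close> modulo \<open>x\<close>, localised at
    \<open>q\<close>. Since \<open>q\<close> is minimal over \<open>I0\<close>, the chain condition
    holds for these, although not visibly for the \<open>J n\<close>.\<close>
  define C where "C n = loc_sat R q (J n <+>\<^bsub>R\<^esub> PIdl x)" for n
  have JC: "J n <+>\<^bsub>R\<^esub> PIdl x \<subseteq> C n" for n
    unfolding C_def by (rule loc_sat_incl[OF q idealE(1)[OF ideal_add_PIdl(1)[OF Ji xR]]])
  have "\<exists>N. \<forall>n\<ge>N. C n = C N"
  proof (rule saturated_ideals_dcc[OF q _ I0 order_refl])
    show "P = q" if "primeideal P R" "I0 \<subseteq> P" "P \<subseteq> q" for P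
      using min[OF that(1) _ _ that(3)] that(2) ideal_add_PIdl[OF p0i xR] unfolding I0_def by blast
    show "ideal (C n) R" for n unfolding C_def by (rule loc_sat_ideal[OF q ideal_add_PIdl(1)[OF Ji xR]])
    show "loc_sat R q (C n) = C n" for n unfolding C_def by (rule loc_sat_idem[OF q])
    show "I0 \<subseteq> C n" for n
      using JC[of n] add_PIdl_mono[OF p0J[of n]] unfolding I0_def by (meson order_trans)
    show "C (Suc n) \<subseteq> C n" for n
      unfolding C_def by (intro loc_sat_mono[OF q] add_PIdl_mono Jd)
  qed
  then obtain n where n: "C n = C (Suc n)" by (metis le_SucI order_refl)
  have "J n = J (Suc n)"
  proof (rule local_nakayama[OF q x Ji Jsat Ji Jsat Jd])
    fix a assume a: "a \<in> J n"
    have "a \<in> C (Suc n)" using a JC[of n] ideal_add_PIdl(2)[OF Ji xR] n by blast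
    then obtain s b c where s: "s \<in> carrier R - q" and b: "b \<in> J (Suc n)" and c: "c \<in> carrier R"
      and e: "s \<otimes> a = b \<oplus> c \<otimes> x" unfolding C_def by (rule loc_sat_add_PIdlE)
    have bR: "b \<in> carrier R" using b idealE(1)[OF Ji] by blast
    have "x \<otimes> c = s \<otimes> a \<ominus> b"
      using add_eq_imp_minus_eq[OF e bR] c xR by (simp add: m_comm)
    also have "\<dots> \<in> J n" using a b Jd s by (intro idealE(4,5)[OF Ji]) auto
    \<comment> \<open>Here \<open>x\<close> is cancelled: it is outside \<open>p1\<close> and
      \<open>J n\<close> is saturated there. So \<open>J n\<close> is locally contained in J (n+1) +
      x J n, which is the hypothesis of Nakayama's lemma.\<close>
    finally have "c \<in> J n" using Jsat1[of c x] c xR xp by blast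
    then show "\<exists>s\<in>carrier R - q. \<exists>k\<in>J (Suc n). \<exists>j\<in>J n. s \<otimes> a = k \<oplus> x \<otimes> j"
      using s b e c m_comm[of c x] idealE(1)[OF Ji] xR by (intro bexI[of _ s] bexI[of _ b] bexI[of _ c]) auto
  qed
  moreover have "y [^] n \<in> J n" using base ideal_add_PIdl(3)[OF p0i yn] by blast
  ultimately have "y [^] n \<in> J (Suc n)" by simp
  then obtain s i r where s: "s \<in> carrier R - p1" and i: "i \<in> p0" and r: "r \<in> carrier R"
    and e: "s \<otimes> y [^] n = i \<oplus> r \<otimes> y [^] Suc n" unfolding J_def by (rule loc_sat_add_PIdlE)
  have iR: "i \<in> carrier R" by (rule primeidealE(2)[OF p0 i])
  \<comment> \<open>In the domain R/p0 the power of \<open>y\<close> cancels, which leaves s = r y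
    modulo \<open>p0\<close>. As \<open>y\<close> is in \<open>p1\<close>, so is \<open>s\<close>,
    against its choice.\<close>
  have "(s \<ominus> r \<otimes> y) \<otimes> y [^] n = s \<otimes> y [^] n \<ominus> r \<otimes> y [^] Suc n"
    using s r yR by (simp add: a_minus_def l_distr l_minus) (simp add: m_ac)
  also have "\<dots> = i" unfolding e using iR r yR by (simp add: a_minus_def a_assoc r_neg del: nat_pow_Suc)
  finally have "(s \<ominus> r \<otimes> y) \<otimes> y [^] n \<in> p0" using i by simp
  moreover have "y [^] n \<notin> p0" for n :: nat
    by (induction n) (use primeidealE(3)[OF p0] primeidealE(5)[OF p0 nat_pow_closed[OF yR] yR] y(2) in auto)
  ultimately have "s \<ominus> r \<otimes> y \<in> p0" using primeidealE(5)[OF p0, of "s \<ominus> r \<otimes> y" "y [^] n"] s r yR by auto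
  then have "s \<ominus> r \<otimes> y \<in> p1" using sub by blast
  moreover have "r \<otimes> y \<in> p1" using idealE(5)[OF primeidealE(1)[OF p1] y(1) r] .
  moreover have "s = (s \<ominus> r \<otimes> y) \<oplus> r \<otimes> y" using s r yR by (simp add: a_minus_def a_assoc l_neg)
  ultimately have "s \<in> p1" using idealE(3)[OF primeidealE(1)[OF p1]] by metis
  then show False using s by blast
qed

section \<open>Infinite antichains of primes\<close>

lemma infinite_antichain_of_primes:
  assumes inf: "infinite {p. primeideal p R}"
  shows "\<exists>H. infinite H \<and> (\<forall>p\<in>H. primeideal p R) \<and> (\<forall>p\<in>H. \<forall>p'\<in>H. p \<subseteq> p' \<longrightarrow> p = p')"
proof -
  define V where "V I = {P. primeideal P R \<and> I \<subseteq> P}" for I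
  have "{p. primeideal p R} = V {\<zero>}" using primeidealE(4) by (auto simp: V_def)
  then have "infinite (V {\<zero>})" using inf by simp
  with zeroideal obtain p where p: "ideal p R" "infinite (V p)" "{\<zero>} \<subseteq> p"
    and max: "\<forall>J. ideal J R \<longrightarrow> infinite (V J) \<longrightarrow> p \<subseteq> J \<longrightarrow> J = p"
    by (rule maximal_ideal_exists[of "{\<zero>}" "\<lambda>I. infinite (V I)"])
  have fin: "finite (V J)" if "ideal J R" "p \<subset> J" for J using max that by blast
  have prime: "primeideal p R"
  proof (rule primeidealI[OF p(1) is_cring])
    have "V (carrier R) = {}"
    proof -
      have "\<not> carrier R \<subseteq> P" if "primeideal P R" for P using primeidealE(3)[OF that] by auto
      then show ?thesis by (auto simp: V_def)
    qed
    then show "carrier R \<noteq> p" using p(2) by auto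
    fix a b assume ab: "a \<in> carrier R" "b \<in> carrier R" "a \<otimes> b \<in> p"
    show "a \<in> p \<or> b \<in> p"
    proof (rule ccontr)
      assume n: "\<not> (a \<in> p \<or> b \<in> p)"
      have "V p \<subseteq> V (p <+>\<^bsub>R\<^esub> PIdl a) \<union> V (p <+>\<^bsub>R\<^esub> PIdl b)"
      proof
        fix P assume P: "P \<in> V p"
        then have Pp: "primeideal P R" "p \<subseteq> P" by (auto simp: V_def)
        have "a \<in> P \<or> b \<in> P" using primeidealE(5)[OF Pp(1) ab(1,2)] ab(3) Pp(2) by blast
        then show "P \<in> V (p <+>\<^bsub>R\<^esub> PIdl a) \<union> V (p <+>\<^bsub>R\<^esub> PIdl b)"
          using add_PIdl_subset[OF primeidealE(1)[OF Pp(1)] Pp(2)] Pp(1) by (auto simp: V_def)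
      qed
      moreover have "finite (V (p <+>\<^bsub>R\<^esub> PIdl a))"
        using ideal_add_PIdl[OF p(1) ab(1)] n by (intro fin) auto
      moreover have "finite (V (p <+>\<^bsub>R\<^esub> PIdl b))"
        using ideal_add_PIdl[OF p(1) ab(2)] n by (intro fin) auto
      ultimately show False using p(2) by (meson finite_UnI finite_subset)
    qed
  qed
  \<comment> \<open>The primes of height one over \<open>p\<close>. The sets \<open>V h\<close> with
    \<open>h\<close> in \<open>H\<close> are finite and cover \<open>V p\<close> apart from
    \<open>p\<close> itself, so \<open>H\<close> has to be infinite.\<close>
  define H where "H = {h. primeideal h R \<and> p \<subset> h \<and> \<not> (\<exists>P. primeideal P R \<and> p \<subset> P \<and> P \<subset> h)}"
  have "V p \<subseteq> insert p (\<Union>h\<in>H. V h)"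
  proof
    fix P assume "P \<in> V p"
    then have P: "primeideal P R" "p \<subseteq> P" by (auto simp: V_def)
    show "P \<in> insert p (\<Union>h\<in>H. V h)"
    proof (cases "P = p")
      case False
      then obtain x where x: "x \<in> P" "x \<notin> p" using P(2) by blast
      have xR: "x \<in> carrier R" by (rule primeidealE(2)[OF P(1) x(1)])
      \<comment> \<open>\<open>B\<close> is finite because only finitely many primes contain
        \<open>p\<close> and \<open>x\<close>. So it has a minimal element \<open>h\<close>, and
        \<open>krull_pit\<close> with the element \<open>x\<close> excludes primes strictly between
        \<open>p\<close> and \<open>h\<close>.\<close>
      define B where "B = {Q. primeideal Q R \<and> p \<subseteq> Q \<and> x \<in> Q \<and> Q \<subseteq> P}"
      have "B \<subseteq> V (p <+>\<^bsub>R\<^esub> PIdl x)"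
      proof
        fix Q assume "Q \<in> B"
        then have Q: "primeideal Q R" "p \<subseteq> Q" "x \<in> Q" by (auto simp: B_def)
        show "Q \<in> V (p <+>\<^bsub>R\<^esub> PIdl x)" using add_PIdl_subset[OF primeidealE(1)[OF Q(1)] Q(2,3)] Q(1) by (auto simp: V_def)
      qed
      moreover have "finite (V (p <+>\<^bsub>R\<^esub> PIdl x))"
        using ideal_add_PIdl[OF p(1) xR] x by (intro fin) auto
      ultimately have "finite B" by (rule finite_subset)
      moreover have "P \<in> B" using P x by (auto simp: B_def)
      ultimately obtain h where h: "h \<in> B" and hm: "\<And>Q. \<lbrakk>Q \<in> B; Q \<subseteq> h\<rbrakk> \<Longrightarrow> Q = h"
        using finite_has_minimal[of B] by blast
      have "\<not> (\<exists>P. primeideal P R \<and> p \<subset> P \<and> P \<subset> h)"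
      proof
        assume "\<exists>P. primeideal P R \<and> p \<subset> P \<and> P \<subset> h"
        then obtain P' where P': "primeideal P' R" "p \<subset> P'" "P' \<subset> h" by blast
        show False
        proof (rule krull_pit[OF prime P'(1) _ P'(2,3), of x])
          show "primeideal h R" "x \<in> h" using h by (auto simp: B_def)
          show "Q = h" if "primeideal Q R" "p \<subseteq> Q" "x \<in> Q" "Q \<subseteq> h" for Q
            using hm[of Q] that h unfolding B_def by blast
        qed
      qed
      then have "h \<in> H" using h x by (auto simp: B_def H_def)
      moreover have "P \<in> V h" using h P by (auto simp: B_def V_def)
      ultimately show ?thesis by blast
    qed simp
  qed
  then have "infinite (\<Union>h\<in>H. V h)" using p(2) by (meson finite.insertI finite_subset)
  moreover have "finite (V h)" if "h \<in> H" for h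
    using that primeidealE(1) by (intro fin) (auto simp: H_def)
  ultimately have "infinite H" by blast
  \<comment> \<open>Of two comparable distinct members of \<open>H\<close> the smaller one would lie
    strictly between \<open>p\<close> and the larger one.\<close>
  then show ?thesis by (intro exI[of _ H]) (auto simp: H_def)
qed

end

section \<open>Modules\<close>

lemma mk_module_sel [simp]:
  "carrier (mk_module C z p s) = C" "zero (mk_module C z p s) = z"
  "add (mk_module C z p s) = p" "smult (mk_module C z p s) = s"
  by (simp_all add: mk_module_def)

lemma a_inv_zero:
  assumes "abelian_group M" shows "\<ominus>\<^bsub>M\<^esub> \<zero>\<^bsub>M\<^esub> = \<zero>\<^bsub>M\<^esub>"
proof -
  interpret abelian_group M by fact
  show ?thesis using l_neg[OF zero_closed] r_zero[OF a_inv_closed[OF zero_closed]] by simp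
qed

lemma mod_homI:
  assumes "\<And>x. x \<in> carrier M \<Longrightarrow> f x \<in> carrier N"
    "\<And>x y. \<lbrakk>x \<in> carrier M; y \<in> carrier M\<rbrakk> \<Longrightarrow> f (x \<oplus>\<^bsub>M\<^esub> y) = f x \<oplus>\<^bsub>N\<^esub> f y"
    "\<And>a x. \<lbrakk>a \<in> carrier R; x \<in> carrier M\<rbrakk> \<Longrightarrow> f (a \<odot>\<^bsub>M\<^esub> x) = a \<odot>\<^bsub>N\<^esub> f x"
  shows "f \<in> mod_hom R M N"
  using assms by (auto simp: mod_hom_def)

lemma mod_homD:
  assumes "f \<in> mod_hom R M N"
  shows "x \<in> carrier M \<Longrightarrow> f x \<in> carrier N"
    "\<lbrakk>x \<in> carrier M; y \<in> carrier M\<rbrakk> \<Longrightarrow> f (x \<oplus>\<^bsub>M\<^esub> y) = f x \<oplus>\<^bsub>N\<^esub> f y"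
    "\<lbrakk>a \<in> carrier R; x \<in> carrier M\<rbrakk> \<Longrightarrow> f (a \<odot>\<^bsub>M\<^esub> x) = a \<odot>\<^bsub>N\<^esub> f x"
  using assms by (auto simp: mod_hom_def)

lemma mod_hom_zero:
  assumes "Module.module R M" "Module.module R N" "f \<in> mod_hom R M N"
  shows "f \<zero>\<^bsub>M\<^esub> = \<zero>\<^bsub>N\<^esub>"
proof -
  interpret M: Module.module R M by fact
  interpret N: Module.module R N by fact
  have "f (\<zero>\<^bsub>R\<^esub> \<odot>\<^bsub>M\<^esub> \<zero>\<^bsub>M\<^esub>) = \<zero>\<^bsub>R\<^esub> \<odot>\<^bsub>N\<^esub> f \<zero>\<^bsub>M\<^esub>" by (rule mod_homD(3)[OF assms(3)]) auto
  then show ?thesis using mod_homD(1)[OF assms(3) M.M.zero_closed] by simp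
qed

lemma mod_hom_a_inv:
  assumes "Module.module R M" "Module.module R N" "f \<in> mod_hom R M N" "x \<in> carrier M"
  shows "f (\<ominus>\<^bsub>M\<^esub> x) = \<ominus>\<^bsub>N\<^esub> f x"
proof -
  interpret M: Module.module R M by fact
  interpret N: Module.module R N by fact
  have "f ((\<ominus>\<^bsub>R\<^esub> \<one>\<^bsub>R\<^esub>) \<odot>\<^bsub>M\<^esub> x) = (\<ominus>\<^bsub>R\<^esub> \<one>\<^bsub>R\<^esub>) \<odot>\<^bsub>N\<^esub> f x"
    by (rule mod_homD(3)[OF assms(3)]) (use assms in auto)
  then show ?thesis using mod_homD(1)[OF assms(3,4)] assms(4) by (simp add: M.smult_l_minus N.smult_l_minus)
qed

lemma mod_hom_minus:
  assumes "Module.module R M" "Module.module R N" "f \<in> mod_hom R M N" "x \<in> carrier M" "y \<in> carrier M"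
  shows "f (x \<ominus>\<^bsub>M\<^esub> y) = f x \<ominus>\<^bsub>N\<^esub> f y"
proof -
  interpret M: Module.module R M by fact
  show ?thesis using assms(4,5) mod_homD(2)[OF assms(3)] mod_hom_a_inv[OF assms(1-3)]
    by (simp add: a_minus_def)
qed

lemma mod_hom_finsum:
  assumes "Module.module R M" "Module.module R N" "f \<in> mod_hom R M N"
    "finite A" "g \<in> A \<rightarrow> carrier M"
  shows "f (finsum M g A) = finsum N (\<lambda>i. f (g i)) A"
proof -
  interpret M: Module.module R M by fact
  interpret N: Module.module R N by fact
  show ?thesis using assms(4,5)
  proof (induction A rule: finite_induct)
    case empty then show ?case using mod_hom_zero[OF assms(1-3)] by simp
  next
    case (insert x F)
    then have "g x \<in> carrier M" "g \<in> F \<rightarrow> carrier M" by auto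
    then show ?case using insert.hyps insert.IH mod_homD(1,2)[OF assms(3)]
      by (subst M.M.finsum_insert N.M.finsum_insert; (auto simp: Pi_iff)?)+
  qed
qed

lemma mod_hom_comp:
  "\<lbrakk>f \<in> mod_hom R L M; g \<in> mod_hom R M N\<rbrakk> \<Longrightarrow> (\<lambda>x. g (f x)) \<in> mod_hom R L N"
  by (rule mod_homI) (auto simp: mod_homD)

lemma mod_hom_id: "(\<lambda>x. x) \<in> mod_hom R M M"
  by (rule mod_homI) auto

lemma mod_isoD:
  assumes "f \<in> mod_iso R M N"
  shows "f \<in> mod_hom R M N" "inj_on f (carrier M)" "f ` carrier M = carrier N"
  using assms by (auto simp: mod_iso_def bij_betw_def)

lemma mod_iso_inv:
  assumes "Module.module R M" "f \<in> mod_iso R M N"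
  shows "inv_into (carrier M) f \<in> mod_hom R N M"
proof (rule mod_homI)
  interpret M: Module.module R M by fact
  let ?g = "inv_into (carrier M) f"
  note f = mod_isoD[OF assms(2)]
  have g: "?g y \<in> carrier M" "f (?g y) = y" if "y \<in> carrier N" for y
    using that f(3) by (auto intro: inv_into_into f_inv_into_f)
  have gf: "?g (f x) = x" if "x \<in> carrier M" for x using that f(2) by simp
  show "?g y \<in> carrier M" if "y \<in> carrier N" for y by (rule g(1)[OF that])
  show "?g (x \<oplus>\<^bsub>N\<^esub> y) = ?g x \<oplus>\<^bsub>M\<^esub> ?g y" if "x \<in> carrier N" "y \<in> carrier N" for x y
    using gf[of "?g x \<oplus>\<^bsub>M\<^esub> ?g y"] g that mod_homD(2)[OF f(1), of "?g x" "?g y"] by simp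
  show "?g (a \<odot>\<^bsub>N\<^esub> y) = a \<odot>\<^bsub>M\<^esub> ?g y" if "a \<in> carrier R" "y \<in> carrier N" for a y
    using gf[of "a \<odot>\<^bsub>M\<^esub> ?g y"] g that mod_homD(3)[OF f(1), of a "?g y"] by simp
qed

lemma submodule_zero:
  assumes "Module.module R M" "submodule N R M" shows "\<zero>\<^bsub>M\<^esub> \<in> N"
proof -
  interpret submodule N R M by fact
  show ?thesis using subgroup.one_closed[OF subgroup_axioms] by simp
qed

lemma mod_hom_image_submodule:
  assumes "Module.module R M" "Module.module R N" "f \<in> mod_hom R M N"
  shows "submodule (f ` carrier M) R N"
proof -
  interpret M: Module.module R M by fact
  interpret N: Module.module R N by fact
  note f = mod_homD[OF assms(3)]
  show ?thesis
  proof (rule N.submoduleI)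
    show "f ` carrier M \<subseteq> carrier N" using f(1) by auto
    show "\<zero>\<^bsub>N\<^esub> \<in> f ` carrier M" using mod_hom_zero[OF assms] by (metis M.M.zero_closed imageI)
    show "\<ominus>\<^bsub>N\<^esub> a \<in> f ` carrier M" if "a \<in> f ` carrier M" for a
    proof -
      from that obtain x where x: "x \<in> carrier M" "a = f x" by auto
      then show ?thesis using mod_hom_a_inv[OF assms x(1)] by (intro image_eqI[of _ _ "\<ominus>\<^bsub>M\<^esub> x"]) auto
    qed
    show "a \<oplus>\<^bsub>N\<^esub> b \<in> f ` carrier M" if "a \<in> f ` carrier M" "b \<in> f ` carrier M" for a b
    proof -
      from that obtain x y where "x \<in> carrier M" "a = f x" "y \<in> carrier M" "b = f y" by auto
      then show ?thesis using f(2)[of x y] by (intro image_eqI[of _ _ "x \<oplus>\<^bsub>M\<^esub> y"]) auto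
    qed
    show "a \<odot>\<^bsub>N\<^esub> x \<in> f ` carrier M" if "a \<in> carrier R" "x \<in> f ` carrier M" for a x
    proof -
      from that obtain y where "y \<in> carrier M" "x = f y" by auto
      then show ?thesis using f(3)[of a y] that(1) by (intro image_eqI[of _ _ "a \<odot>\<^bsub>M\<^esub> y"]) auto
    qed
  qed
qed

lemma submod_gen_submodule:
  assumes "Module.module R M" "A \<subseteq> carrier M"
  shows "submodule (submod_gen R M A) R M" "A \<subseteq> submod_gen R M A"
proof -
  interpret M: Module.module R M by fact
  note E = M.submoduleE
  show "A \<subseteq> submod_gen R M A" by (auto simp: submod_gen_def)
  show "submodule (submod_gen R M A) R M"
  proof (rule M.submoduleI)
    show "submod_gen R M A \<subseteq> carrier M"
      unfolding submod_gen_def using M.carrier_is_submodule assms(2) by (intro Inter_lower) auto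
    show "\<zero>\<^bsub>M\<^esub> \<in> submod_gen R M A" using submodule_zero[OF assms(1)] by (auto simp: submod_gen_def)
  qed (auto simp: submod_gen_def intro: E)
qed

lemma submod_gen_least: "\<lbrakk>submodule N R M; A \<subseteq> N\<rbrakk> \<Longrightarrow> submod_gen R M A \<subseteq> N"
  by (auto simp: submod_gen_def)

section \<open>Quotient modules\<close>

context
  fixes R :: "('a, 'r) ring_scheme" and M :: "('a, 'b) module" and N :: "'b set"
  assumes M: "Module.module R M" and N: "submodule N R M"
begin

interpretation M: Module.module R M by (rule M)

lemma quot_sub: "subgroup N (add_monoid M)" "N \<subseteq> carrier M"
  using submodule.axioms(1)[OF N] M.submoduleE(1)[OF N] by auto

lemma quot_eq_iff:
  assumes "x \<in> carrier M" "y \<in> carrier M"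
  shows "N +>\<^bsub>M\<^esub> x = N +>\<^bsub>M\<^esub> y \<longleftrightarrow> x \<ominus>\<^bsub>M\<^esub> y \<in> N"
proof
  assume "N +>\<^bsub>M\<^esub> x = N +>\<^bsub>M\<^esub> y"
  moreover have "\<zero>\<^bsub>M\<^esub> \<oplus>\<^bsub>M\<^esub> x \<in> N +>\<^bsub>M\<^esub> x"
    using M.M.a_rcosI[OF submodule_zero[OF M N] quot_sub(2) assms(1)] .
  ultimately obtain n where n: "n \<in> N" "x = n \<oplus>\<^bsub>M\<^esub> y"
    using assms by (auto simp: a_r_coset_def')
  then have "n \<in> carrier M" using quot_sub(2) by auto
  then have "x \<ominus>\<^bsub>M\<^esub> y = n" using n(2) assms by (simp add: a_minus_def M.M.a_assoc M.M.r_neg)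
  then show "x \<ominus>\<^bsub>M\<^esub> y \<in> N" using n(1) by simp
next
  assume *: "x \<ominus>\<^bsub>M\<^esub> y \<in> N"
  have "(x \<ominus>\<^bsub>M\<^esub> y) \<oplus>\<^bsub>M\<^esub> y \<in> N +>\<^bsub>M\<^esub> y" by (rule M.M.a_rcosI[OF * quot_sub(2) assms(2)])
  moreover have "(x \<ominus>\<^bsub>M\<^esub> y) \<oplus>\<^bsub>M\<^esub> y = x" using assms by (simp add: a_minus_def M.M.a_assoc M.M.l_neg)
  ultimately show "N +>\<^bsub>M\<^esub> x = N +>\<^bsub>M\<^esub> y"
    using M.M.a_repr_independence[OF _ assms(2) quot_sub(1)] by metis
qed

lemma quot_carrier: "carrier (quot_module M N) = (\<lambda>x. N +>\<^bsub>M\<^esub> x) ` carrier M"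
  by (auto simp: quot_module_def A_RCOSETS_def')

lemma quot_add:
  assumes "x \<in> carrier M" "y \<in> carrier M"
  shows "(N +>\<^bsub>M\<^esub> x) \<oplus>\<^bsub>quot_module M N\<^esub> (N +>\<^bsub>M\<^esub> y) = N +>\<^bsub>M\<^esub> (x \<oplus>\<^bsub>M\<^esub> y)"
proof -
  have "abelian_subgroup N M"
    by (rule abelian_subgroupI3) (use quot_sub(1) M.M.abelian_group_axioms in \<open>auto simp: additive_subgroup_def\<close>)
  then show ?thesis using abelian_subgroup.a_rcos_sum assms by (fastforce simp: quot_module_def)
qed

lemma quot_zero: "\<zero>\<^bsub>quot_module M N\<^esub> = N +>\<^bsub>M\<^esub> \<zero>\<^bsub>M\<^esub>"
  using quot_sub(2) by (simp add: quot_module_def)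

lemma quot_eq_zero_iff: "x \<in> carrier M \<Longrightarrow> N +>\<^bsub>M\<^esub> x = \<zero>\<^bsub>quot_module M N\<^esub> \<longleftrightarrow> x \<in> N"
  unfolding quot_zero using quot_eq_iff[of x "\<zero>\<^bsub>M\<^esub>"] by (simp add: a_minus_def a_inv_zero[OF M.abelian_group_axioms])

text \<open>The union in \<open>coset_map\<close> runs over equal cosets: replacing \<open>x\<close>
  by n + x with \<open>n\<close> in \<open>N\<close> changes \<open>f x\<close> by
  \<open>f n\<close>, which is in \<open>N'\<close>.\<close>

lemma coset_map_apply:
  assumes M': "Module.module R M'" "submodule N' R M'" and f: "f \<in> mod_hom R M M'"
    and sub: "\<And>n. n \<in> N \<Longrightarrow> f n \<in> N'" and x: "x \<in> carrier M"
  shows "coset_map M' N' f (N +>\<^bsub>M\<^esub> x) = N' +>\<^bsub>M'\<^esub> f x"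
proof -
  interpret M': Module.module R M' by (rule M'(1))
  have "N' +>\<^bsub>M'\<^esub> f (n \<oplus>\<^bsub>M\<^esub> x) = N' +>\<^bsub>M'\<^esub> f x" if n: "n \<in> N" for n
  proof -
    have nM: "n \<in> carrier M" using n quot_sub(2) by auto
    have N'M: "subgroup N' (add_monoid M')" "N' \<subseteq> carrier M'"
      using submodule.axioms(1)[OF M'(2)] M'.submoduleE(1)[OF M'(2)] by auto
    have "f n \<oplus>\<^bsub>M'\<^esub> f x \<in> N' +>\<^bsub>M'\<^esub> f x"
      using M'.M.a_rcosI[OF sub[OF n] N'M(2) mod_homD(1)[OF f x]] .
    then show ?thesis
      using M'.M.a_repr_independence[OF _ mod_homD(1)[OF f x] N'M(1)] mod_homD(2)[OF f nM x] by simp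
  qed
  moreover have "N \<noteq> {}" using submodule_zero[OF M N] by auto
  ultimately show ?thesis by (auto simp: coset_map_def a_r_coset_def'[of M])
qed

lemma quot_smult:
  assumes "a \<in> carrier R" "x \<in> carrier M"
  shows "a \<odot>\<^bsub>quot_module M N\<^esub> (N +>\<^bsub>M\<^esub> x) = N +>\<^bsub>M\<^esub> (a \<odot>\<^bsub>M\<^esub> x)"
proof -
  have "(\<lambda>x. a \<odot>\<^bsub>M\<^esub> x) \<in> mod_hom R M M"
  proof (rule mod_homI)
    show "a \<odot>\<^bsub>M\<^esub> (b \<odot>\<^bsub>M\<^esub> x) = b \<odot>\<^bsub>M\<^esub> (a \<odot>\<^bsub>M\<^esub> x)" if "b \<in> carrier R" "x \<in> carrier M" for b x
      using that assms(1) by (metis M.R.m_comm M.smult_assoc1)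
  qed (use assms(1) in \<open>auto simp: M.smult_r_distr\<close>)
  then show ?thesis
    unfolding quot_module_def mk_module_sel
    by (rule coset_map_apply[OF M N]) (use M.submoduleE(4)[OF N assms(1)] assms in auto)
qed

lemma quot_is_module: "Module.module R (quot_module M N)"
proof -
  let ?Q = "quot_module M N"
  have rep: "\<exists>x\<in>carrier M. u = N +>\<^bsub>M\<^esub> x" if "u \<in> carrier ?Q" for u using that quot_carrier by auto
  have cl: "N +>\<^bsub>M\<^esub> x \<in> carrier ?Q" if "x \<in> carrier M" for x using that quot_carrier by auto
  have "abelian_group ?Q"
  proof (rule abelian_groupI)
    show "u \<oplus>\<^bsub>?Q\<^esub> v \<in> carrier ?Q" if "u \<in> carrier ?Q" "v \<in> carrier ?Q" for u v
      using rep[OF that(1)] rep[OF that(2)] by (auto simp: quot_add intro!: cl)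
    show "\<zero>\<^bsub>?Q\<^esub> \<in> carrier ?Q" unfolding quot_zero by (rule cl) simp
    show "u \<oplus>\<^bsub>?Q\<^esub> v \<oplus>\<^bsub>?Q\<^esub> w = u \<oplus>\<^bsub>?Q\<^esub> (v \<oplus>\<^bsub>?Q\<^esub> w)"
      if "u \<in> carrier ?Q" "v \<in> carrier ?Q" "w \<in> carrier ?Q" for u v w
      using rep[OF that(1)] rep[OF that(2)] rep[OF that(3)] by (auto simp: quot_add M.M.a_assoc)
    show "u \<oplus>\<^bsub>?Q\<^esub> v = v \<oplus>\<^bsub>?Q\<^esub> u" if "u \<in> carrier ?Q" "v \<in> carrier ?Q" for u v
      using rep[OF that(1)] rep[OF that(2)] by (auto simp: quot_add M.M.a_comm)
    show "\<zero>\<^bsub>?Q\<^esub> \<oplus>\<^bsub>?Q\<^esub> u = u" if "u \<in> carrier ?Q" for u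
      using rep[OF that] unfolding quot_zero by (auto simp: quot_add)
    show "\<exists>v\<in>carrier ?Q. v \<oplus>\<^bsub>?Q\<^esub> u = \<zero>\<^bsub>?Q\<^esub>" if "u \<in> carrier ?Q" for u
    proof -
      obtain x where x: "x \<in> carrier M" "u = N +>\<^bsub>M\<^esub> x" using rep[OF \<open>u \<in> carrier ?Q\<close>] by auto
      show ?thesis unfolding quot_zero x(2)
        by (rule bexI[OF _ cl[of "\<ominus>\<^bsub>M\<^esub> x"]]) (use x(1) in \<open>auto simp: quot_add M.M.l_neg\<close>)
    qed
  qed
  then show ?thesis
  proof (intro Module.moduleI M.is_cring)
    show "a \<odot>\<^bsub>?Q\<^esub> u \<in> carrier ?Q" if "a \<in> carrier R" "u \<in> carrier ?Q" for a u
      using rep[OF that(2)] that(1) by (auto simp: quot_smult intro!: cl)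
    show "(a \<oplus>\<^bsub>R\<^esub> b) \<odot>\<^bsub>?Q\<^esub> u = a \<odot>\<^bsub>?Q\<^esub> u \<oplus>\<^bsub>?Q\<^esub> b \<odot>\<^bsub>?Q\<^esub> u"
      if "a \<in> carrier R" "b \<in> carrier R" "u \<in> carrier ?Q" for a b u
      using rep[OF that(3)] that(1,2) by (auto simp: quot_smult quot_add M.smult_l_distr)
    show "a \<odot>\<^bsub>?Q\<^esub> (u \<oplus>\<^bsub>?Q\<^esub> v) = a \<odot>\<^bsub>?Q\<^esub> u \<oplus>\<^bsub>?Q\<^esub> a \<odot>\<^bsub>?Q\<^esub> v"
      if "a \<in> carrier R" "u \<in> carrier ?Q" "v \<in> carrier ?Q" for a u v
      using rep[OF that(2)] rep[OF that(3)] that(1) by (auto simp: quot_smult quot_add M.smult_r_distr)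
    show "(a \<otimes>\<^bsub>R\<^esub> b) \<odot>\<^bsub>?Q\<^esub> u = a \<odot>\<^bsub>?Q\<^esub> (b \<odot>\<^bsub>?Q\<^esub> u)"
      if "a \<in> carrier R" "b \<in> carrier R" "u \<in> carrier ?Q" for a b u
      using rep[OF that(3)] that(1,2) by (auto simp: quot_smult M.smult_assoc1)
    show "\<one>\<^bsub>R\<^esub> \<odot>\<^bsub>?Q\<^esub> u = u" if "u \<in> carrier ?Q" for u
      using rep[OF that] by (auto simp: quot_smult)
  qed
qed

lemma quot_proj_hom: "(\<lambda>x. N +>\<^bsub>M\<^esub> x) \<in> mod_hom R M (quot_module M N)"
  by (rule mod_homI) (auto simp: quot_add quot_smult quot_carrier)

end

section \<open>Free modules and linear extension\<close>

lemma free_module_carrier: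
  "c \<in> carrier (free_module R S) \<longleftrightarrow>
     finite {s. c s \<noteq> \<zero>\<^bsub>R\<^esub>} \<and> (\<forall>s\<in>S. c s \<in> carrier R) \<and> (\<forall>s. s \<notin> S \<longrightarrow> c s = \<zero>\<^bsub>R\<^esub>)"
  by (simp add: free_module_def)

context cring
begin

lemma free_module_coeff: "c \<in> carrier (free_module R S) \<Longrightarrow> c s \<in> carrier R"
  by (cases "s \<in> S") (auto simp: free_module_carrier)

lemma free_module_is_module: "Module.module R (free_module R S)"
proof -
  let ?F = "free_module R S"
  have fin: "finite {s. c s \<oplus> d s \<noteq> \<zero>}" if "c \<in> carrier ?F" "d \<in> carrier ?F" for c d
    by (rule finite_subset[of _ "{s. c s \<noteq> \<zero>} \<union> {s. d s \<noteq> \<zero>}"])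
      (use that in \<open>auto simp: free_module_carrier\<close>)
  have fin2: "finite {s. a \<otimes> c s \<noteq> \<zero>}" if "a \<in> carrier R" "c \<in> carrier ?F" for a c
    by (rule finite_subset[of _ "{s. c s \<noteq> \<zero>}"]) (use that in \<open>auto simp: free_module_carrier\<close>)
  have ops: "add ?F = (\<lambda>c d s. c s \<oplus> d s)" "zero ?F = (\<lambda>s. \<zero>)" "smult ?F = (\<lambda>a c s. a \<otimes> c s)"
    by (simp_all add: free_module_def)
  note co = free_module_coeff[of _ S]
  have "abelian_group ?F"
  proof (rule abelian_groupI)
    show "c \<oplus>\<^bsub>?F\<^esub> d \<in> carrier ?F" if "c \<in> carrier ?F" "d \<in> carrier ?F" for c d
      using that fin[OF that] by (auto simp: free_module_carrier ops)
    show "\<zero>\<^bsub>?F\<^esub> \<in> carrier ?F" by (auto simp: free_module_carrier ops)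
    show "\<exists>d\<in>carrier ?F. d \<oplus>\<^bsub>?F\<^esub> c = \<zero>\<^bsub>?F\<^esub>" if c: "c \<in> carrier ?F" for c
    proof (rule bexI)
      show "(\<lambda>s. \<ominus> c s) \<oplus>\<^bsub>?F\<^esub> c = \<zero>\<^bsub>?F\<^esub>" using co[OF c] by (auto simp: ops l_neg)
      have "finite {s. \<ominus> c s \<noteq> \<zero>}"
        by (rule finite_subset[of _ "{s. c s \<noteq> \<zero>}"]) (use c in \<open>auto simp: free_module_carrier\<close>)
      then show "(\<lambda>s. \<ominus> c s) \<in> carrier ?F" using c by (auto simp: free_module_carrier)
    qed
  qed (auto simp: ops a_ac co)
  then show ?thesis
  proof (intro Module.moduleI is_cring)
    show "a \<odot>\<^bsub>?F\<^esub> c \<in> carrier ?F" if "a \<in> carrier R" "c \<in> carrier ?F" for a c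
      using that fin2[OF that] by (auto simp: free_module_carrier ops)
  qed (auto simp: ops co l_distr r_distr m_assoc)
qed

lemma free_gen_closed: "s \<in> S \<Longrightarrow> free_gen R s \<in> carrier (free_module R S)"
  by (auto simp: free_module_carrier free_gen_def intro: finite_subset[of _ "{s}"])

text \<open>\<open>lin_ext\<close> sums over the support of \<open>c\<close>, and supports do not
  add up when elements are added. Padding with zero terms allows several elements to be compared
  over one index set.\<close>

lemma lin_ext_superset:
  assumes L: "Module.module R L" and \<phi>: "\<And>s. s \<in> A \<Longrightarrow> \<phi> s \<in> carrier L"
    and A: "finite A" "{s. c s \<noteq> \<zero>} \<subseteq> A" and c: "\<And>s. c s \<in> carrier R"
  shows "lin_ext R L \<phi> c = finsum L (\<lambda>s. c s \<odot>\<^bsub>L\<^esub> \<phi> s) A"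
proof -
  interpret L: Module.module R L by fact
  show ?thesis unfolding lin_ext_def
    by (rule L.M.add.finprod_mono_neutral_cong_left) (use A \<phi> c in auto)
qed

lemma lin_ext_hom:
  assumes L: "Module.module R L" and \<phi>: "\<And>s. s \<in> S \<Longrightarrow> \<phi> s \<in> carrier L"
  shows "lin_ext R L \<phi> \<in> mod_hom R (free_module R S) L"
proof (rule mod_homI)
  interpret L: Module.module R L by fact
  let ?F = "free_module R S"
  note co = free_module_coeff[of _ S]
  have sup: "{s. c s \<noteq> \<zero>} \<subseteq> S" "finite {s. c s \<noteq> \<zero>}" if "c \<in> carrier ?F" for c
    using that by (auto simp: free_module_carrier)
  show "lin_ext R L \<phi> c \<in> carrier L" if "c \<in> carrier ?F" for c
    unfolding lin_ext_def using sup[OF that] co[OF that] \<phi> by (intro L.M.finsum_closed) auto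
  show "lin_ext R L \<phi> (c \<oplus>\<^bsub>?F\<^esub> d) = lin_ext R L \<phi> c \<oplus>\<^bsub>L\<^esub> lin_ext R L \<phi> d"
    if c: "c \<in> carrier ?F" and d: "d \<in> carrier ?F" for c d
  proof -
    let ?A = "{s. c s \<noteq> \<zero>} \<union> {s. d s \<noteq> \<zero>}"
    have A: "finite ?A" "?A \<subseteq> S" using sup[OF c] sup[OF d] by auto
    have \<phi>': "\<phi> s \<in> carrier L" if "s \<in> ?A" for s using \<phi> A(2) that by blast
    have "lin_ext R L \<phi> (\<lambda>s. c s \<oplus> d s) = finsum L (\<lambda>s. (c s \<oplus> d s) \<odot>\<^bsub>L\<^esub> \<phi> s) ?A"
      by (rule lin_ext_superset[OF L \<phi>' A(1)]) (use co c d in auto)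
    also have "\<dots> = finsum L (\<lambda>s. c s \<odot>\<^bsub>L\<^esub> \<phi> s \<oplus>\<^bsub>L\<^esub> d s \<odot>\<^bsub>L\<^esub> \<phi> s) ?A"
      by (rule L.M.finsum_cong') (use \<phi>' co[OF c] co[OF d] in \<open>auto simp: L.smult_l_distr\<close>)
    also have "\<dots> = finsum L (\<lambda>s. c s \<odot>\<^bsub>L\<^esub> \<phi> s) ?A \<oplus>\<^bsub>L\<^esub> finsum L (\<lambda>s. d s \<odot>\<^bsub>L\<^esub> \<phi> s) ?A"
      by (rule L.M.finsum_addf) (use \<phi>' co[OF c] co[OF d] in auto)
    also have "finsum L (\<lambda>s. c s \<odot>\<^bsub>L\<^esub> \<phi> s) ?A = lin_ext R L \<phi> c"
      by (rule lin_ext_superset[OF L \<phi>' A(1), symmetric]) (use co c in auto)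
    also have "finsum L (\<lambda>s. d s \<odot>\<^bsub>L\<^esub> \<phi> s) ?A = lin_ext R L \<phi> d"
      by (rule lin_ext_superset[OF L \<phi>' A(1), symmetric]) (use co d in auto)
    finally show ?thesis by (simp add: free_module_def)
  qed
  show "lin_ext R L \<phi> (a \<odot>\<^bsub>?F\<^esub> c) = a \<odot>\<^bsub>L\<^esub> lin_ext R L \<phi> c"
    if a: "a \<in> carrier R" and c: "c \<in> carrier ?F" for a c
  proof -
    let ?A = "{s. c s \<noteq> \<zero>}"
    have A: "finite ?A" "?A \<subseteq> S" using sup[OF c] by auto
    have \<phi>': "\<phi> s \<in> carrier L" if "s \<in> ?A" for s using \<phi> A(2) that by blast
    have "lin_ext R L \<phi> (\<lambda>s. a \<otimes> c s) = finsum L (\<lambda>s. (a \<otimes> c s) \<odot>\<^bsub>L\<^esub> \<phi> s) ?A"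
      by (rule lin_ext_superset[OF L \<phi>' A(1)]) (use co[OF c] a in auto)
    also have "\<dots> = finsum L (\<lambda>s. a \<odot>\<^bsub>L\<^esub> (c s \<odot>\<^bsub>L\<^esub> \<phi> s)) ?A"
      by (rule L.M.finsum_cong') (use \<phi>' co[OF c] a in \<open>auto simp: L.smult_assoc1\<close>)
    also have "\<dots> = a \<odot>\<^bsub>L\<^esub> lin_ext R L \<phi> c"
      unfolding lin_ext_def by (rule L.finsum_smult_ldistr[symmetric]) (use A a \<phi>' co[OF c] in auto)
    finally show ?thesis by (simp add: free_module_def)
  qed
qed

lemma lin_ext_free_gen:
  assumes L: "Module.module R L" and \<phi>: "\<phi> s \<in> carrier L"
  shows "lin_ext R L \<phi> (free_gen R s) = \<phi> s"
proof -
  interpret L: Module.module R L by fact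
  have "lin_ext R L \<phi> (free_gen R s) = finsum L (\<lambda>t. free_gen R s t \<odot>\<^bsub>L\<^esub> \<phi> t) {s}"
    by (rule lin_ext_superset[OF L]) (use \<phi> in \<open>auto simp: free_gen_def\<close>)
  then show ?thesis using \<phi> by (simp add: free_gen_def)
qed

lemma lin_ext_free_gen_self:
  assumes c: "c \<in> carrier (free_module R S)"
  shows "lin_ext R (free_module R S) (free_gen R) c = c"
proof
  let ?F = "free_module R S"
  interpret F: Module.module R ?F by (rule free_module_is_module)
  fix t
  let ?A = "{s. c s \<noteq> \<zero>}"
  have A: "finite ?A" "?A \<subseteq> S" using c by (auto simp: free_module_carrier)
  have "finsum ?F (\<lambda>s. c s \<odot>\<^bsub>?F\<^esub> free_gen R s) B t = (if t \<in> B then c t else \<zero>)" if "finite B" "B \<subseteq> S" for B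
    using that
  proof (induction B rule: finite_induct)
    case empty
    show ?case unfolding F.M.finsum_empty by (simp add: free_module_def)
  next
    case (insert x B)
    have "finsum ?F (\<lambda>s. c s \<odot>\<^bsub>?F\<^esub> free_gen R s) (insert x B) =
      c x \<odot>\<^bsub>?F\<^esub> free_gen R x \<oplus>\<^bsub>?F\<^esub> finsum ?F (\<lambda>s. c s \<odot>\<^bsub>?F\<^esub> free_gen R s) B"
      using insert free_module_coeff[OF c] free_gen_closed[of _ S] by (intro F.M.finsum_insert) auto
    then have "finsum ?F (\<lambda>s. c s \<odot>\<^bsub>?F\<^esub> free_gen R s) (insert x B) t =
      c x \<otimes> free_gen R x t \<oplus> finsum ?F (\<lambda>s. c s \<odot>\<^bsub>?F\<^esub> free_gen R s) B t"
      by (simp add: free_module_def)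
    then show ?case using insert free_module_coeff[OF c] by (auto simp: free_gen_def)
  qed
  from this[OF A] show "lin_ext R ?F (free_gen R) c t = c t" unfolding lin_ext_def by auto
qed

text \<open>Uniqueness in the universal property of free modules: \<open>f\<close> is applied to the
  expansion of \<open>c\<close> in the standard generators.\<close>

lemma mod_hom_free_eq_lin_ext:
  assumes L: "Module.module R L" and f: "f \<in> mod_hom R (free_module R S) L"
    and c: "c \<in> carrier (free_module R S)"
  shows "f c = lin_ext R L (\<lambda>s. f (free_gen R s)) c"
proof -
  let ?F = "free_module R S"
  interpret F: Module.module R ?F by (rule free_module_is_module)
  interpret L: Module.module R L by fact
  have A: "finite {s. c s \<noteq> \<zero>}" "{s. c s \<noteq> \<zero>} \<subseteq> S" using c by (auto simp: free_module_carrier)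
  have g: "free_gen R s \<in> carrier ?F" if "c s \<noteq> \<zero>" for s using A(2) that by (intro free_gen_closed) auto
  have "f c = f (lin_ext R ?F (free_gen R) c)" using lin_ext_free_gen_self[OF c] by simp
  also have "\<dots> = finsum L (\<lambda>s. f (c s \<odot>\<^bsub>?F\<^esub> free_gen R s)) {s. c s \<noteq> \<zero>}"
    unfolding lin_ext_def
    by (rule mod_hom_finsum[OF F.module_axioms L f A(1)]) (use g free_module_coeff[OF c] in auto)
  also have "\<dots> = lin_ext R L (\<lambda>s. f (free_gen R s)) c"
    unfolding lin_ext_def
    by (rule L.M.finsum_cong')
      (use g free_module_coeff[OF c] mod_homD[OF f] in auto)
  finally show ?thesis .
qed

end

section \<open>Products and direct sums of modules\<close>

lemma prod_module_is_module:
  assumes "Module.module R M" "Module.module R N"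
  shows "Module.module R (prod_module M N)"
proof -
  interpret M: Module.module R M by fact
  interpret N: Module.module R N by fact
  have "abelian_group (prod_module M N)"
  proof (rule abelian_groupI)
    show "\<exists>y\<in>carrier (prod_module M N). y \<oplus>\<^bsub>prod_module M N\<^esub> x = \<zero>\<^bsub>prod_module M N\<^esub>"
      if "x \<in> carrier (prod_module M N)" for x
      by (rule bexI[of _ "(\<ominus>\<^bsub>M\<^esub> fst x, \<ominus>\<^bsub>N\<^esub> snd x)"])
        (use that in \<open>auto simp: prod_module_def M.M.l_neg N.M.l_neg\<close>)
  qed (auto simp: prod_module_def M.M.a_ac N.M.a_ac)
  then show ?thesis
    by (intro Module.moduleI M.is_cring)
      (auto simp: prod_module_def M.smult_l_distr M.smult_r_distr M.smult_assoc1
        N.smult_l_distr N.smult_r_distr N.smult_assoc1)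
qed

lemma dsum_module_is_module:
  assumes M: "\<And>i. Module.module R (M i)" and "cring R"
  shows "Module.module R (dsum_module M)"
proof -
  interpret R: cring R by fact
  interpret M: Module.module R "M i" for i by (rule M)
  let ?D = "dsum_module M"
  have D: "z \<in> carrier ?D \<longleftrightarrow> finite {i. z i \<noteq> \<zero>\<^bsub>M i\<^esub>} \<and> (\<forall>i. z i \<in> carrier (M i))" for z
    by (simp add: dsum_module_def)
  have ops: "add ?D = (\<lambda>z w i. z i \<oplus>\<^bsub>M i\<^esub> w i)" "zero ?D = (\<lambda>i. \<zero>\<^bsub>M i\<^esub>)" "smult ?D = (\<lambda>a z i. a \<odot>\<^bsub>M i\<^esub> z i)"
    by (simp_all add: dsum_module_def)
  have "abelian_group ?D"
  proof (rule abelian_groupI)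
    show "z \<oplus>\<^bsub>?D\<^esub> w \<in> carrier ?D" if "z \<in> carrier ?D" "w \<in> carrier ?D" for z w
    proof -
      have "finite {i. z i \<oplus>\<^bsub>M i\<^esub> w i \<noteq> \<zero>\<^bsub>M i\<^esub>}"
        by (rule finite_subset[of _ "{i. z i \<noteq> \<zero>\<^bsub>M i\<^esub>} \<union> {i. w i \<noteq> \<zero>\<^bsub>M i\<^esub>}"]) (use that in \<open>auto simp: D\<close>)
      then show ?thesis using that by (auto simp: D ops)
    qed
    show "\<exists>w\<in>carrier ?D. w \<oplus>\<^bsub>?D\<^esub> z = \<zero>\<^bsub>?D\<^esub>" if z: "z \<in> carrier ?D" for z
    proof (rule bexI)
      show "(\<lambda>i. \<ominus>\<^bsub>M i\<^esub> z i) \<oplus>\<^bsub>?D\<^esub> z = \<zero>\<^bsub>?D\<^esub>" using z by (auto simp: D ops M.M.l_neg)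
      have "finite {i. \<ominus>\<^bsub>M i\<^esub> z i \<noteq> \<zero>\<^bsub>M i\<^esub>}"
        by (rule finite_subset[of _ "{i. z i \<noteq> \<zero>\<^bsub>M i\<^esub>}"]) (use z in \<open>auto simp: D\<close>)
      then show "(\<lambda>i. \<ominus>\<^bsub>M i\<^esub> z i) \<in> carrier ?D" using z by (auto simp: D)
    qed
  qed (auto simp: D ops M.M.a_ac)
  then show ?thesis
  proof (intro Module.moduleI R.is_cring)
    show "a \<odot>\<^bsub>?D\<^esub> z \<in> carrier ?D" if "a \<in> carrier R" "z \<in> carrier ?D" for a z
    proof -
      have "finite {i. a \<odot>\<^bsub>M i\<^esub> z i \<noteq> \<zero>\<^bsub>M i\<^esub>}"
        by (rule finite_subset[of _ "{i. z i \<noteq> \<zero>\<^bsub>M i\<^esub>}"]) (use that in \<open>auto simp: D\<close>)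
      then show ?thesis using that by (auto simp: D ops)
    qed
  qed (auto simp: D ops M.smult_l_distr M.smult_r_distr M.smult_assoc1)
qed

text \<open>Being annihilated by \<open>s\<close> modulo \<open>N\<close> depends only on the class
  modulo \<open>N\<close>. With \<open>N\<close> the coboundaries, this replaces computations in
  cohomology modules by computations with cocycles.\<close>

lemma submodule_diffD:
  assumes M: "Module.module R M" and N: "submodule N R M"
    and xy: "x \<in> carrier M" "y \<in> carrier M" "x \<ominus>\<^bsub>M\<^esub> y \<in> N"
    and s: "s \<in> carrier R" "s \<odot>\<^bsub>M\<^esub> y \<in> N"
  shows "s \<odot>\<^bsub>M\<^esub> x \<in> N"
proof -
  interpret M: Module.module R M by fact
  have "x = (x \<ominus>\<^bsub>M\<^esub> y) \<oplus>\<^bsub>M\<^esub> y" using xy by (simp add: a_minus_def M.M.a_assoc M.M.l_neg)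
  then have "s \<odot>\<^bsub>M\<^esub> x = s \<odot>\<^bsub>M\<^esub> ((x \<ominus>\<^bsub>M\<^esub> y) \<oplus>\<^bsub>M\<^esub> y)" by simp
  also have "\<dots> = s \<odot>\<^bsub>M\<^esub> (x \<ominus>\<^bsub>M\<^esub> y) \<oplus>\<^bsub>M\<^esub> s \<odot>\<^bsub>M\<^esub> y"
    using xy s by (intro M.smult_r_distr) auto
  also have "\<dots> \<in> N" by (intro M.submoduleE(5)[OF N] M.submoduleE(4)[OF N] s xy)
  finally show ?thesis .
qed

lemma submodule_diff_commute:
  assumes M: "Module.module R M" and N: "submodule N R M"
    and xy: "x \<in> carrier M" "y \<in> carrier M" "x \<ominus>\<^bsub>M\<^esub> y \<in> N"
  shows "y \<ominus>\<^bsub>M\<^esub> x \<in> N"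
proof -
  interpret M: Module.module R M by fact
  have "y \<ominus>\<^bsub>M\<^esub> x = \<ominus>\<^bsub>M\<^esub> (x \<ominus>\<^bsub>M\<^esub> y)" using xy by (simp add: a_minus_def M.M.minus_add M.M.a_comm)
  then show ?thesis using M.submoduleE(3)[OF N xy(3)] by simp
qed

section \<open>Local acyclicity\<close>

text \<open>The cohomology module \<open>H\<^sup>n(X)\<close> vanishes at \<open>p\<close> if and only if each of its elements is
  annihilated by some \<open>s\<close> outside \<open>p\<close>.\<close>

definition locally_exact :: "('a, 'r) ring_scheme \<Rightarrow> 'a set \<Rightarrow> ('a, 'b) cpx \<Rightarrow> int \<Rightarrow> bool" where
  "locally_exact R p X n \<longleftrightarrow> (\<forall>x\<in>carrier (cx_mod X n). cx_diff X n x = \<zero>\<^bsub>cx_mod X (n + 1)\<^esub> \<longrightarrow>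
     (\<exists>s\<in>carrier R - p. s \<odot>\<^bsub>cx_mod X n\<^esub> x \<in> coboundaries X n))"

definition locally_acyclic :: "('a, 'r) ring_scheme \<Rightarrow> 'a set \<Rightarrow> ('a, 'b) cpx \<Rightarrow> bool" where
  "locally_acyclic R p X \<longleftrightarrow> (\<forall>n. locally_exact R p X n)"

lemma locally_exactE:
  assumes "locally_exact R p X n" "x \<in> carrier (cx_mod X n)" "cx_diff X n x = \<zero>\<^bsub>cx_mod X (n + 1)\<^esub>"
  obtains s where "s \<in> carrier R - p" "s \<odot>\<^bsub>cx_mod X n\<^esub> x \<in> coboundaries X n"
  using assms unfolding locally_exact_def by metis

section \<open>Cocycles, coboundaries and quasi-isomorphisms\<close>

lemma is_cpxD:
  assumes "is_cpx R X"
  shows "Module.module R (cx_mod X n)" "cx_diff X n \<in> mod_hom R (cx_mod X n) (cx_mod X (n + 1))"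
    "x \<in> carrier (cx_mod X n) \<Longrightarrow> cx_diff X (n + 1) (cx_diff X n x) = \<zero>\<^bsub>cx_mod X (n + 2)\<^esub>"
    "cx_diff X (n - 1) \<in> mod_hom R (cx_mod X (n - 1)) (cx_mod X n)"
    "u \<in> carrier (cx_mod X (n - 1)) \<Longrightarrow> cx_diff X n (cx_diff X (n - 1) u) = \<zero>\<^bsub>cx_mod X (n + 1)\<^esub>"
proof -
  show "Module.module R (cx_mod X n)" "cx_diff X n \<in> mod_hom R (cx_mod X n) (cx_mod X (n + 1))" for n
    using assms by (auto simp: is_cpx_def)
  from this(2)[of "n - 1"] show "cx_diff X (n - 1) \<in> mod_hom R (cx_mod X (n - 1)) (cx_mod X n)" by simp
  show dd: "x \<in> carrier (cx_mod X n) \<Longrightarrow> cx_diff X (n + 1) (cx_diff X n x) = \<zero>\<^bsub>cx_mod X (n + 2)\<^esub>" for n x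
    using assms by (auto simp: is_cpx_def)
  have "n - 1 + 1 = n" "n - 1 + 2 = n + 1" by auto
  with dd[of u "n - 1"]
  show "u \<in> carrier (cx_mod X (n - 1)) \<Longrightarrow> cx_diff X n (cx_diff X (n - 1) u) = \<zero>\<^bsub>cx_mod X (n + 1)\<^esub>"
    by metis
qed

lemma coboundaries_submodule: "is_cpx R X \<Longrightarrow> submodule (coboundaries X n) R (cx_mod X n)"
  unfolding coboundaries_def by (intro mod_hom_image_submodule is_cpxD)

lemma coboundary_cocycle:
  assumes X: "is_cpx R X" and b: "b \<in> coboundaries X n"
  shows "b \<in> carrier (cx_mod X n)" "cx_diff X n b = \<zero>\<^bsub>cx_mod X (n + 1)\<^esub>"
proof -
  obtain u where u: "u \<in> carrier (cx_mod X (n - 1))" "b = cx_diff X (n - 1) u"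
    using b by (auto simp: coboundaries_def)
  show "b \<in> carrier (cx_mod X n)" using mod_homD(1)[OF is_cpxD(4)[OF X] u(1)] u(2) by simp
  show "cx_diff X n b = \<zero>\<^bsub>cx_mod X (n + 1)\<^esub>"
    using is_cpxD(5)[OF X u(1)] u(2) by simp
qed

lemma cocycles_submodule:
  assumes X: "is_cpx R X"
  shows "submodule {x\<in>carrier (cx_mod X n). cx_diff X n x = \<zero>\<^bsub>cx_mod X (n + 1)\<^esub>} R (cx_mod X n)"
proof -
  interpret M: Module.module R "cx_mod X n" by (rule is_cpxD(1)[OF X])
  interpret N: Module.module R "cx_mod X (n + 1)" by (rule is_cpxD(1)[OF X])
  note d = is_cpxD(2)[OF X, of n]
  show ?thesis
    by (rule M.submoduleI)
      (auto simp: mod_homD[OF d] mod_hom_zero[OF M.module_axioms N.module_axioms d]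
        mod_hom_a_inv[OF M.module_axioms N.module_axioms d] a_inv_zero[OF N.abelian_group_axioms])
qed

lemma cocycles_sel [simp]:
  "carrier (cocycles X n) = {x\<in>carrier (cx_mod X n). cx_diff X n x = \<zero>\<^bsub>cx_mod X (n + 1)\<^esub>}"
  "add (cocycles X n) = add (cx_mod X n)" "zero (cocycles X n) = zero (cx_mod X n)"
  "smult (cocycles X n) = smult (cx_mod X n)"
  by (simp_all add: cocycles_def)

lemma cocycles_is_module: "is_cpx R X \<Longrightarrow> Module.module R (cocycles X n)"
  unfolding cocycles_def by (rule submodule.submodule_is_module[OF cocycles_submodule is_cpxD(1)])

lemma cocycles_inclusion: "(\<lambda>x. x) \<in> mod_hom R (cocycles X n) (cx_mod X n)"
  by (rule mod_homI) auto

lemma cocycles_minus: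
  assumes "is_cpx R X" "x \<in> carrier (cocycles X n)" "y \<in> carrier (cocycles X n)"
  shows "x \<ominus>\<^bsub>cocycles X n\<^esub> y = x \<ominus>\<^bsub>cx_mod X n\<^esub> y"
  using mod_hom_minus[OF cocycles_is_module[OF assms(1)] is_cpxD(1)[OF assms(1)] cocycles_inclusion assms(2,3)] .

lemma coboundaries_submodule_cocycles:
  assumes X: "is_cpx R X" shows "submodule (coboundaries X n) R (cocycles X n)"
proof -
  have "cx_diff X (n - 1) \<in> mod_hom R (cx_mod X (n - 1)) (cocycles X n)"
    by (intro mod_homI) (auto simp: is_cpxD(5)[OF X] mod_homD[OF is_cpxD(4)[OF X, of n]])
  from mod_hom_image_submodule[OF is_cpxD(1)[OF X] cocycles_is_module[OF X] this]
  show ?thesis unfolding coboundaries_def .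
qed

lemma chain_mapD:
  assumes "chain_map R X Y f"
  shows "f n \<in> mod_hom R (cx_mod X n) (cx_mod Y n)"
    "x \<in> carrier (cx_mod X n) \<Longrightarrow> f (n + 1) (cx_diff X n x) = cx_diff Y n (f n x)"
  using assms by (auto simp: chain_map_def)

lemma chain_map_coboundary:
  assumes f: "chain_map R X Y f" and b: "b \<in> coboundaries X n"
  shows "f n b \<in> coboundaries Y n"
proof -
  obtain u where u: "u \<in> carrier (cx_mod X (n - 1))" "b = cx_diff X (n - 1) u"
    using b by (auto simp: coboundaries_def)
  have "f n b = cx_diff Y (n - 1) (f (n - 1) u)" using chain_mapD(2)[OF f u(1)] u(2) by simp
  then show ?thesis using mod_homD(1)[OF chain_mapD(1)[OF f] u(1)] by (auto simp: coboundaries_def)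
qed

lemma chain_map_cocycle:
  assumes X: "is_cpx R X" and Y: "is_cpx R Y" and f: "chain_map R X Y f"
    and x: "x \<in> carrier (cx_mod X n)" "cx_diff X n x = \<zero>\<^bsub>cx_mod X (n + 1)\<^esub>"
  shows "f n x \<in> carrier (cx_mod Y n)" "cx_diff Y n (f n x) = \<zero>\<^bsub>cx_mod Y (n + 1)\<^esub>"
  using mod_homD(1)[OF chain_mapD(1)[OF f] x(1)] chain_mapD(2)[OF f x(1)] x(2)
    mod_hom_zero[OF is_cpxD(1)[OF X] is_cpxD(1)[OF Y] chain_mapD(1)[OF f], of "n + 1"] by auto

lemma chain_map_comp:
  "\<lbrakk>chain_map R X Y f; chain_map R Y Z g\<rbrakk> \<Longrightarrow> chain_map R X Z (\<lambda>n. g n \<circ> f n)"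
  unfolding chain_map_def[of R X Z] comp_def
  by (auto intro: mod_hom_comp chain_mapD simp: chain_mapD(2) mod_homD(1)[OF chain_mapD(1)])

text \<open>Injectivity and surjectivity on cohomology, stated for elements. From here on
  quasi-isomorphisms are used in this form, without cosets.\<close>

lemma quasi_isoD:
  assumes X: "is_cpx R X" and Y: "is_cpx R Y" and q: "quasi_iso R X Y f"
  shows "chain_map R X Y f"
    "\<lbrakk>x \<in> carrier (cocycles X n); f n x \<in> coboundaries Y n\<rbrakk> \<Longrightarrow> x \<in> coboundaries X n"
    "y \<in> carrier (cocycles Y n) \<Longrightarrow> \<exists>x\<in>carrier (cocycles X n). y \<ominus>\<^bsub>cx_mod Y n\<^esub> f n x \<in> coboundaries Y n"
proof -
  show f: "chain_map R X Y f" using q by (simp add: quasi_iso_def)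
  let ?F = "coset_map (cocycles Y n) (coboundaries Y n) (f n)"
  have iso: "?F \<in> mod_iso R (cohomology X n) (cohomology Y n)" using q by (simp add: quasi_iso_def)
  note MX = cocycles_is_module[OF X, of n] and MY = cocycles_is_module[OF Y, of n]
    and BX = coboundaries_submodule_cocycles[OF X, of n] and BY = coboundaries_submodule_cocycles[OF Y, of n]
  have fZ: "f n \<in> mod_hom R (cocycles X n) (cocycles Y n)"
    using chain_map_cocycle[OF X Y f] mod_homD[OF chain_mapD(1)[OF f, of n]] by (intro mod_homI) auto
  have F: "?F (coboundaries X n +>\<^bsub>cocycles X n\<^esub> x) = coboundaries Y n +>\<^bsub>cocycles Y n\<^esub> f n x"
    if "x \<in> carrier (cocycles X n)" for x
    by (rule coset_map_apply[OF MX BX MY BY fZ chain_map_coboundary[OF f] that])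
  show "x \<in> coboundaries X n" if x: "x \<in> carrier (cocycles X n)" "f n x \<in> coboundaries Y n"
  proof -
    let ?Z = "\<zero>\<^bsub>cocycles X n\<^esub>"
    interpret MX: Module.module R "cocycles X n" by (rule MX)
    have "?F (coboundaries X n +>\<^bsub>cocycles X n\<^esub> x) = \<zero>\<^bsub>cohomology Y n\<^esub>"
      using F[OF x(1)] quot_eq_zero_iff[OF MY BY mod_homD(1)[OF fZ x(1)]] x(2)
      unfolding cohomology_def by simp
    also have "\<dots> = ?F (coboundaries X n +>\<^bsub>cocycles X n\<^esub> ?Z)"
      using F[OF MX.M.zero_closed] mod_hom_zero[OF MX MY fZ] quot_zero[OF MY BY]
      unfolding cohomology_def by simp
    finally have "coboundaries X n +>\<^bsub>cocycles X n\<^esub> x = coboundaries X n +>\<^bsub>cocycles X n\<^esub> ?Z"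
      using inj_onD[OF mod_isoD(2)[OF iso]] x(1) MX.M.zero_closed quot_carrier[OF MX BX]
      unfolding cohomology_def by blast
    then show ?thesis
      using quot_eq_zero_iff[OF MX BX x(1)] quot_zero[OF MX BX] by simp
  qed
  show "\<exists>x\<in>carrier (cocycles X n). y \<ominus>\<^bsub>cx_mod Y n\<^esub> f n x \<in> coboundaries Y n"
    if y: "y \<in> carrier (cocycles Y n)"
  proof -
    have "coboundaries Y n +>\<^bsub>cocycles Y n\<^esub> y \<in> carrier (cohomology Y n)"
      using y quot_carrier[OF MY BY] unfolding cohomology_def by blast
    then obtain C where "C \<in> carrier (cohomology X n)" "?F C = coboundaries Y n +>\<^bsub>cocycles Y n\<^esub> y"
      using mod_isoD(3)[OF iso] by (metis imageE)
    then obtain x where x: "x \<in> carrier (cocycles X n)"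
        "coboundaries Y n +>\<^bsub>cocycles Y n\<^esub> f n x = coboundaries Y n +>\<^bsub>cocycles Y n\<^esub> y"
      using F quot_carrier[OF MX BX] unfolding cohomology_def by force
    have "y \<ominus>\<^bsub>cocycles Y n\<^esub> f n x \<in> coboundaries Y n"
      using x(2) quot_eq_iff[OF MY BY y mod_homD(1)[OF fZ x(1)]] by simp
    then show ?thesis using cocycles_minus[OF Y y mod_homD(1)[OF fZ x(1)]] x(1) by auto
  qed
qed

lemma cohomology_trivial_iff:
  assumes X: "is_cpx R X"
  shows "carrier (cohomology X n) = {\<zero>\<^bsub>cohomology X n\<^esub>} \<longleftrightarrow> carrier (cocycles X n) \<subseteq> coboundaries X n"
proof -
  note MX = cocycles_is_module[OF X, of n] and BX = coboundaries_submodule_cocycles[OF X, of n]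
  interpret MX: Module.module R "cocycles X n" by (rule MX)
  let ?\<pi> = "\<lambda>x. coboundaries X n +>\<^bsub>cocycles X n\<^esub> x"
  have car: "carrier (cohomology X n) = ?\<pi> ` carrier (cocycles X n)"
    unfolding cohomology_def by (rule quot_carrier[OF MX BX])
  have z: "\<zero>\<^bsub>cohomology X n\<^esub> \<in> ?\<pi> ` carrier (cocycles X n)"
    unfolding cohomology_def quot_zero[OF MX BX] by (rule imageI) (rule MX.M.zero_closed)
  have eq: "?\<pi> x = \<zero>\<^bsub>cohomology X n\<^esub> \<longleftrightarrow> x \<in> coboundaries X n" if "x \<in> carrier (cocycles X n)" for x
    unfolding cohomology_def by (rule quot_eq_zero_iff[OF MX BX that])
  have "carrier (cohomology X n) = {\<zero>\<^bsub>cohomology X n\<^esub>} \<longleftrightarrow>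
      (\<forall>x\<in>carrier (cocycles X n). ?\<pi> x = \<zero>\<^bsub>cohomology X n\<^esub>)"
    using z unfolding car by blast
  also have "\<dots> \<longleftrightarrow> carrier (cocycles X n) \<subseteq> coboundaries X n"
    using eq by blast
  finally show ?thesis .
qed

lemma quasi_iso_id:
  assumes X: "is_cpx R X" shows "quasi_iso R X X (\<lambda>n x. x)"
proof -
  have "coset_map (cocycles X n) (coboundaries X n) (\<lambda>x. x) \<in> mod_iso R (cohomology X n) (cohomology X n)" for n
  proof -
    note MX = cocycles_is_module[OF X, of n] and BX = coboundaries_submodule_cocycles[OF X, of n]
    interpret H: Module.module R "cohomology X n"
      unfolding cohomology_def by (rule quot_is_module[OF MX BX])
    have "coset_map (cocycles X n) (coboundaries X n) (\<lambda>x. x) C = C" if "C \<in> carrier (cohomology X n)" for C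
      using that coset_map_apply[OF MX BX MX BX mod_hom_id] quot_carrier[OF MX BX]
      unfolding cohomology_def by force
    then show ?thesis
      unfolding mod_iso_def by (auto intro!: mod_homI simp: bij_betw_def inj_on_def)
  qed
  then show ?thesis by (auto simp: quasi_iso_def chain_map_def mod_hom_id)
qed

text \<open>On a cocycle the summand of the homotopy formula that contains
  \<open>cx_diff W n w\<close> vanishes, and the remaining one is a coboundary.\<close>

lemma homotopic_diff:
  assumes W: "is_cpx R W" and Y: "is_cpx R Y" and h: "homotopic R W Y f g"
    and w: "w \<in> carrier (cocycles W n)"
  shows "f n w \<ominus>\<^bsub>cx_mod Y n\<^esub> g n w \<in> coboundaries Y n"
proof -
  obtain h where hm: "\<And>n. h n \<in> mod_hom R (cx_mod W n) (cx_mod Y (n - 1))"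
    and he: "\<And>n x. x \<in> carrier (cx_mod W n) \<Longrightarrow> f n x \<ominus>\<^bsub>cx_mod Y n\<^esub> g n x =
          cx_diff Y (n - 1) (h n x) \<oplus>\<^bsub>cx_mod Y n\<^esub> h (n + 1) (cx_diff W n x)"
    using h unfolding homotopic_def by metis
  interpret Yn: Module.module R "cx_mod Y n" by (rule is_cpxD(1)[OF Y])
  have "h (n + 1) (cx_diff W n w) = \<zero>\<^bsub>cx_mod Y n\<^esub>"
    using w mod_hom_zero[OF is_cpxD(1)[OF W] is_cpxD(1)[OF Y] hm, of "n + 1"] by simp
  moreover have hw: "h n w \<in> carrier (cx_mod Y (n - 1))" using mod_homD(1)[OF hm] w by auto
  ultimately have "f n w \<ominus>\<^bsub>cx_mod Y n\<^esub> g n w = cx_diff Y (n - 1) (h n w)"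
    using he[of w n] w mod_homD(1)[OF is_cpxD(4)[OF Y] hw] by simp
  then show ?thesis using hw by (auto simp: coboundaries_def)
qed

lemma homotopic_refl:
  assumes Y: "is_cpx R Y" and f: "\<And>n. f n \<in> mod_hom R (cx_mod W n) (cx_mod Y n)"
  shows "homotopic R W Y f f"
proof -
  have 0: "(\<lambda>x. \<zero>\<^bsub>cx_mod Y m\<^esub>) \<in> mod_hom R (cx_mod W n) (cx_mod Y m)" for m n
  proof -
    interpret Y: Module.module R "cx_mod Y m" by (rule is_cpxD(1)[OF Y])
    show ?thesis by (rule mod_homI) auto
  qed
  have "f n x \<ominus>\<^bsub>cx_mod Y n\<^esub> f n x = cx_diff Y (n - 1) \<zero>\<^bsub>cx_mod Y (n - 1)\<^esub> \<oplus>\<^bsub>cx_mod Y n\<^esub> \<zero>\<^bsub>cx_mod Y n\<^esub>"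
    if "x \<in> carrier (cx_mod W n)" for n x
  proof -
    interpret Y: Module.module R "cx_mod Y n" by (rule is_cpxD(1)[OF Y])
    show ?thesis
      using mod_homD(1)[OF f that] mod_hom_zero[OF is_cpxD(1)[OF Y] is_cpxD(1)[OF Y] is_cpxD(4)[OF Y], of n]
      by (simp add: a_minus_def Y.M.r_neg)
  qed
  then show ?thesis
    unfolding homotopic_def using 0 by (intro exI[of _ "\<lambda>n x. \<zero>\<^bsub>cx_mod Y (n - 1)\<^esub>"]) auto
qed

text \<open>One direction lifts a cocycle of \<open>Y\<close> to one of \<open>X\<close> by
  surjectivity on cohomology. The other applies injectivity to the multiple of \<open>x\<close>
  whose image is a coboundary.\<close>

lemma quasi_iso_locally_acyclic:
  assumes X: "is_cpx R X" and Y: "is_cpx R Y" and q: "quasi_iso R X Y f"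
  shows "locally_acyclic R p X \<longleftrightarrow> locally_acyclic R p Y"
proof
  note q' = quasi_isoD[OF X Y q]
  note fh = chain_mapD(1)[OF q'(1)]
  assume L: "locally_acyclic R p X"
  show "locally_acyclic R p Y"
    unfolding locally_acyclic_def locally_exact_def
  proof (intro allI ballI impI)
    fix n y assume "y \<in> carrier (cx_mod Y n)" "cx_diff Y n y = \<zero>\<^bsub>cx_mod Y (n + 1)\<^esub>"
    then have y: "y \<in> carrier (cocycles Y n)" by simp
    obtain x where x: "x \<in> carrier (cx_mod X n)" "cx_diff X n x = \<zero>\<^bsub>cx_mod X (n + 1)\<^esub>"
      and b: "y \<ominus>\<^bsub>cx_mod Y n\<^esub> f n x \<in> coboundaries Y n" using q'(3)[OF y] by auto
    have "locally_exact R p X n" using L by (simp add: locally_acyclic_def)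
    then obtain s where s: "s \<in> carrier R - p" "s \<odot>\<^bsub>cx_mod X n\<^esub> x \<in> coboundaries X n"
      using x by (rule locally_exactE)
    have "s \<odot>\<^bsub>cx_mod Y n\<^esub> f n x \<in> coboundaries Y n"
      using chain_map_coboundary[OF q'(1) s(2)] mod_homD(3)[OF fh] s(1) x(1) by auto
    moreover have "y \<in> carrier (cx_mod Y n)" "s \<in> carrier R" using y s(1) by auto
    ultimately have "s \<odot>\<^bsub>cx_mod Y n\<^esub> y \<in> coboundaries Y n"
      using submodule_diffD[OF is_cpxD(1)[OF Y] coboundaries_submodule[OF Y] _ mod_homD(1)[OF fh x(1)] b]
      by blast
    then show "\<exists>s\<in>carrier R - p. s \<odot>\<^bsub>cx_mod Y n\<^esub> y \<in> coboundaries Y n" using s(1) by blast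
  qed
next
  note q' = quasi_isoD[OF X Y q]
  note fh = chain_mapD(1)[OF q'(1)]
  assume L: "locally_acyclic R p Y"
  show "locally_acyclic R p X"
    unfolding locally_acyclic_def locally_exact_def
  proof (intro allI ballI impI)
    fix n x assume x: "x \<in> carrier (cx_mod X n)" "cx_diff X n x = \<zero>\<^bsub>cx_mod X (n + 1)\<^esub>"
    have "locally_exact R p Y n" using L by (simp add: locally_acyclic_def)
    then obtain s where s: "s \<in> carrier R - p" "s \<odot>\<^bsub>cx_mod Y n\<^esub> f n x \<in> coboundaries Y n"
      using chain_map_cocycle[OF X Y q'(1) x] by (rule locally_exactE)
    interpret C: Module.module R "cocycles X n" by (rule cocycles_is_module[OF X])
    have "s \<odot>\<^bsub>cocycles X n\<^esub> x \<in> carrier (cocycles X n)" using s(1) x by (intro C.smult_closed) auto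
    then have "s \<odot>\<^bsub>cx_mod X n\<^esub> x \<in> coboundaries X n"
      using s x mod_homD(3)[OF fh[of n], of s x] by (intro q'(2)) auto
    then show "\<exists>s\<in>carrier R - p. s \<odot>\<^bsub>cx_mod X n\<^esub> x \<in> coboundaries X n" using s(1) by blast
  qed
qed

text \<open>Of \<open>X\<close> only closedness of the differential is assumed, so mapping cones and
  total tensor products can be compared with their small models without a computation of d d =
  0.\<close>

lemma cpx_iso_locally_acyclic:
  assumes M: "\<And>n. Module.module R (cx_mod X n)"
    and d: "\<And>n x. x \<in> carrier (cx_mod X n) \<Longrightarrow> cx_diff X n x \<in> carrier (cx_mod X (n + 1))"
    and Y: "is_cpx R Y" and iso: "cpx_iso R X Y \<phi>"
  shows "locally_acyclic R p X \<longleftrightarrow> locally_acyclic R p Y"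
proof -
  have ch: "chain_map R X Y \<phi>" and mi: "\<phi> n \<in> mod_iso R (cx_mod X n) (cx_mod Y n)" for n
    using iso by (auto simp: cpx_iso_def)
  note mh = mod_isoD(1)[OF mi]
  have eq0: "cx_diff Y n (\<phi> n x) = \<zero>\<^bsub>cx_mod Y (n + 1)\<^esub> \<longleftrightarrow> cx_diff X n x = \<zero>\<^bsub>cx_mod X (n + 1)\<^esub>"
    if x: "x \<in> carrier (cx_mod X n)" for n x
  proof -
    interpret X: Module.module R "cx_mod X (n + 1)" by (rule M)
    have "cx_diff Y n (\<phi> n x) = \<phi> (n + 1) (cx_diff X n x)" using chain_mapD(2)[OF ch x] by simp
    moreover have "\<phi> (n + 1) \<zero>\<^bsub>cx_mod X (n + 1)\<^esub> = \<zero>\<^bsub>cx_mod Y (n + 1)\<^esub>"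
      by (rule mod_hom_zero[OF M is_cpxD(1)[OF Y] mh])
    ultimately show ?thesis
      using inj_on_eq_iff[OF mod_isoD(2)[OF mi] d[OF x] X.M.zero_closed] by metis
  qed
  have cob: "\<phi> n x \<in> coboundaries Y n \<longleftrightarrow> x \<in> coboundaries X n" if x: "x \<in> carrier (cx_mod X n)" for n x
  proof
    assume "\<phi> n x \<in> coboundaries Y n"
    then obtain v where v: "v \<in> carrier (cx_mod Y (n - 1))" "\<phi> n x = cx_diff Y (n - 1) v"
      by (auto simp: coboundaries_def)
    then have "v \<in> \<phi> (n - 1) ` carrier (cx_mod X (n - 1))"
      using mod_isoD(3)[OF mi[of "n - 1"]] by simp
    then obtain u where u: "u \<in> carrier (cx_mod X (n - 1))" "v = \<phi> (n - 1) u" by auto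
    have e: "n - 1 + 1 = n" by simp
    have "\<phi> n x = \<phi> n (cx_diff X (n - 1) u)" using chain_mapD(2)[OF ch u(1)] u(2) v(2) unfolding e by simp
    then have "x = cx_diff X (n - 1) u"
      using inj_on_eq_iff[OF mod_isoD(2)[OF mi[of n]] x] d[OF u(1)] unfolding e by simp
    then show "x \<in> coboundaries X n" using u(1) by (auto simp: coboundaries_def)
  qed (rule chain_map_coboundary[OF ch])
  have "locally_exact R p X n \<longleftrightarrow> locally_exact R p Y n" for n
  proof -
    interpret X: Module.module R "cx_mod X n" by (rule M)
    have "locally_exact R p Y n \<longleftrightarrow> (\<forall>x\<in>carrier (cx_mod X n). cx_diff Y n (\<phi> n x) = \<zero>\<^bsub>cx_mod Y (n + 1)\<^esub> \<longrightarrow>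
       (\<exists>s\<in>carrier R - p. s \<odot>\<^bsub>cx_mod Y n\<^esub> \<phi> n x \<in> coboundaries Y n))"
      unfolding locally_exact_def mod_isoD(3)[OF mi, of n, symmetric] by simp
    also have "\<dots> \<longleftrightarrow> locally_exact R p X n"
      unfolding locally_exact_def
    proof (rule ball_cong[OF refl])
      fix x assume x: "x \<in> carrier (cx_mod X n)"
      have "s \<odot>\<^bsub>cx_mod Y n\<^esub> \<phi> n x \<in> coboundaries Y n \<longleftrightarrow> s \<odot>\<^bsub>cx_mod X n\<^esub> x \<in> coboundaries X n"
        if s: "s \<in> carrier R" for s
        using cob[OF X.smult_closed[OF s x]] mod_homD(3)[OF mh s x] by simp
      then show "(cx_diff Y n (\<phi> n x) = \<zero>\<^bsub>cx_mod Y (n + 1)\<^esub> \<longrightarrow>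
         (\<exists>s\<in>carrier R - p. s \<odot>\<^bsub>cx_mod Y n\<^esub> \<phi> n x \<in> coboundaries Y n)) =
         (cx_diff X n x = \<zero>\<^bsub>cx_mod X (n + 1)\<^esub> \<longrightarrow> (\<exists>s\<in>carrier R - p. s \<odot>\<^bsub>cx_mod X n\<^esub> x \<in> coboundaries X n))"
        unfolding eq0[OF x] by auto
    qed
    finally show ?thesis ..
  qed
  then show ?thesis by (simp add: locally_acyclic_def)
qed

section \<open>Roofs and retracts\<close>

lemma Dminus_obD: "X \<in> Dminus_ob R \<Longrightarrow> is_cpx R X" "X \<in> Dminus_ob R \<Longrightarrow> fg_module R (cx_mod X n)"
  by (auto simp: Dminus_ob_def)

text \<open>Reflexivity of \<open>roof_equiv\<close> for roofs with identity left leg. It supplies a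
  concrete member of \<open>loc\<close>, so that an equation between morphism classes can be turned
  into an equivalence of roofs.\<close>

lemma roof_class_self:
  assumes X: "X \<in> Dminus_ob R" and f: "chain_map R X Y f" and Y: "is_cpx R Y"
  shows "(X, (\<lambda>n x. x), f) \<in> loc R X Y f"
proof -
  note X' = Dminus_obD(1)[OF X]
  have c: "chain_map R X X (\<lambda>n x. x)" by (auto simp: chain_map_def mod_hom_id)
  have "roof_equiv R X Y (X, (\<lambda>n x. x), f) (X, (\<lambda>n x. x), f)"
    unfolding roof_equiv_def
    using X c quasi_iso_id[OF X'] homotopic_refl[OF X', of "\<lambda>n x. x" X] homotopic_refl[OF Y, of f X]
      chain_mapD(1)[OF f]
    by (auto intro!: bexI[of _ X] exI[of _ "\<lambda>n x. x"] simp: comp_def mod_hom_id)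
  then show ?thesis using X f quasi_iso_id[OF X'] by (auto simp: loc_def roof_class_def roofs_def)
qed

lemma loc_in_mor:
  assumes X: "X \<in> Dminus_ob R" and f: "chain_map R X Y f"
  shows "loc R X Y f \<in> Dminus_mor R X Y"
  using X f quasi_iso_id[OF Dminus_obD(1)[OF X]] by (auto simp: loc_def Dminus_mor_def roofs_def)

text \<open>Local acyclicity passes to retracts, hence to isomorphic objects and to direct summands: the
  identity of \<open>X\<close> on cohomology factors through that of \<open>S\<close>.\<close>

lemma locally_acyclic_retract:
  assumes X: "X \<in> Dminus_ob R" and S: "S \<in> Dminus_ob R"
    and h: "h \<in> Dminus_mor R S X"
    and eq: "Dminus_comp R X S X h i = loc R X X (\<lambda>n x. x)"
    and i: "i \<in> Dminus_mor R X S"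
    and L: "locally_acyclic R p S"
  shows "locally_acyclic R p X"
proof -
  note X' = Dminus_obD(1)[OF X]
  have c: "chain_map R X X (\<lambda>n x. x)" by (auto simp: chain_map_def mod_hom_id)
  \<comment> \<open>By \<open>eq\<close> the identity roof lies in one of the classes whose union is
    the composite. This produces an explicit composite roof with vertex \<open>U\<close> that is
    equivalent to the identity roof.\<close>
  have "(X, (\<lambda>n x. x), (\<lambda>n x. x)) \<in> Dminus_comp R X S X h i"
    unfolding eq by (rule roof_class_self[OF X c X'])
  then obtain U s t' g f' Z f W t where "(Z, s, f) \<in> i" and Wh: "(W, t, g) \<in> h" and U: "U \<in> Dminus_ob R"
    and t': "quasi_iso R U Z t'" and f': "chain_map R U W f'"
    and mem: "(X, (\<lambda>n x. x), (\<lambda>n x. x)) \<in> roof_class R X X (U, (\<lambda>n. s n \<circ> t' n), (\<lambda>n. g n \<circ> f' n))"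
    unfolding Dminus_comp_def by blast
  from mem have "roof_equiv R X X (U, (\<lambda>n. s n \<circ> t' n), (\<lambda>n. g n \<circ> f' n)) (X, (\<lambda>n x. x), (\<lambda>n x. x))"
    by (simp add: roof_class_def)
  then obtain V u u' where V: "V \<in> Dminus_ob R" and u: "chain_map R V U u" and u': "chain_map R V X u'"
    and q: "quasi_iso R V X (\<lambda>n. (s n \<circ> t' n) \<circ> u n)"
    and h1: "homotopic R V X (\<lambda>n. (s n \<circ> t' n) \<circ> u n) (\<lambda>n. (\<lambda>x. x) \<circ> u' n)"
    and h2: "homotopic R V X (\<lambda>n. (g n \<circ> f' n) \<circ> u n) (\<lambda>n. (\<lambda>x. x) \<circ> u' n)"
    unfolding roof_equiv_def by auto
  have "(W, t, g) \<in> roofs R S X" using h Wh by (auto simp: Dminus_mor_def roof_class_def)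
  then have W: "W \<in> Dminus_ob R" and t: "quasi_iso R W S t" and g: "chain_map R W X g"
    by (auto simp: roofs_def)
  note W' = Dminus_obD(1)[OF W] and V' = Dminus_obD(1)[OF V]
  have LW: "locally_acyclic R p W"
    using quasi_iso_locally_acyclic[OF W' Dminus_obD(1)[OF S] t] L by blast
  \<comment> \<open>Both legs of the identity roof are identities, so \<open>h1\<close> and
    \<open>h2\<close> compare with the same map \<open>u'\<close>. Hence the quasi-isomorphism
    \<open>?\<sigma>\<close> agrees on cohomology with the map through \<open>W\<close>, and
    \<open>W\<close> is locally acyclic like \<open>S\<close>.\<close>
  let ?\<sigma> = "\<lambda>n. (s n \<circ> t' n) \<circ> u n"
  have \<sigma>: "chain_map R V X ?\<sigma>" by (rule quasi_isoD(1)[OF V' X' q])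
  have fu: "chain_map R V W (\<lambda>n. f' n \<circ> u n)" by (rule chain_map_comp[OF u f'])
  show ?thesis
    unfolding locally_acyclic_def locally_exact_def
  proof (intro allI ballI impI)
    fix n x assume "x \<in> carrier (cx_mod X n)" "cx_diff X n x = \<zero>\<^bsub>cx_mod X (n + 1)\<^esub>"
    then have x: "x \<in> carrier (cocycles X n)" by simp
    note sub = is_cpxD(1)[OF X', of n] coboundaries_submodule[OF X', of n]
    obtain w where wZ: "w \<in> carrier (cocycles V n)"
      and b: "x \<ominus>\<^bsub>cx_mod X n\<^esub> ?\<sigma> n w \<in> coboundaries X n" using quasi_isoD(3)[OF V' X' q x] by blast
    from wZ have w: "w \<in> carrier (cx_mod V n)" "cx_diff V n w = \<zero>\<^bsub>cx_mod V (n + 1)\<^esub>" by auto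
    have "locally_exact R p W n" using LW by (simp add: locally_acyclic_def)
    then obtain a where a: "a \<in> carrier R - p" "a \<odot>\<^bsub>cx_mod W n\<^esub> (f' n \<circ> u n) w \<in> coboundaries W n"
      using chain_map_cocycle[OF V' W' fu w] by (rule locally_exactE)
    have fw: "(f' n \<circ> u n) w \<in> carrier (cx_mod W n)" by (rule chain_map_cocycle[OF V' W' fu w])
    have car: "?\<sigma> n w \<in> carrier (cx_mod X n)" "u' n w \<in> carrier (cx_mod X n)"
      "g n (f' n (u n w)) \<in> carrier (cx_mod X n)"
      using mod_homD(1)[OF chain_mapD(1)[OF \<sigma>] w(1)] mod_homD(1)[OF chain_mapD(1)[OF u'] w(1)]
        mod_homD(1)[OF chain_mapD(1)[OF g] fw] by auto
    \<comment> \<open>The relation moves along a chain of elements that agree modulo coboundaries: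
      from the image through \<open>W\<close> to \<open>u' n w\<close> by \<open>h2\<close>, then to
      \<open>?\<sigma> n w\<close> by \<open>h1\<close>, then to \<open>x\<close> by
      \<open>b\<close>. The scalar \<open>a\<close> stays the same.\<close>
    have "a \<odot>\<^bsub>cx_mod X n\<^esub> g n (f' n (u n w)) \<in> coboundaries X n"
      using chain_map_coboundary[OF g a(2)] mod_homD(3)[OF chain_mapD(1)[OF g] _ fw, of a] a(1) by simp
    moreover have "g n (f' n (u n w)) \<ominus>\<^bsub>cx_mod X n\<^esub> u' n w \<in> coboundaries X n"
      using homotopic_diff[OF V' X' h2 wZ] unfolding comp_def .
    moreover have aR: "a \<in> carrier R" using a(1) by simp
    ultimately have "a \<odot>\<^bsub>cx_mod X n\<^esub> u' n w \<in> coboundaries X n"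
      using submodule_diffD[OF sub car(2,3) submodule_diff_commute[OF sub car(3,2)]] by blast
    moreover have "?\<sigma> n w \<ominus>\<^bsub>cx_mod X n\<^esub> u' n w \<in> coboundaries X n"
      using homotopic_diff[OF V' X' h1 wZ] unfolding comp_def .
    ultimately have "a \<odot>\<^bsub>cx_mod X n\<^esub> ?\<sigma> n w \<in> coboundaries X n"
      using submodule_diffD[OF sub car(1,2) _ aR] by blast
    moreover have "x \<in> carrier (cx_mod X n)" using x by simp
    ultimately have "a \<odot>\<^bsub>cx_mod X n\<^esub> x \<in> coboundaries X n"
      using submodule_diffD[OF sub _ car(1) b aR] by blast
    then show "\<exists>s\<in>carrier R - p. s \<odot>\<^bsub>cx_mod X n\<^esub> x \<in> coboundaries X n" using a(1) by blast
  qed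
qed

section \<open>Shifts and mapping cones\<close>

lemma a_inv_eq_zero_iff:
  assumes "abelian_group M" "x \<in> carrier M"
  shows "\<ominus>\<^bsub>M\<^esub> x = \<zero>\<^bsub>M\<^esub> \<longleftrightarrow> x = \<zero>\<^bsub>M\<^esub>"
proof -
  interpret abelian_group M by fact
  show ?thesis using a_inv_zero[OF assms(1)] minus_minus[OF assms(2)] by metis
qed

lemma abelian_group_cancel:
  assumes "abelian_group M" "x \<in> carrier M" "y \<in> carrier M"
  shows "\<ominus>\<^bsub>M\<^esub> x \<oplus>\<^bsub>M\<^esub> (y \<oplus>\<^bsub>M\<^esub> x) = y"
proof -
  interpret abelian_group M by fact
  show ?thesis using a_comm[OF assms(3,2)] assms(2,3) r_neg1 by simp
qed

lemma shift_cpx_sel: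
  "cx_mod (shift_cpx X) n = cx_mod X (n + 1)"
  "cx_diff (shift_cpx X) n x = \<ominus>\<^bsub>cx_mod X (n + 2)\<^esub> cx_diff X (n + 1) x"
  by (simp_all add: shift_cpx_def)

lemma shift_is_cpx:
  assumes X: "is_cpx R X" shows "is_cpx R (shift_cpx X)"
proof -
  have e: "n + 1 + 1 = n + 2" "n + 1 + 2 = n + 2 + 1" for n :: int by auto
  have hom: "cx_diff (shift_cpx X) n \<in> mod_hom R (cx_mod (shift_cpx X) n) (cx_mod (shift_cpx X) (n + 1))" for n
  proof -
    interpret M: Module.module R "cx_mod X (n + 2)" by (rule is_cpxD(1)[OF X])
    note d = mod_homD[OF is_cpxD(2)[OF X, of "n + 1", unfolded e]]
    show ?thesis
      unfolding shift_cpx_sel e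
      by (rule mod_homI) (auto simp: shift_cpx_sel d M.M.minus_add M.smult_r_minus M.M.a_comm)
  qed
  have "cx_diff (shift_cpx X) (n + 1) (cx_diff (shift_cpx X) n x) = \<zero>\<^bsub>cx_mod (shift_cpx X) (n + 2)\<^esub>"
    if x: "x \<in> carrier (cx_mod (shift_cpx X) n)" for n x
  proof -
    interpret M: Module.module R "cx_mod X (n + 2)" by (rule is_cpxD(1)[OF X])
    interpret N: Module.module R "cx_mod X (n + 2 + 1)" by (rule is_cpxD(1)[OF X])
    have x': "x \<in> carrier (cx_mod X (n + 1))" using x by (simp add: shift_cpx_sel)
    have dx: "cx_diff X (n + 1) x \<in> carrier (cx_mod X (n + 2))"
      using mod_homD(1)[OF is_cpxD(2)[OF X, of "n + 1"] x'] unfolding e .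
    have "cx_diff X (n + 2) (\<ominus>\<^bsub>cx_mod X (n + 2)\<^esub> cx_diff X (n + 1) x) =
        \<ominus>\<^bsub>cx_mod X (n + 2 + 1)\<^esub> cx_diff X (n + 2) (cx_diff X (n + 1) x)"
      by (rule mod_hom_a_inv[OF M.module_axioms N.module_axioms is_cpxD(2)[OF X] dx])
    also have "cx_diff X (n + 2) (cx_diff X (n + 1) x) = \<zero>\<^bsub>cx_mod X (n + 2 + 1)\<^esub>"
      using is_cpxD(3)[OF X x'] unfolding e .
    finally have E: "cx_diff X (n + 2) (\<ominus>\<^bsub>cx_mod X (n + 2)\<^esub> cx_diff X (n + 1) x) = \<zero>\<^bsub>cx_mod X (n + 2 + 1)\<^esub>"
      unfolding a_inv_zero[OF N.abelian_group_axioms] .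
    show ?thesis unfolding shift_cpx_sel e E a_inv_zero[OF N.abelian_group_axioms] ..
  qed
  then show ?thesis using hom is_cpxD(1)[OF X] by (auto simp: is_cpx_def shift_cpx_sel)
qed

text \<open>The sign of the shifted differential is absorbed by passing from \<open>x\<close> to its
  negative.\<close>

lemma shift_coboundaries:
  assumes X: "is_cpx R X" shows "coboundaries (shift_cpx X) n = coboundaries X (n + 1)"
proof -
  have e: "n - 1 + 1 = n" "n - 1 + 2 = n + 1" "n + 1 - 1 = n" by auto
  note M = is_cpxD(1)[OF X] and d = is_cpxD(2)[OF X, of n]
  interpret M: Module.module R "cx_mod X n" by (rule M)
  interpret N: Module.module R "cx_mod X (n + 1)" by (rule M)
  have "(\<lambda>x. \<ominus>\<^bsub>cx_mod X (n + 1)\<^esub> cx_diff X n x) ` carrier (cx_mod X n) = cx_diff X n ` carrier (cx_mod X n)"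
  proof (intro equalityI subsetI)
    fix y assume "y \<in> (\<lambda>x. \<ominus>\<^bsub>cx_mod X (n + 1)\<^esub> cx_diff X n x) ` carrier (cx_mod X n)"
    then obtain x where "x \<in> carrier (cx_mod X n)" "y = \<ominus>\<^bsub>cx_mod X (n + 1)\<^esub> cx_diff X n x" by auto
    then show "y \<in> cx_diff X n ` carrier (cx_mod X n)"
      using mod_hom_a_inv[OF M M d] by (intro image_eqI[of _ _ "\<ominus>\<^bsub>cx_mod X n\<^esub> x"]) auto
  next
    fix y assume "y \<in> cx_diff X n ` carrier (cx_mod X n)"
    then obtain x where x: "x \<in> carrier (cx_mod X n)" "y = cx_diff X n x" by auto
    then show "y \<in> (\<lambda>x. \<ominus>\<^bsub>cx_mod X (n + 1)\<^esub> cx_diff X n x) ` carrier (cx_mod X n)"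
      using mod_hom_a_inv[OF M M d x(1)] mod_homD(1)[OF d x(1)]
      by (intro image_eqI[of _ _ "\<ominus>\<^bsub>cx_mod X n\<^esub> x"]) auto
  qed
  then show ?thesis unfolding coboundaries_def shift_cpx_sel e .
qed

lemma shift_cocycles:
  assumes X: "is_cpx R X" shows "carrier (cocycles (shift_cpx X) n) = carrier (cocycles X (n + 1))"
proof -
  have e: "n + 1 + 1 = n + 2" by simp
  interpret M: Module.module R "cx_mod X (n + 2)" by (rule is_cpxD(1)[OF X])
  show ?thesis
    unfolding cocycles_sel shift_cpx_sel e
    using a_inv_eq_zero_iff[OF M.abelian_group_axioms mod_homD(1)[OF is_cpxD(2)[OF X, of "n + 1", unfolded e]]]
    by blast
qed

lemma locally_exact_cocycles:
  "locally_exact R p X n \<longleftrightarrow>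
     (\<forall>x\<in>carrier (cocycles X n). \<exists>s\<in>carrier R - p. s \<odot>\<^bsub>cx_mod X n\<^esub> x \<in> coboundaries X n)"
  by (auto simp: locally_exact_def)

lemma shift_locally_acyclic:
  assumes X: "is_cpx R X" shows "locally_acyclic R p (shift_cpx X) \<longleftrightarrow> locally_acyclic R p X"
proof -
  have "locally_exact R p (shift_cpx X) n \<longleftrightarrow> locally_exact R p X (n + 1)" for n
    unfolding locally_exact_cocycles shift_cocycles[OF X] shift_coboundaries[OF X] shift_cpx_sel ..
  then have "locally_acyclic R p (shift_cpx X) \<longleftrightarrow> (\<forall>n. locally_exact R p X (n + 1))"
    by (simp add: locally_acyclic_def)
  also have "\<dots> \<longleftrightarrow> locally_acyclic R p X"
    unfolding locally_acyclic_def by (metis diff_add_cancel)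
  finally show ?thesis .
qed

lemma shift_Dminus_ob:
  assumes X: "X \<in> Dminus_ob R" shows "shift_cpx X \<in> Dminus_ob R"
proof -
  note X' = Dminus_obD(1)[OF X]
  obtain N where N: "\<And>n. n > N \<Longrightarrow> carrier (cohomology X n) = {\<zero>\<^bsub>cohomology X n\<^esub>}"
    using X unfolding Dminus_ob_def by blast
  have "carrier (cohomology (shift_cpx X) n) = {\<zero>\<^bsub>cohomology (shift_cpx X) n\<^esub>}" if "n > N" for n
    using N[of "n + 1"] that
    unfolding cohomology_trivial_iff[OF X'] cohomology_trivial_iff[OF shift_is_cpx[OF X']]
      shift_cocycles[OF X'] shift_coboundaries[OF X'] by simp
  then show ?thesis
    using shift_is_cpx[OF X'] Dminus_obD(2)[OF X] by (auto simp: Dminus_ob_def shift_cpx_sel)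
qed

lemma mapping_cone_sel:
  "cx_mod (mapping_cone X Y f) n = prod_module (cx_mod X (n + 1)) (cx_mod Y n)"
  "cx_diff (mapping_cone X Y f) n (x, y) = (\<ominus>\<^bsub>cx_mod X (n + 2)\<^esub> cx_diff X (n + 1) x,
       f (n + 1) x \<oplus>\<^bsub>cx_mod Y (n + 1)\<^esub> cx_diff Y n y)"
  by (simp_all add: mapping_cone_def)

lemma prod_module_sel [simp]:
  "carrier (prod_module M N) = carrier M \<times> carrier N"
  "\<zero>\<^bsub>prod_module M N\<^esub> = (\<zero>\<^bsub>M\<^esub>, \<zero>\<^bsub>N\<^esub>)"
  "a \<odot>\<^bsub>prod_module M N\<^esub> (x, y) = (a \<odot>\<^bsub>M\<^esub> x, a \<odot>\<^bsub>N\<^esub> y)"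
  by (simp_all add: prod_module_def)

lemma mapping_cone_diff_closed:
  assumes A: "is_cpx R A" and B: "is_cpx R B" and u: "chain_map R A B u"
    and z: "z \<in> carrier (cx_mod (mapping_cone A B u) n)"
  shows "cx_diff (mapping_cone A B u) n z \<in> carrier (cx_mod (mapping_cone A B u) (n + 1))"
proof -
  have e: "n + 1 + 1 = n + 2" by simp
  obtain x y where xy: "z = (x, y)" "x \<in> carrier (cx_mod A (n + 1))" "y \<in> carrier (cx_mod B n)"
    using z by (auto simp: mapping_cone_sel)
  interpret A2: Module.module R "cx_mod A (n + 2)" by (rule is_cpxD(1)[OF A])
  interpret B1: Module.module R "cx_mod B (n + 1)" by (rule is_cpxD(1)[OF B])
  show ?thesis
    unfolding xy(1) mapping_cone_sel e
    using mod_homD(1)[OF is_cpxD(2)[OF A, of "n + 1", unfolded e] xy(2)] mod_homD(1)[OF is_cpxD(2)[OF B] xy(3)]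
      mod_homD(1)[OF chain_mapD(1)[OF u] xy(2)] by simp
qed

text \<open>The long exact sequence made explicit. For a cocycle (x, y) of the cone, some
  \<open>s\<close> gives s x = d x'. Then s y + u x' is a cocycle of \<open>B\<close>, some
  \<open>t\<close> makes it d y', and the multiple of (x, y) by t s is the differential of (- t x',
  y').\<close>

lemma mapping_cone_locally_acyclic:
  assumes p: "primeideal p R" and A: "is_cpx R A" and B: "is_cpx R B" and u: "chain_map R A B u"
    and LA: "locally_acyclic R p A" and LB: "locally_acyclic R p B"
  shows "locally_acyclic R p (mapping_cone A B u)"
  unfolding locally_acyclic_def locally_exact_def
proof (intro allI ballI impI)
  let ?C = "mapping_cone A B u"
  fix n z assume z: "z \<in> carrier (cx_mod ?C n)" "cx_diff ?C n z = \<zero>\<^bsub>cx_mod ?C (n + 1)\<^esub>"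
  have e: "n + 1 + 1 = n + 2" "n + 1 - 1 = n" "n - 1 + 1 = n" "n - 1 + 2 = n + 1" by auto
  obtain x y where xy: "z = (x, y)" "x \<in> carrier (cx_mod A (n + 1))" "y \<in> carrier (cx_mod B n)"
    using z by (auto simp: mapping_cone_sel)
  interpret A0: Module.module R "cx_mod A n" by (rule is_cpxD(1)[OF A])
  interpret A1: Module.module R "cx_mod A (n + 1)" by (rule is_cpxD(1)[OF A])
  interpret A2: Module.module R "cx_mod A (n + 2)" by (rule is_cpxD(1)[OF A])
  interpret B0: Module.module R "cx_mod B n" by (rule is_cpxD(1)[OF B])
  interpret B1: Module.module R "cx_mod B (n + 1)" by (rule is_cpxD(1)[OF B])
  note dA = is_cpxD(2)[OF A, of n] and dB = is_cpxD(2)[OF B, of n]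
  note u0 = chain_mapD(1)[OF u, of n] and u1 = chain_mapD(1)[OF u, of "n + 1"]
  have dx: "cx_diff A (n + 1) x = \<zero>\<^bsub>cx_mod A (n + 1 + 1)\<^esub>"
    using z(2) a_inv_eq_zero_iff[OF A2.abelian_group_axioms mod_homD(1)[OF is_cpxD(2)[OF A, of "n + 1", unfolded e] xy(2)]]
    unfolding xy(1) mapping_cone_sel prod_module_sel e by simp
  have dy: "u (n + 1) x \<oplus>\<^bsub>cx_mod B (n + 1)\<^esub> cx_diff B n y = \<zero>\<^bsub>cx_mod B (n + 1)\<^esub>"
    using z(2) unfolding xy(1) mapping_cone_sel prod_module_sel e by simp
  have "locally_exact R p A (n + 1)" using LA by (simp add: locally_acyclic_def)
  then obtain s where s: "s \<in> carrier R - p" "s \<odot>\<^bsub>cx_mod A (n + 1)\<^esub> x \<in> coboundaries A (n + 1)"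
    using xy(2) dx by (rule locally_exactE)
  then obtain x' where x': "x' \<in> carrier (cx_mod A n)" "s \<odot>\<^bsub>cx_mod A (n + 1)\<^esub> x = cx_diff A n x'"
    unfolding coboundaries_def e by auto
  have sR: "s \<in> carrier R" using s(1) by simp
  have ux': "u n x' \<in> carrier (cx_mod B n)" by (rule mod_homD(1)[OF u0 x'(1)])
  have dyc: "cx_diff B n y \<in> carrier (cx_mod B (n + 1))" by (rule mod_homD(1)[OF dB xy(3)])
  have ux: "u (n + 1) x \<in> carrier (cx_mod B (n + 1))" by (rule mod_homD(1)[OF u1 xy(2)])
  let ?w = "s \<odot>\<^bsub>cx_mod B n\<^esub> y \<oplus>\<^bsub>cx_mod B n\<^esub> u n x'"
  have w: "?w \<in> carrier (cx_mod B n)" using sR xy(3) ux' by simp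
  have "cx_diff B n ?w = s \<odot>\<^bsub>cx_mod B (n + 1)\<^esub> cx_diff B n y \<oplus>\<^bsub>cx_mod B (n + 1)\<^esub> cx_diff B n (u n x')"
    using mod_homD(2)[OF dB] mod_homD(3)[OF dB] sR xy(3) ux' by simp
  also have "cx_diff B n (u n x') = s \<odot>\<^bsub>cx_mod B (n + 1)\<^esub> u (n + 1) x"
    using chain_mapD(2)[OF u x'(1)] x'(2) mod_homD(3)[OF u1 sR xy(2)] by simp
  also have "s \<odot>\<^bsub>cx_mod B (n + 1)\<^esub> cx_diff B n y \<oplus>\<^bsub>cx_mod B (n + 1)\<^esub> s \<odot>\<^bsub>cx_mod B (n + 1)\<^esub> u (n + 1) x =
      s \<odot>\<^bsub>cx_mod B (n + 1)\<^esub> (u (n + 1) x \<oplus>\<^bsub>cx_mod B (n + 1)\<^esub> cx_diff B n y)"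
    using B1.smult_r_distr[OF sR ux dyc] B1.M.a_comm sR ux dyc by simp
  also have "\<dots> = \<zero>\<^bsub>cx_mod B (n + 1)\<^esub>" unfolding dy using sR by simp
  finally have dw: "cx_diff B n ?w = \<zero>\<^bsub>cx_mod B (n + 1)\<^esub>" .
  have "locally_exact R p B n" using LB by (simp add: locally_acyclic_def)
  then obtain t where t: "t \<in> carrier R - p" "t \<odot>\<^bsub>cx_mod B n\<^esub> ?w \<in> coboundaries B n"
    using w dw by (rule locally_exactE)
  then obtain y' where y': "y' \<in> carrier (cx_mod B (n - 1))" "t \<odot>\<^bsub>cx_mod B n\<^esub> ?w = cx_diff B (n - 1) y'"
    unfolding coboundaries_def by auto
  have tR: "t \<in> carrier R" using t(1) by simp
  \<comment> \<open>The minus sign offsets the sign of the differential of \<open>A\<close> in the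
    cone, and it makes the term with \<open>u n x'\<close> cancel in the second coordinate.\<close>
  let ?x = "\<ominus>\<^bsub>cx_mod A n\<^esub> (t \<odot>\<^bsub>cx_mod A n\<^esub> x')"
  have tx: "t \<odot>\<^bsub>cx_mod A n\<^esub> x' \<in> carrier (cx_mod A n)" using tR x'(1) by simp
  have 1: "\<ominus>\<^bsub>cx_mod A (n + 1)\<^esub> cx_diff A n ?x = (t \<otimes>\<^bsub>R\<^esub> s) \<odot>\<^bsub>cx_mod A (n + 1)\<^esub> x"
    using mod_hom_a_inv[OF A0.module_axioms A1.module_axioms dA tx] mod_homD(3)[OF dA tR x'(1)]
      x'(2)[symmetric] tR sR xy(2) by (simp add: A1.smult_assoc1)
  have "u n ?x = \<ominus>\<^bsub>cx_mod B n\<^esub> (t \<odot>\<^bsub>cx_mod B n\<^esub> u n x')"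
    using mod_hom_a_inv[OF A0.module_axioms B0.module_axioms u0 tx] mod_homD(3)[OF u0 tR x'(1)] by simp
  moreover have "cx_diff B (n - 1) y' = t \<odot>\<^bsub>cx_mod B n\<^esub> (s \<odot>\<^bsub>cx_mod B n\<^esub> y) \<oplus>\<^bsub>cx_mod B n\<^esub> t \<odot>\<^bsub>cx_mod B n\<^esub> u n x'"
    using y'(2)[symmetric] B0.smult_r_distr[OF tR _ ux'] sR xy(3) by simp
  ultimately have 2: "u n ?x \<oplus>\<^bsub>cx_mod B n\<^esub> cx_diff B (n - 1) y' = (t \<otimes>\<^bsub>R\<^esub> s) \<odot>\<^bsub>cx_mod B n\<^esub> y"
    using tR sR xy(3) ux' abelian_group_cancel[OF B0.abelian_group_axioms]
    by (simp add: B0.smult_assoc1)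
  have "(t \<otimes>\<^bsub>R\<^esub> s) \<odot>\<^bsub>cx_mod ?C n\<^esub> z = cx_diff ?C (n - 1) (?x, y')"
    unfolding xy(1) mapping_cone_sel prod_module_sel e 1 2 ..
  moreover have "(?x, y') \<in> carrier (cx_mod ?C (n - 1))"
    unfolding mapping_cone_sel prod_module_sel e using tx y'(1) by simp
  ultimately have "(t \<otimes>\<^bsub>R\<^esub> s) \<odot>\<^bsub>cx_mod ?C n\<^esub> z \<in> coboundaries ?C n"
    unfolding coboundaries_def by (rule image_eqI)
  then show "\<exists>s\<in>carrier R - p. s \<odot>\<^bsub>cx_mod ?C n\<^esub> z \<in> coboundaries ?C n"
    using primeidealE(6)[OF p t(1) s(1)] by blast
qed

section \<open>The kernel of localisation at a prime is thick\<close>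

definition local_kernel :: "('a, 'r) ring_scheme \<Rightarrow> 'a set \<Rightarrow> 'a dcpx set" where
  "local_kernel R p = {X\<in>Dminus_ob R. locally_acyclic R p X}"

lemma Dminus_sel [simp]:
  "Ob (Dminus R) = Dminus_ob R" "Mor (Dminus R) = Dminus_mor R" "Idt (Dminus R) = (\<lambda>X. loc R X X (\<lambda>n x. x))"
  "Cmp (Dminus R) = Dminus_comp R" "Shf (Dminus R) = shift_cpx" "Tri (Dminus R) = Dminus_tri R"
  "Tns (Dminus R) = derived_tensor R"
  by (simp_all add: Dminus_def Dminus_cat_def)

lemma Dminus_cat_sel [simp]:
  "Ob (Dminus_cat R) = Dminus_ob R" "Mor (Dminus_cat R) = Dminus_mor R"
  "Idt (Dminus_cat R) = (\<lambda>X. loc R X X (\<lambda>n x. x))" "Cmp (Dminus_cat R) = Dminus_comp R"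
  by (simp_all add: Dminus_cat_def)

text \<open>Each of two isomorphic objects is a retract of the other. The category \<open>T\<close>
  is left open because isomorphisms occur both in \<open>Dminus_cat\<close>, inside the definition
  of exact triangles, and in \<open>Dminus\<close>.\<close>

lemma iso_mor_locally_acyclic:
  assumes T: "Mor T = Dminus_mor R" "Idt T = (\<lambda>X. loc R X X (\<lambda>n x. x))" "Cmp T = Dminus_comp R"
    and X: "X \<in> Dminus_ob R" and Y: "Y \<in> Dminus_ob R" and f: "iso_mor T X Y f"
  shows "locally_acyclic R p X \<longleftrightarrow> locally_acyclic R p Y"
proof -
  obtain g where g: "g \<in> Dminus_mor R Y X" "Dminus_comp R X Y X g f = loc R X X (\<lambda>n x. x)"
      "Dminus_comp R Y X Y f g = loc R Y Y (\<lambda>n x. x)" and f': "f \<in> Dminus_mor R X Y"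
    using f unfolding iso_mor_def T by auto
  show ?thesis
    using locally_acyclic_retract[OF X Y g(1,2) f'] locally_acyclic_retract[OF Y X f' g(3,1)] by blast
qed

lemma zero_chain_map:
  assumes X: "is_cpx R X" and Y: "is_cpx R Y"
  shows "chain_map R Y X (\<lambda>n y. \<zero>\<^bsub>cx_mod X n\<^esub>)"
proof -
  have "(\<lambda>y. \<zero>\<^bsub>cx_mod X n\<^esub>) \<in> mod_hom R (cx_mod Y n) (cx_mod X n)" for n
  proof -
    interpret M: Module.module R "cx_mod X n" by (rule is_cpxD(1)[OF X])
    show ?thesis by (rule mod_homI) auto
  qed
  then show ?thesis
    using mod_hom_zero[OF is_cpxD(1)[OF X] is_cpxD(1)[OF X] is_cpxD(2)[OF X]] by (auto simp: chain_map_def)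
qed

text \<open>Only the vertices of a triangle matter: an exact triangle is vertexwise isomorphic to a
  standard one, whose third vertex is a model of the mapping cone.\<close>

lemma triangle_locally_acyclic:
  assumes p: "primeideal p R" and t: "(X, Y, Z, f, g, h) \<in> Dminus_tri R"
    and L: "locally_acyclic R p X" "locally_acyclic R p Y"
  shows "Z \<in> Dminus_ob R" "locally_acyclic R p Z"
proof -
  obtain A B C f' g' h' a b c where XYZ: "X \<in> Dminus_ob R" "Y \<in> Dminus_ob R" "Z \<in> Dminus_ob R"
    and std: "std_triangle R A B C f' g' h'"
    and iso: "iso_mor (Dminus_cat R) X A a" "iso_mor (Dminus_cat R) Y B b" "iso_mor (Dminus_cat R) Z C c"
    using t unfolding Dminus_tri_def by blast
  show "Z \<in> Dminus_ob R" by (rule XYZ(3))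
  obtain u \<phi> where ABC: "A \<in> Dminus_ob R" "B \<in> Dminus_ob R" "C \<in> Dminus_ob R"
    and u: "chain_map R A B u" and \<phi>: "cpx_iso R (mapping_cone A B u) C \<phi>"
    using std unfolding std_triangle_def by blast
  note A = Dminus_obD(1)[OF ABC(1)] and B = Dminus_obD(1)[OF ABC(2)]
  note iso' = iso_mor_locally_acyclic[OF Dminus_cat_sel(2-4)]
  have "locally_acyclic R p A" using iso'[OF XYZ(1) ABC(1) iso(1)] L(1) by blast
  moreover have "locally_acyclic R p B" using iso'[OF XYZ(2) ABC(2) iso(2)] L(2) by blast
  ultimately have "locally_acyclic R p (mapping_cone A B u)"
    by (rule mapping_cone_locally_acyclic[OF p A B u])
  moreover have "Module.module R (cx_mod (mapping_cone A B u) n)" for n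
    unfolding mapping_cone_sel by (intro prod_module_is_module is_cpxD(1)[OF A] is_cpxD(1)[OF B])
  ultimately have "locally_acyclic R p C"
    using cpx_iso_locally_acyclic[OF _ mapping_cone_diff_closed[OF A B u] Dminus_obD(1)[OF ABC(3)] \<phi>] by blast
  then show "locally_acyclic R p Z" using iso'[OF XYZ(3) ABC(3) iso(3)] by blast
qed

lemma local_kernel_thick:
  assumes p: "primeideal p R" and ne: "local_kernel R p \<noteq> {}"
  shows "thick_subcat (Dminus R) (local_kernel R p)"
  unfolding thick_subcat_def
proof
  note iso' = iso_mor_locally_acyclic[OF Dminus_sel(2-4)]
  show "triangulated_subcat (Dminus R) (local_kernel R p)"
    unfolding triangulated_subcat_def
  proof (intro conjI)
    show "local_kernel R p \<subseteq> Ob (Dminus R)" by (auto simp: local_kernel_def)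
    show "local_kernel R p \<noteq> {}" by (rule ne)
    show "\<forall>X\<in>local_kernel R p. \<forall>Y\<in>Ob (Dminus R). isomorphic_obj (Dminus R) X Y \<longrightarrow> Y \<in> local_kernel R p"
    proof (intro ballI impI)
      fix X Y assume XY: "X \<in> local_kernel R p" "Y \<in> Ob (Dminus R)" "isomorphic_obj (Dminus R) X Y"
      then obtain f where "iso_mor (Dminus R) X Y f" unfolding isomorphic_obj_def by blast
      then have "locally_acyclic R p X \<longleftrightarrow> locally_acyclic R p Y"
        by (rule iso'[rotated 2]) (use XY in \<open>auto simp: local_kernel_def\<close>)
      then show "Y \<in> local_kernel R p" using XY by (auto simp: local_kernel_def)
    qed
    show "\<forall>X\<in>Ob (Dminus R). (X \<in> local_kernel R p) = (Shf (Dminus R) X \<in> local_kernel R p)"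
      using shift_locally_acyclic[OF Dminus_obD(1)] shift_Dminus_ob by (auto simp: local_kernel_def)
    show "\<forall>X Y Z f g h. (X, Y, Z, f, g, h) \<in> Tri (Dminus R) \<longrightarrow> X \<in> local_kernel R p \<longrightarrow>
        Y \<in> local_kernel R p \<longrightarrow> Z \<in> local_kernel R p"
      using triangle_locally_acyclic[OF p] by (auto simp: local_kernel_def)
  qed
  show "\<forall>X Y S. coproduct (Dminus R) X Y S \<longrightarrow> S \<in> local_kernel R p \<longrightarrow> X \<in> local_kernel R p \<and> Y \<in> local_kernel R p"
  proof (intro allI impI)
    fix X Y S assume cp: "coproduct (Dminus R) X Y S" and S: "S \<in> local_kernel R p"
    obtain i j where ob: "X \<in> Dminus_ob R" "Y \<in> Dminus_ob R" "S \<in> Dminus_ob R"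
      and i: "i \<in> Dminus_mor R X S" and j: "j \<in> Dminus_mor R Y S"
      and univ: "\<And>W f g. \<lbrakk>W \<in> Dminus_ob R; f \<in> Dminus_mor R X W; g \<in> Dminus_mor R Y W\<rbrakk> \<Longrightarrow>
        \<exists>h\<in>Dminus_mor R S W. Dminus_comp R X S W h i = f \<and> Dminus_comp R Y S W h j = g"
      using cp unfolding coproduct_def Dminus_sel by (metis (no_types, lifting))
    have LS: "locally_acyclic R p S" using S by (simp add: local_kernel_def)
    note X = Dminus_obD(1)[OF ob(1)] and Y = Dminus_obD(1)[OF ob(2)]
    have id: "loc R Z Z (\<lambda>n x. x) \<in> Dminus_mor R Z Z" if "Z \<in> Dminus_ob R" for Z
      by (rule loc_in_mor[OF that]) (auto simp: chain_map_def mod_hom_id)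
    \<comment> \<open>The universal property for the identity of \<open>X\<close> and the zero map
      from \<open>Y\<close> yields a retraction of the inclusion of \<open>X\<close> into the
      coproduct.\<close>
    obtain h where "h \<in> Dminus_mor R S X" "Dminus_comp R X S X h i = loc R X X (\<lambda>n x. x)"
      using univ[OF ob(1) id[OF ob(1)] loc_in_mor[OF ob(2) zero_chain_map[OF X Y]]] by blast
    then have "locally_acyclic R p X" using locally_acyclic_retract[OF ob(1,3) _ _ i LS] by blast
    moreover obtain h' where "h' \<in> Dminus_mor R S Y" "Dminus_comp R Y S Y h' j = loc R Y Y (\<lambda>n x. x)"
      using univ[OF ob(2) loc_in_mor[OF ob(1) zero_chain_map[OF Y X]] id[OF ob(2)]] by blast
    then have "locally_acyclic R p Y" using locally_acyclic_retract[OF ob(2,3) _ _ j LS] by blast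
    ultimately show "X \<in> local_kernel R p \<and> Y \<in> local_kernel R p"
      using ob by (auto simp: local_kernel_def)
  qed
qed

section \<open>Tensor products\<close>

lemma mod_hom_preimage_submodule:
  assumes M: "Module.module R M" and N: "Module.module R N" and f: "f \<in> mod_hom R M N" and S: "submodule S R N"
  shows "submodule {x\<in>carrier M. f x \<in> S} R M"
proof -
  interpret M: Module.module R M by fact
  interpret N: Module.module R N by fact
  show ?thesis
    by (rule M.submoduleI)
      (auto simp: mod_homD[OF f] mod_hom_zero[OF M N f] mod_hom_a_inv[OF M N f]
        intro: submodule_zero[OF N S] N.submoduleE(3,4,5)[OF S])
qed

lemma mod_hom_sum:
  assumes M: "Module.module R M" and L: "Module.module R L" and A: "finite A"
    and f: "\<And>j. j \<in> A \<Longrightarrow> f j \<in> mod_hom R M L"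
  shows "(\<lambda>x. finsum L (\<lambda>j. f j x) A) \<in> mod_hom R M L"
proof (rule mod_homI)
  interpret M: Module.module R M by fact
  interpret L: Module.module R L by fact
  note f' = mod_homD[OF f]
  show "finsum L (\<lambda>j. f j x) A \<in> carrier L" if "x \<in> carrier M" for x
    using f'(1) that by (intro L.M.finsum_closed) auto
  show "finsum L (\<lambda>j. f j (x \<oplus>\<^bsub>M\<^esub> y)) A = finsum L (\<lambda>j. f j x) A \<oplus>\<^bsub>L\<^esub> finsum L (\<lambda>j. f j y) A"
    if x: "x \<in> carrier M" and y: "y \<in> carrier M" for x y
  proof -
    have "finsum L (\<lambda>j. f j (x \<oplus>\<^bsub>M\<^esub> y)) A = finsum L (\<lambda>j. f j x \<oplus>\<^bsub>L\<^esub> f j y) A"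
      by (rule L.M.finsum_cong') (use f' x y in auto)
    also have "\<dots> = finsum L (\<lambda>j. f j x) A \<oplus>\<^bsub>L\<^esub> finsum L (\<lambda>j. f j y) A"
      by (rule L.M.finsum_addf) (use f'(1) x y in auto)
    finally show ?thesis .
  qed
  show "finsum L (\<lambda>j. f j (a \<odot>\<^bsub>M\<^esub> x)) A = a \<odot>\<^bsub>L\<^esub> finsum L (\<lambda>j. f j x) A"
    if a: "a \<in> carrier R" and x: "x \<in> carrier M" for a x
  proof -
    have "finsum L (\<lambda>j. f j (a \<odot>\<^bsub>M\<^esub> x)) A = finsum L (\<lambda>j. a \<odot>\<^bsub>L\<^esub> f j x) A"
      by (rule L.M.finsum_cong') (use f' a x in auto)
    also have "\<dots> = a \<odot>\<^bsub>L\<^esub> finsum L (\<lambda>j. f j x) A"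
      by (rule L.finsum_smult_ldistr[symmetric]) (use A f'(1) a x in auto)
    finally show ?thesis .
  qed
qed

text \<open>The product of the individual scalars works: it stays outside the prime, and the
  submodule absorbs the additional factors.\<close>

lemma common_denominator:
  assumes p: "primeideal p R" and M: "Module.module R M" and B: "submodule B R M"
    and A: "finite A" and x: "\<And>j. j \<in> A \<Longrightarrow> x j \<in> carrier M"
    and s: "\<And>j. j \<in> A \<Longrightarrow> \<exists>s\<in>carrier R - p. s \<odot>\<^bsub>M\<^esub> x j \<in> B"
  shows "\<exists>s\<in>carrier R - p. \<forall>j\<in>A. s \<odot>\<^bsub>M\<^esub> x j \<in> B"
  using A x s
proof (induction A rule: finite_induct)
  case empty
  interpret M: Module.module R M by fact
  show ?case using primeidealE(3)[OF p] by auto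
next
  case (insert i A)
  interpret M: Module.module R M by fact
  have "\<exists>s\<in>carrier R - p. \<forall>j\<in>A. s \<odot>\<^bsub>M\<^esub> x j \<in> B"
    by (rule insert.IH) (auto intro: insert.prems)
  then obtain s where s: "s \<in> carrier R - p" "\<And>j. j \<in> A \<Longrightarrow> s \<odot>\<^bsub>M\<^esub> x j \<in> B" by auto
  from insert.prems(2)[OF insertI1] obtain t where t: "t \<in> carrier R - p" "t \<odot>\<^bsub>M\<^esub> x i \<in> B" by auto
  have xi: "x i \<in> carrier M" using insert.prems(1) by simp
  have "(t \<otimes>\<^bsub>R\<^esub> s) \<odot>\<^bsub>M\<^esub> x j \<in> B" if "j \<in> insert i A" for j
  proof (cases "j = i")
    case True
    have "(t \<otimes>\<^bsub>R\<^esub> s) \<odot>\<^bsub>M\<^esub> x i = s \<odot>\<^bsub>M\<^esub> (t \<odot>\<^bsub>M\<^esub> x i)"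
      using s(1) t(1) xi M.smult_assoc1[of s t "x i"] M.R.m_comm[of s t] by simp
    then show ?thesis using M.submoduleE(4)[OF B _ t(2)] s(1) True by simp
  next
    case False
    then have "s \<odot>\<^bsub>M\<^esub> x j \<in> B" "x j \<in> carrier M" using that s(2) insert.prems(1) by auto
    then show ?thesis using M.submoduleE(4)[OF B, of t] s(1) t(1) by (simp add: M.smult_assoc1)
  qed
  then show ?case using primeidealE(6)[OF p t(1) s(1)] by blast
qed

text \<open>R in the module record, so that linear functionals are elements of
  \<open>mod_hom\<close> and ideals are submodules.\<close>

definition ring_mod :: "('a, 'r) ring_scheme \<Rightarrow> ('a, 'a) module" where
  "ring_mod R = mk_module (carrier R) \<zero>\<^bsub>R\<^esub> (\<lambda>x y. x \<oplus>\<^bsub>R\<^esub> y) (\<lambda>x y. x \<otimes>\<^bsub>R\<^esub> y)"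

lemma ring_mod_sel [simp]:
  "carrier (ring_mod R) = carrier R" "zero (ring_mod R) = zero R"
  "add (ring_mod R) x y = x \<oplus>\<^bsub>R\<^esub> y" "smult (ring_mod R) x y = x \<otimes>\<^bsub>R\<^esub> y"
  by (simp_all add: ring_mod_def)

lemma ring_mod_is_module:
  assumes "cring R" shows "Module.module R (ring_mod R)"
proof -
  interpret cring R by fact
  have "abelian_group (ring_mod R)"
  proof (rule abelian_groupI)
    show "\<exists>y\<in>carrier (ring_mod R). y \<oplus>\<^bsub>ring_mod R\<^esub> x = \<zero>\<^bsub>ring_mod R\<^esub>" if "x \<in> carrier (ring_mod R)" for x
      by (rule bexI[of _ "\<ominus>\<^bsub>R\<^esub> x"]) (use that in \<open>auto simp: l_neg\<close>)
  qed (auto simp: a_ac)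
  then show ?thesis by (intro Module.moduleI is_cring) (auto simp: l_distr r_distr m_assoc)
qed

lemma ideal_submodule:
  assumes "cring R" "ideal I R" shows "submodule I R (ring_mod R)"
proof -
  interpret R: cring R by fact
  interpret rm: Module.module R "ring_mod R" by (rule ring_mod_is_module[OF assms(1)])
  note IE = R.idealE[OF assms(2)]
  show ?thesis
  proof (rule rm.submoduleI)
    show "\<ominus>\<^bsub>ring_mod R\<^esub> u \<in> I" if "u \<in> I" for u
    proof -
      have uR: "u \<in> carrier (ring_mod R)" using IE(1) that by auto
      have "\<ominus>\<^bsub>ring_mod R\<^esub> u = (\<ominus>\<^bsub>R\<^esub> \<one>\<^bsub>R\<^esub>) \<odot>\<^bsub>ring_mod R\<^esub> u" using uR rm.smult_l_minus[of "\<one>\<^bsub>R\<^esub>" u] by simp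
      then show ?thesis using IE(5)[OF that, of "\<ominus>\<^bsub>R\<^esub> \<one>\<^bsub>R\<^esub>"] by simp
    qed
  qed (use IE(1-3,5) in auto)
qed

section \<open>Universal property and functoriality of the tensor product\<close>

definition bilinear_map ::
  "('a, 'r) ring_scheme \<Rightarrow> ('a, 'b) module \<Rightarrow> ('a, 'c) module \<Rightarrow> ('a, 'd) module \<Rightarrow> ('b \<Rightarrow> 'c \<Rightarrow> 'd) \<Rightarrow> bool" where
  "bilinear_map R M N L b \<longleftrightarrow> (\<forall>x\<in>carrier M. b x \<in> mod_hom R N L) \<and>
     (\<forall>y\<in>carrier N. (\<lambda>x. b x y) \<in> mod_hom R M L)"

definition tens ::
  "('a, 'r) ring_scheme \<Rightarrow> ('a, 'b) module \<Rightarrow> ('a, 'c) module \<Rightarrow> 'b \<Rightarrow> 'c \<Rightarrow> ('b \<times> 'c \<Rightarrow> 'a) set" where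
  "tens R M N x y = tensor_ker R M N +>\<^bsub>tensor_free R M N\<^esub> free_gen R (x, y)"

context
  fixes R :: "('a, 'r) ring_scheme" and M :: "('a, 'b) module" and N :: "('a, 'c) module"
  assumes M: "Module.module R M" and N: "Module.module R N"
begin

interpretation M: Module.module R M by (rule M)
interpretation N: Module.module R N by (rule N)

abbreviation (input) "\<F> \<equiv> tensor_free R M N"
abbreviation (input) "\<K> \<equiv> tensor_ker R M N"

lemma tensor_free_is_module: "Module.module R (tensor_free R M N)"
  by (rule M.R.free_module_is_module)

interpretation F: Module.module R "tensor_free R M N" by (rule tensor_free_is_module)

lemma tensor_gen_closed:
  "\<lbrakk>x \<in> carrier M; y \<in> carrier N\<rbrakk> \<Longrightarrow> free_gen R (x, y) \<in> carrier (tensor_free R M N)"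
  by (rule M.R.free_gen_closed) simp

lemma tensor_rels_closed: "tensor_rels R M N \<subseteq> carrier (tensor_free R M N)"
  unfolding tensor_rels_def Let_def
  by (auto intro!: F.M.minus_closed F.M.a_closed F.smult_closed tensor_gen_closed)

lemma tensor_ker_submodule: "submodule \<K> R \<F>" "tensor_rels R M N \<subseteq> \<K>"
  unfolding tensor_ker_def using submod_gen_submodule[OF tensor_free_is_module tensor_rels_closed] by auto

lemma tensor_module_is_module: "Module.module R (tensor_module R M N)"
  unfolding tensor_module_def by (rule quot_is_module[OF tensor_free_is_module tensor_ker_submodule(1)])

lemma tensor_proj_hom: "(\<lambda>c. \<K> +>\<^bsub>\<F>\<^esub> c) \<in> mod_hom R \<F> (tensor_module R M N)"
  unfolding tensor_module_def by (rule quot_proj_hom[OF tensor_free_is_module tensor_ker_submodule(1)])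

lemma tensor_carrier: "carrier (tensor_module R M N) = (\<lambda>c. \<K> +>\<^bsub>\<F>\<^esub> c) ` carrier \<F>"
  unfolding tensor_module_def by (rule quot_carrier[OF tensor_free_is_module tensor_ker_submodule(1)])

lemma tens_closed [intro]:
  "\<lbrakk>x \<in> carrier M; y \<in> carrier N\<rbrakk> \<Longrightarrow> tens R M N x y \<in> carrier (tensor_module R M N)"
  unfolding tens_def tensor_carrier by (intro imageI tensor_gen_closed)

lemma tens_bilinear: "bilinear_map R M N (tensor_module R M N) (tens R M N)"
proof -
  note proj = mod_homD[OF tensor_proj_hom]
  have eq: "\<K> +>\<^bsub>\<F>\<^esub> c = \<K> +>\<^bsub>\<F>\<^esub> d" if "c \<ominus>\<^bsub>\<F>\<^esub> d \<in> tensor_rels R M N" "c \<in> carrier \<F>" "d \<in> carrier \<F>" for c d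
    using quot_eq_iff[OF tensor_free_is_module tensor_ker_submodule(1) that(2,3)] that(1) tensor_ker_submodule(2)
    by blast
  have 1: "tens R M N (x \<oplus>\<^bsub>M\<^esub> x') y = tens R M N x y \<oplus>\<^bsub>tensor_module R M N\<^esub> tens R M N x' y"
    if "x \<in> carrier M" "x' \<in> carrier M" "y \<in> carrier N" for x x' y
  proof -
    have "free_gen R (x \<oplus>\<^bsub>M\<^esub> x', y) \<ominus>\<^bsub>\<F>\<^esub> (free_gen R (x, y) \<oplus>\<^bsub>\<F>\<^esub> free_gen R (x', y)) \<in> tensor_rels R M N"
      unfolding tensor_rels_def Let_def using that by blast
    then show ?thesis
      unfolding tens_def using that tensor_gen_closed
      by (subst eq) (auto intro!: proj(2))
  qed
  have 2: "tens R M N x (y \<oplus>\<^bsub>N\<^esub> y') = tens R M N x y \<oplus>\<^bsub>tensor_module R M N\<^esub> tens R M N x y'"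
    if "x \<in> carrier M" "y \<in> carrier N" "y' \<in> carrier N" for x y y'
  proof -
    have "free_gen R (x, y \<oplus>\<^bsub>N\<^esub> y') \<ominus>\<^bsub>\<F>\<^esub> (free_gen R (x, y) \<oplus>\<^bsub>\<F>\<^esub> free_gen R (x, y')) \<in> tensor_rels R M N"
      unfolding tensor_rels_def Let_def using that by blast
    then show ?thesis
      unfolding tens_def using that tensor_gen_closed
      by (subst eq) (auto intro!: proj(2))
  qed
  have 3: "tens R M N (a \<odot>\<^bsub>M\<^esub> x) y = a \<odot>\<^bsub>tensor_module R M N\<^esub> tens R M N x y"
    if "a \<in> carrier R" "x \<in> carrier M" "y \<in> carrier N" for a x y
  proof -
    have "free_gen R (a \<odot>\<^bsub>M\<^esub> x, y) \<ominus>\<^bsub>\<F>\<^esub> a \<odot>\<^bsub>\<F>\<^esub> free_gen R (x, y) \<in> tensor_rels R M N"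
      unfolding tensor_rels_def Let_def using that by blast
    then show ?thesis
      unfolding tens_def using that tensor_gen_closed
      by (subst eq) (auto intro!: proj(3))
  qed
  have 4: "tens R M N x (a \<odot>\<^bsub>N\<^esub> y) = a \<odot>\<^bsub>tensor_module R M N\<^esub> tens R M N x y"
    if "a \<in> carrier R" "x \<in> carrier M" "y \<in> carrier N" for a x y
  proof -
    have "free_gen R (x, a \<odot>\<^bsub>N\<^esub> y) \<ominus>\<^bsub>\<F>\<^esub> a \<odot>\<^bsub>\<F>\<^esub> free_gen R (x, y) \<in> tensor_rels R M N"
      unfolding tensor_rels_def Let_def using that by blast
    then show ?thesis
      unfolding tens_def using that tensor_gen_closed
      by (subst eq) (auto intro!: proj(3))
  qed
  show ?thesis
    unfolding bilinear_map_def using 1 2 3 4 by (auto intro!: mod_homI)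
qed

text \<open>The kernel of \<phi> is a submodule, and it contains the four kinds of bilinearity
  relations as soon as \<phi> is bilinear on generators. Used for maps out of the tensor product and
  again for the functoriality of it.\<close>

lemma tensor_ker_killed:
  assumes L: "Module.module R L" and \<phi>: "\<phi> \<in> mod_hom R \<F> L" and b: "bilinear_map R M N L b"
    and eq: "\<And>x y. \<lbrakk>x \<in> carrier M; y \<in> carrier N\<rbrakk> \<Longrightarrow> \<phi> (free_gen R (x, y)) = b x y"
    and c: "c \<in> \<K>"
  shows "\<phi> c = \<zero>\<^bsub>L\<^esub>"
proof -
  interpret L: Module.module R L by fact
  note \<phi>' = mod_homD[OF \<phi>] and g = tensor_gen_closed
  have bR: "b x \<in> mod_hom R N L" if "x \<in> carrier M" for x using b that by (auto simp: bilinear_map_def)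
  have bL: "(\<lambda>x. b x y) \<in> mod_hom R M L" if "y \<in> carrier N" for y using b that by (auto simp: bilinear_map_def)
  have minus: "\<phi> (u \<ominus>\<^bsub>\<F>\<^esub> v) = \<zero>\<^bsub>L\<^esub>" if "u \<in> carrier \<F>" "v \<in> carrier \<F>" "\<phi> u = \<phi> v" for u v
    using mod_hom_minus[OF tensor_free_is_module L \<phi> that(1,2)] that(3) \<phi>'(1)[OF that(2)]
    by (simp add: a_minus_def L.M.r_neg)
  have "tensor_rels R M N \<subseteq> {c\<in>carrier \<F>. \<phi> c \<in> {\<zero>\<^bsub>L\<^esub>}}"
  proof
    fix c assume c: "c \<in> tensor_rels R M N"
    have "\<phi> c = \<zero>\<^bsub>L\<^esub>"
      using c unfolding tensor_rels_def Let_def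
      by (elim UnE) (auto simp: \<phi>' g eq mod_homD[OF bR] mod_homD[OF bL] intro!: minus)
    then show "c \<in> {c\<in>carrier \<F>. \<phi> c \<in> {\<zero>\<^bsub>L\<^esub>}}" using c tensor_rels_closed by blast
  qed
  moreover have "submodule {\<zero>\<^bsub>L\<^esub>} R L"
    by (rule L.submoduleI) (auto simp: a_inv_zero[OF L.abelian_group_axioms])
  ultimately have "\<K> \<subseteq> {c\<in>carrier \<F>. \<phi> c \<in> {\<zero>\<^bsub>L\<^esub>}}"
    unfolding tensor_ker_def by (intro submod_gen_least mod_hom_preimage_submodule[OF tensor_free_is_module L \<phi>])
  then show ?thesis using c by auto
qed

lemma tensor_lift:
  assumes L: "Module.module R L" and b: "bilinear_map R M N L b"
  obtains g where "g \<in> mod_hom R (tensor_module R M N) L"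
    "\<And>x y. \<lbrakk>x \<in> carrier M; y \<in> carrier N\<rbrakk> \<Longrightarrow> g (tens R M N x y) = b x y"
proof -
  interpret L: Module.module R L by fact
  define \<phi> where "\<phi> = lin_ext R L (\<lambda>(x, y). b x y)"
  have bc: "b x y \<in> carrier L" if "x \<in> carrier M" "y \<in> carrier N" for x y
    using b that by (auto simp: bilinear_map_def intro: mod_homD(1))
  have \<phi>: "\<phi> \<in> mod_hom R \<F> L" unfolding \<phi>_def by (rule M.R.lin_ext_hom[OF L]) (use bc in auto)
  have \<phi>g: "\<phi> (free_gen R (x, y)) = b x y" if "x \<in> carrier M" "y \<in> carrier N" for x y
    unfolding \<phi>_def by (subst M.R.lin_ext_free_gen[OF L]) (use bc that in auto)
  note kill = tensor_ker_killed[OF L \<phi> b \<phi>g]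
  \<comment> \<open>The value is computed from a chosen representative of the class
    \<open>C\<close>; \<open>kill\<close> shows that the choice does not matter.\<close>
  define g where "g C = \<phi> (SOME c. c \<in> carrier \<F> \<and> C = \<K> +>\<^bsub>\<F>\<^esub> c)" for C
  have g: "g (\<K> +>\<^bsub>\<F>\<^esub> c) = \<phi> c" if c: "c \<in> carrier \<F>" for c
  proof -
    define d where "d = (SOME d. d \<in> carrier \<F> \<and> \<K> +>\<^bsub>\<F>\<^esub> c = \<K> +>\<^bsub>\<F>\<^esub> d)"
    have d: "d \<in> carrier \<F>" "\<K> +>\<^bsub>\<F>\<^esub> c = \<K> +>\<^bsub>\<F>\<^esub> d"
      using someI[of "\<lambda>d. d \<in> carrier \<F> \<and> \<K> +>\<^bsub>\<F>\<^esub> c = \<K> +>\<^bsub>\<F>\<^esub> d" c] c unfolding d_def by auto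
    then have "d \<ominus>\<^bsub>\<F>\<^esub> c \<in> \<K>"
      using quot_eq_iff[OF tensor_free_is_module tensor_ker_submodule(1) d(1) c] by simp
    then have "\<phi> d \<ominus>\<^bsub>L\<^esub> \<phi> c = \<zero>\<^bsub>L\<^esub>"
      using kill mod_hom_minus[OF tensor_free_is_module L \<phi> d(1) c] by auto
    then have "\<phi> d = \<phi> c"
      using mod_homD(1)[OF \<phi>] c d(1) by (simp add: a_minus_def) (metis L.M.minus_equality L.M.minus_minus L.M.a_inv_closed)
    then show ?thesis by (simp add: g_def d_def)
  qed
  note proj = mod_homD[OF tensor_proj_hom] and \<phi>' = mod_homD[OF \<phi>]
  have "g \<in> mod_hom R (tensor_module R M N) L"
  proof (rule mod_homI)
    fix u assume "u \<in> carrier (tensor_module R M N)"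
    then obtain c where c: "c \<in> carrier \<F>" "u = \<K> +>\<^bsub>\<F>\<^esub> c" unfolding tensor_carrier by auto
    show "g u \<in> carrier L" using c g \<phi>'(1) by simp
    show "g (a \<odot>\<^bsub>tensor_module R M N\<^esub> u) = a \<odot>\<^bsub>L\<^esub> g u" if "a \<in> carrier R" for a
      using c g that \<phi>'(3)[OF that c(1)] proj(3)[OF that c(1), symmetric] by simp
    fix v assume "v \<in> carrier (tensor_module R M N)"
    then obtain d where d: "d \<in> carrier \<F>" "v = \<K> +>\<^bsub>\<F>\<^esub> d" unfolding tensor_carrier by auto
    show "g (u \<oplus>\<^bsub>tensor_module R M N\<^esub> v) = g u \<oplus>\<^bsub>L\<^esub> g v"
      using c d g \<phi>'(2)[OF c(1) d(1)] proj(2)[OF c(1) d(1), symmetric] by simp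
  qed
  moreover have "g (tens R M N x y) = b x y" if "x \<in> carrier M" "y \<in> carrier N" for x y
    unfolding tens_def using g[OF tensor_gen_closed[OF that]] \<phi>g[OF that] by simp
  ultimately show thesis by (rule that)
qed

text \<open>Composed with the projection from the free module, both maps are linear extensions of
  their values on generators, and those are the pure tensors.\<close>

lemma tensor_hom_eqI:
  assumes L: "Module.module R L" and f: "f \<in> mod_hom R (tensor_module R M N) L"
    and g: "g \<in> mod_hom R (tensor_module R M N) L"
    and eq: "\<And>x y. \<lbrakk>x \<in> carrier M; y \<in> carrier N\<rbrakk> \<Longrightarrow> f (tens R M N x y) = g (tens R M N x y)"
    and t: "t \<in> carrier (tensor_module R M N)"
  shows "f t = g t"
proof -
  interpret L: Module.module R L by fact
  obtain c where c: "c \<in> carrier \<F>" "t = \<K> +>\<^bsub>\<F>\<^esub> c" using t unfolding tensor_carrier by auto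
  have supp: "{s. c s \<noteq> \<zero>\<^bsub>R\<^esub>} \<subseteq> carrier M \<times> carrier N" using c(1) by (auto simp: free_module_carrier)
  have *: "h t = lin_ext R L (\<lambda>s. h (\<K> +>\<^bsub>\<F>\<^esub> free_gen R s)) c" if "h \<in> mod_hom R (tensor_module R M N) L" for h
    unfolding c(2) using M.R.mod_hom_free_eq_lin_ext[OF L mod_hom_comp[OF tensor_proj_hom that] c(1)] by simp
  show ?thesis
    unfolding *[OF f] *[OF g] lin_ext_def
  proof (rule L.M.finsum_cong')
    show "(\<lambda>s. c s \<odot>\<^bsub>L\<^esub> g (\<K> +>\<^bsub>\<F>\<^esub> free_gen R s)) \<in> {s. c s \<noteq> \<zero>\<^bsub>R\<^esub>} \<rightarrow> carrier L"
    proof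
      fix s assume "s \<in> {s. c s \<noteq> \<zero>\<^bsub>R\<^esub>}"
      then obtain x y where "s = (x, y)" "x \<in> carrier M" "y \<in> carrier N" using supp by blast
      then show "c s \<odot>\<^bsub>L\<^esub> g (\<K> +>\<^bsub>\<F>\<^esub> free_gen R s) \<in> carrier L"
        using M.R.free_module_coeff[OF c(1)] mod_homD(1)[OF g tens_closed] unfolding tens_def by auto
    qed
    fix s assume "s \<in> {s. c s \<noteq> \<zero>\<^bsub>R\<^esub>}"
    then obtain x y where "s = (x, y)" "x \<in> carrier M" "y \<in> carrier N" using supp by blast
    then show "c s \<odot>\<^bsub>L\<^esub> f (\<K> +>\<^bsub>\<F>\<^esub> free_gen R s) = c s \<odot>\<^bsub>L\<^esub> g (\<K> +>\<^bsub>\<F>\<^esub> free_gen R s)"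
      using eq unfolding tens_def by simp
  qed simp
qed

lemma tens_hom_right: "x \<in> carrier M \<Longrightarrow> tens R M N x \<in> mod_hom R N (tensor_module R M N)"
  and tens_hom_left: "y \<in> carrier N \<Longrightarrow> (\<lambda>x. tens R M N x y) \<in> mod_hom R M (tensor_module R M N)"
  using tens_bilinear by (auto simp: bilinear_map_def)

end

lemma bilinear_map_comp:
  assumes b: "bilinear_map R M' N' L b" and f: "f \<in> mod_hom R M M'" and g: "g \<in> mod_hom R N N'"
  shows "bilinear_map R M N L (\<lambda>x y. b (f x) (g y))"
  unfolding bilinear_map_def
proof (intro conjI ballI)
  fix x assume "x \<in> carrier M"
  then have "b (f x) \<in> mod_hom R N' L" using b mod_homD(1)[OF f] by (auto simp: bilinear_map_def)
  from mod_hom_comp[OF g this] show "(\<lambda>y. b (f x) (g y)) \<in> mod_hom R N L" .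
next
  fix y assume "y \<in> carrier N"
  then have "(\<lambda>x. b x (g y)) \<in> mod_hom R M' L" using b mod_homD(1)[OF g] by (auto simp: bilinear_map_def)
  from mod_hom_comp[OF f this] show "(\<lambda>x. b (f x) (g y)) \<in> mod_hom R M L" .
qed

lemma tensor_map_props:
  assumes M: "Module.module R M" and N: "Module.module R N" and M': "Module.module R M'" and N': "Module.module R N'"
    and f: "f \<in> mod_hom R M M'" and g: "g \<in> mod_hom R N N'"
  shows tensor_map_hom: "tensor_map R M' N' f g \<in> mod_hom R (tensor_module R M N) (tensor_module R M' N')"
    and tensor_map_tens: "\<lbrakk>x \<in> carrier M; y \<in> carrier N\<rbrakk> \<Longrightarrow>
      tensor_map R M' N' f g (tens R M N x y) = tens R M' N' (f x) (g y)"
proof -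
  interpret M: Module.module R M by fact
  let ?F = "tensor_free R M N" and ?F' = "tensor_free R M' N'"
  let ?K = "tensor_ker R M N" and ?K' = "tensor_ker R M' N'"
  define \<phi> where "\<phi> = lin_ext R ?F' (\<lambda>(x, y). free_gen R (f x, g y))"
  note F = tensor_free_is_module[OF M N] and F' = tensor_free_is_module[OF M' N']
  note K = tensor_ker_submodule(1)[OF M N] and K' = tensor_ker_submodule(1)[OF M' N']
  have gen: "free_gen R (f x, g y) \<in> carrier ?F'" if "x \<in> carrier M" "y \<in> carrier N" for x y
    using tensor_gen_closed[OF M' N'] mod_homD(1)[OF f] mod_homD(1)[OF g] that by blast
  have \<phi>: "\<phi> \<in> mod_hom R ?F ?F'" unfolding \<phi>_def by (rule M.R.lin_ext_hom[OF F']) (use gen in auto)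
  have \<phi>g: "\<phi> (free_gen R (x, y)) = free_gen R (f x, g y)" if "x \<in> carrier M" "y \<in> carrier N" for x y
    unfolding \<phi>_def by (subst M.R.lin_ext_free_gen[OF F']) (use gen that in auto)
  \<comment> \<open>Followed by the projection to M' \<otimes> N', the map \<phi> is bilinear on
    generators. So it kills the relations of M \<otimes> N, which says that their images are
    relations of M' \<otimes> N'.\<close>
  have ker: "\<phi> c \<in> ?K'" if c: "c \<in> ?K" for c
  proof -
    have "?K' +>\<^bsub>?F'\<^esub> \<phi> c = \<zero>\<^bsub>tensor_module R M' N'\<^esub>"
      by (rule tensor_ker_killed[OF M N tensor_module_is_module[OF M' N']
            mod_hom_comp[OF \<phi> tensor_proj_hom[OF M' N']] bilinear_map_comp[OF tens_bilinear[OF M' N'] f g] _ c])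
        (simp add: \<phi>g tens_def)
    moreover have "c \<in> carrier ?F" using c Module.module.submoduleE(1)[OF F K] by auto
    ultimately show ?thesis
      using quot_eq_zero_iff[OF F' K' mod_homD(1)[OF \<phi>]] unfolding tensor_module_def by blast
  qed
  have tm: "tensor_map R M' N' f g (?K +>\<^bsub>?F\<^esub> c) = ?K' +>\<^bsub>?F'\<^esub> \<phi> c" if "c \<in> carrier ?F" for c
    unfolding tensor_map_def \<phi>_def[symmetric] by (rule coset_map_apply[OF F K F' K' \<phi> ker that])
  note proj = mod_homD[OF tensor_proj_hom[OF M N]] and proj' = mod_homD[OF tensor_proj_hom[OF M' N']]
    and \<phi>' = mod_homD[OF \<phi>]
  interpret F: Module.module R ?F by (rule F)
  show "tensor_map R M' N' f g \<in> mod_hom R (tensor_module R M N) (tensor_module R M' N')"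
  proof (rule mod_homI)
    fix u assume "u \<in> carrier (tensor_module R M N)"
    then obtain c where c: "c \<in> carrier ?F" "u = ?K +>\<^bsub>?F\<^esub> c" unfolding tensor_carrier[OF M N] by auto
    show "tensor_map R M' N' f g u \<in> carrier (tensor_module R M' N')"
      unfolding c(2) tm[OF c(1)] by (rule proj'(1)[OF \<phi>'(1)[OF c(1)]])
    show "tensor_map R M' N' f g (a \<odot>\<^bsub>tensor_module R M N\<^esub> u) =
        a \<odot>\<^bsub>tensor_module R M' N'\<^esub> tensor_map R M' N' f g u" if a: "a \<in> carrier R" for a
      using tm[OF F.smult_closed[OF a c(1)]] tm[OF c(1)] \<phi>'(3)[OF a c(1)] proj(3)[OF a c(1)]
        proj'(3)[OF a \<phi>'(1)[OF c(1)]] c(2) by simp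
    fix v assume "v \<in> carrier (tensor_module R M N)"
    then obtain d where d: "d \<in> carrier ?F" "v = ?K +>\<^bsub>?F\<^esub> d" unfolding tensor_carrier[OF M N] by auto
    show "tensor_map R M' N' f g (u \<oplus>\<^bsub>tensor_module R M N\<^esub> v) =
        tensor_map R M' N' f g u \<oplus>\<^bsub>tensor_module R M' N'\<^esub> tensor_map R M' N' f g v"
      using tm[OF F.M.a_closed[OF c(1) d(1)]] tm[OF c(1)] tm[OF d(1)] \<phi>'(2)[OF c(1) d(1)]
        proj(2)[OF c(1) d(1)] proj'(2)[OF \<phi>'(1)[OF c(1)] \<phi>'(1)[OF d(1)]] c(2) d(2) by simp
  qed
  show "tensor_map R M' N' f g (tens R M N x y) = tens R M' N' (f x) (g y)"
    if "x \<in> carrier M" "y \<in> carrier N"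
    unfolding tens_def using tm[OF tensor_gen_closed[OF M N that]] \<phi>g[OF that] by simp
qed

text \<open>A dual basis: vectors \<open>v j\<close> with coordinate functionals
  \<open>\<pi> j\<close>. The expansion of \<open>x\<close> is the form in which finite freeness
  enters the arguments about resolutions.\<close>

lemma fin_free_basis:
  assumes "fin_free R M"
  obtains k :: nat and v \<pi> where "\<And>j. j < k \<Longrightarrow> v j \<in> carrier M"
    "\<And>j. j < k \<Longrightarrow> \<pi> j \<in> mod_hom R M (ring_mod R)"
    "\<And>x. x \<in> carrier M \<Longrightarrow> x = finsum M (\<lambda>j. \<pi> j x \<odot>\<^bsub>M\<^esub> v j) {..<k}"
proof -
  obtain k :: nat and \<phi> where M: "Module.module R M" and iso: "\<phi> \<in> mod_iso R (free_module R {..<k}) M"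
    using assms unfolding fin_free_def by auto
  interpret M: Module.module R M by fact
  let ?F = "free_module R {..<k}"
  interpret F: Module.module R ?F by (rule M.R.free_module_is_module)
  let ?g = "inv_into (carrier ?F) \<phi>"
  note \<phi> = mod_isoD[OF iso] and g = mod_iso_inv[OF F.module_axioms iso]
  define v where "v j = \<phi> (free_gen R j)" for j
  define \<pi> where "\<pi> j x = ?g x j" for j x
  have vM: "v j \<in> carrier M" if "j < k" for j
    unfolding v_def by (rule mod_homD(1)[OF \<phi>(1)]) (use that in \<open>auto intro: M.R.free_gen_closed\<close>)
  have ops: "(c \<oplus>\<^bsub>?F\<^esub> d) j = c j \<oplus>\<^bsub>R\<^esub> d j" "(a \<odot>\<^bsub>?F\<^esub> c) j = a \<otimes>\<^bsub>R\<^esub> c j" for a c d j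
    by (simp_all add: free_module_def)
  have \<pi>: "\<pi> j \<in> mod_hom R M (ring_mod R)" for j
  proof (rule mod_homI)
    show "\<pi> j x \<in> carrier (ring_mod R)" if "x \<in> carrier M" for x
      unfolding \<pi>_def using M.R.free_module_coeff[OF mod_homD(1)[OF g that]] by simp
    show "\<pi> j (x \<oplus>\<^bsub>M\<^esub> y) = \<pi> j x \<oplus>\<^bsub>ring_mod R\<^esub> \<pi> j y" if "x \<in> carrier M" "y \<in> carrier M" for x y
      unfolding \<pi>_def mod_homD(2)[OF g that] ops by simp
    show "\<pi> j (a \<odot>\<^bsub>M\<^esub> x) = a \<odot>\<^bsub>ring_mod R\<^esub> \<pi> j x" if "a \<in> carrier R" "x \<in> carrier M" for a x
      unfolding \<pi>_def mod_homD(3)[OF g that] ops by simp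
  qed
  have "x = finsum M (\<lambda>j. \<pi> j x \<odot>\<^bsub>M\<^esub> v j) {..<k}" if x: "x \<in> carrier M" for x
  proof -
    have gx: "?g x \<in> carrier ?F" by (rule mod_homD(1)[OF g x])
    have "x = \<phi> (?g x)" using \<phi>(3) x by (simp add: f_inv_into_f)
    also have "\<dots> = lin_ext R M v (?g x)"
      unfolding v_def by (rule M.R.mod_hom_free_eq_lin_ext[OF M \<phi>(1) gx])
    also have "\<dots> = finsum M (\<lambda>j. ?g x j \<odot>\<^bsub>M\<^esub> v j) {..<k}"
    proof (rule M.R.lin_ext_superset[OF M])
      show "{j. ?g x j \<noteq> \<zero>\<^bsub>R\<^esub>} \<subseteq> {..<k}" using gx by (auto simp: free_module_carrier)
    qed (use vM M.R.free_module_coeff[OF gx] in auto)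
    finally show ?thesis unfolding \<pi>_def .
  qed
  then show thesis using vM \<pi> by (intro that[of k v \<pi>]) auto
qed

text \<open>The map induced by this pairing on M \<otimes> N is \<pi> \<otimes> id followed by the
  identification of R \<otimes> N with N, a coordinate map.\<close>

lemma scalar_bilinear:
  assumes N: "Module.module R N" and \<pi>: "\<pi> \<in> mod_hom R M (ring_mod R)"
  shows "bilinear_map R M N N (\<lambda>x y. \<pi> x \<odot>\<^bsub>N\<^esub> y)"
proof -
  interpret N: Module.module R N by fact
  note \<pi>' = mod_homD[OF \<pi>, simplified]
  have "\<pi> x \<odot>\<^bsub>N\<^esub> (a \<odot>\<^bsub>N\<^esub> y) = a \<odot>\<^bsub>N\<^esub> (\<pi> x \<odot>\<^bsub>N\<^esub> y)"
    if "x \<in> carrier M" "a \<in> carrier R" "y \<in> carrier N" for x a y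
    using that \<pi>'(1) N.smult_assoc1[of "\<pi> x" a y] N.smult_assoc1[of a "\<pi> x" y] N.R.m_comm[of "\<pi> x" a] by simp
  then show ?thesis
    unfolding bilinear_map_def
    by (auto intro!: mod_homI simp: \<pi>' N.smult_l_distr N.smult_r_distr N.smult_assoc1)
qed

text \<open>Local exactness is checked in each coordinate with respect to a basis of \<open>M\<close>.\<close>

lemma free_tensor_locally_exact:
  assumes p: "primeideal p R" and ff: "fin_free R M" and Q: "is_cpx R Q" and L: "locally_exact R p Q m"
    and t: "t \<in> carrier (tensor_module R M (cx_mod Q m))"
      "tensor_map R M (cx_mod Q (m + 1)) (\<lambda>x. x) (cx_diff Q m) t = \<zero>\<^bsub>tensor_module R M (cx_mod Q (m + 1))\<^esub>"
  shows "\<exists>s\<in>carrier R - p. \<exists>w\<in>carrier (tensor_module R M (cx_mod Q (m - 1))).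
     s \<odot>\<^bsub>tensor_module R M (cx_mod Q m)\<^esub> t = tensor_map R M (cx_mod Q m) (\<lambda>x. x) (cx_diff Q (m - 1)) w"
proof -
  have M: "Module.module R M" using ff by (simp add: fin_free_def)
  obtain k :: nat and v \<pi> where v: "\<And>j. j < k \<Longrightarrow> v j \<in> carrier M"
    and \<pi>: "\<And>j. j < k \<Longrightarrow> \<pi> j \<in> mod_hom R M (ring_mod R)"
    and bas: "\<And>x. x \<in> carrier M \<Longrightarrow> x = finsum M (\<lambda>j. \<pi> j x \<odot>\<^bsub>M\<^esub> v j) {..<k}"
    using fin_free_basis[OF ff] by blast
  let ?N = "\<lambda>n. cx_mod Q n" and ?T = "\<lambda>n. tensor_module R M (cx_mod Q n)"
  note N = is_cpxD(1)[OF Q] and T = tensor_module_is_module[OF M is_cpxD(1)[OF Q]]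
  interpret M: Module.module R M by fact
  interpret N: Module.module R "?N m" by (rule N)
  interpret T: Module.module R "?T m" by (rule T)
  interpret T': Module.module R "?T (m - 1)" by (rule T)
  \<comment> \<open>The coordinate maps \<open>\<gamma> j n\<close>, given on pure tensors by
    multiplying \<open>y\<close> with the j-th coordinate of \<open>x\<close>.\<close>
  have "\<exists>g\<in>mod_hom R (?T n) (?N n). \<forall>x\<in>carrier M. \<forall>y\<in>carrier (?N n). g (tens R M (?N n) x y) = \<pi> j x \<odot>\<^bsub>?N n\<^esub> y"
    if "j < k" for j n
    by (rule tensor_lift[OF M N[of n] N[of n] scalar_bilinear[OF N[of n] \<pi>[OF that]]]) blast
  then obtain \<gamma> where \<gamma>: "\<And>j n. j < k \<Longrightarrow> \<gamma> j n \<in> mod_hom R (?T n) (?N n)"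
    and \<gamma>t: "\<And>j n x y. \<lbrakk>j < k; x \<in> carrier M; y \<in> carrier (?N n)\<rbrakk> \<Longrightarrow> \<gamma> j n (tens R M (?N n) x y) = \<pi> j x \<odot>\<^bsub>?N n\<^esub> y"
    by metis
  \<comment> \<open>An element of the tensor product is recovered from its coordinates, because on
    pure tensors the scalars \<open>\<pi> j x\<close> may be moved from one factor to the
    other.\<close>
  have decomp: "u = finsum (?T m) (\<lambda>j. tens R M (?N m) (v j) (\<gamma> j m u)) {..<k}" if u: "u \<in> carrier (?T m)" for u
  proof (rule tensor_hom_eqI[OF M N T mod_hom_id _ _ u])
    show "(\<lambda>u. finsum (?T m) (\<lambda>j. tens R M (?N m) (v j) (\<gamma> j m u)) {..<k}) \<in> mod_hom R (?T m) (?T m)"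
      by (rule mod_hom_sum[OF T T]) (auto intro!: mod_hom_comp[OF \<gamma> tens_hom_right[OF M N v]])
    fix x y assume x: "x \<in> carrier M" and y: "y \<in> carrier (?N m)"
    have \<pi>x: "\<pi> j x \<in> carrier R" if "j < k" for j using mod_homD(1)[OF \<pi>[OF that] x] by simp
    have "tens R M (?N m) x y = tens R M (?N m) (finsum M (\<lambda>j. \<pi> j x \<odot>\<^bsub>M\<^esub> v j) {..<k}) y"
      using bas[OF x] by simp
    also have "\<dots> = finsum (?T m) (\<lambda>j. tens R M (?N m) (\<pi> j x \<odot>\<^bsub>M\<^esub> v j) y) {..<k}"
      by (rule mod_hom_finsum[OF M T tens_hom_left[OF M N y]]) (use \<pi>x v in auto)
    also have "\<dots> = finsum (?T m) (\<lambda>j. tens R M (?N m) (v j) (\<gamma> j m (tens R M (?N m) x y))) {..<k}"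
    proof (rule T.M.finsum_cong')
      show "(\<lambda>j. tens R M (?N m) (v j) (\<gamma> j m (tens R M (?N m) x y))) \<in> {..<k} \<rightarrow> carrier (?T m)"
        using \<gamma>t x y \<pi>x v tens_closed[OF M N] by auto
      fix j assume j: "j \<in> {..<k}"
      then show "tens R M (?N m) (\<pi> j x \<odot>\<^bsub>M\<^esub> v j) y = tens R M (?N m) (v j) (\<gamma> j m (tens R M (?N m) x y))"
        using \<gamma>t[of j x y] x y \<pi>x[of j] v[of j] mod_homD(3)[OF tens_hom_left[OF M N y]]
          mod_homD(3)[OF tens_hom_right[OF M N v]] by auto
    qed simp
    finally show "tens R M (?N m) x y = finsum (?T m) (\<lambda>j. tens R M (?N m) (v j) (\<gamma> j m (tens R M (?N m) x y))) {..<k}" .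
  qed
  note d = is_cpxD(2)[OF Q, of m] and d' = is_cpxD(4)[OF Q, of m]
  let ?D = "tensor_map R M (?N (m + 1)) (\<lambda>x. x) (cx_diff Q m)"
    and ?D' = "tensor_map R M (?N m) (\<lambda>x. x) (cx_diff Q (m - 1))"
  note D = tensor_map_hom[OF M N M N mod_hom_id d] and Dt = tensor_map_tens[OF M N M N mod_hom_id d]
  note D' = tensor_map_hom[OF M N M N mod_hom_id d'] and D't = tensor_map_tens[OF M N M N mod_hom_id d']
  \<comment> \<open>The coordinate maps commute with the differentials, so the coordinates of
    \<open>t\<close> are cocycles of \<open>Q\<close> and local exactness of \<open>Q\<close>
    applies to each of them.\<close>
  have nat: "\<gamma> j (m + 1) (?D u) = cx_diff Q m (\<gamma> j m u)" if j: "j < k" and u: "u \<in> carrier (?T m)" for j u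
  proof (rule tensor_hom_eqI[OF M N N mod_hom_comp[OF D \<gamma>[OF j]] mod_hom_comp[OF \<gamma>[OF j] d] _ u])
    fix x y assume x: "x \<in> carrier M" and y: "y \<in> carrier (?N m)"
    show "\<gamma> j (m + 1) (?D (tens R M (?N m) x y)) = cx_diff Q m (\<gamma> j m (tens R M (?N m) x y))"
      using Dt[OF x y] \<gamma>t[OF j x y] \<gamma>t[OF j x mod_homD(1)[OF d y]] mod_homD(3)[OF d _ y, of "\<pi> j x"]
        mod_homD(1)[OF \<pi>[OF j] x] by simp
  qed
  have c: "\<gamma> j m t \<in> carrier (?N m)" if "j < k" for j by (rule mod_homD(1)[OF \<gamma>[OF that] t(1)])
  have "\<exists>s\<in>carrier R - p. s \<odot>\<^bsub>?N m\<^esub> \<gamma> j m t \<in> coboundaries Q m" if j: "j < k" for j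
  proof -
    have "cx_diff Q m (\<gamma> j m t) = \<zero>\<^bsub>?N (m + 1)\<^esub>"
      using nat[OF j t(1)] t(2) mod_hom_zero[OF T N \<gamma>[OF j]] by simp
    with L c[OF j] show ?thesis unfolding locally_exact_def by blast
  qed
  then have "\<exists>s\<in>carrier R - p. \<forall>j\<in>{..<k}. s \<odot>\<^bsub>?N m\<^esub> \<gamma> j m t \<in> coboundaries Q m"
    using c by (intro common_denominator[OF p N coboundaries_submodule[OF Q]]) auto
  then obtain s where s: "s \<in> carrier R - p" and "\<forall>j<k. \<exists>q\<in>carrier (?N (m - 1)). s \<odot>\<^bsub>?N m\<^esub> \<gamma> j m t = cx_diff Q (m - 1) q"
    unfolding coboundaries_def by blast
  then obtain q where q: "\<And>j. j < k \<Longrightarrow> q j \<in> carrier (?N (m - 1))"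
    and qe: "\<And>j. j < k \<Longrightarrow> s \<odot>\<^bsub>?N m\<^esub> \<gamma> j m t = cx_diff Q (m - 1) (q j)" by metis
  have sR: "s \<in> carrier R" using s by simp
  let ?w = "finsum (?T (m - 1)) (\<lambda>j. tens R M (?N (m - 1)) (v j) (q j)) {..<k}"
  have tc: "(\<lambda>j. tens R M (?N (m - 1)) (v j) (q j)) \<in> {..<k} \<rightarrow> carrier (?T (m - 1))"
    using v q tens_closed[OF M N] by auto
  have w: "?w \<in> carrier (?T (m - 1))" by (rule T'.M.finsum_closed[OF tc])
  have "?D' ?w = finsum (?T m) (\<lambda>j. ?D' (tens R M (?N (m - 1)) (v j) (q j))) {..<k}"
    by (rule mod_hom_finsum[OF T T D' _ tc]) simp
  also have "\<dots> = finsum (?T m) (\<lambda>j. s \<odot>\<^bsub>?T m\<^esub> tens R M (?N m) (v j) (\<gamma> j m t)) {..<k}"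
  proof (rule T.M.finsum_cong')
    show "(\<lambda>j. s \<odot>\<^bsub>?T m\<^esub> tens R M (?N m) (v j) (\<gamma> j m t)) \<in> {..<k} \<rightarrow> carrier (?T m)"
      using v c sR tens_closed[OF M N] by auto
    fix j assume "j \<in> {..<k}"
    then show "?D' (tens R M (?N (m - 1)) (v j) (q j)) = s \<odot>\<^bsub>?T m\<^esub> tens R M (?N m) (v j) (\<gamma> j m t)"
      using D't[OF v[of j] q[of j]] qe[of j] mod_homD(3)[OF tens_hom_right[OF M N v[of j]] sR c[of j]] by simp
  qed simp
  also have "\<dots> = s \<odot>\<^bsub>?T m\<^esub> finsum (?T m) (\<lambda>j. tens R M (?N m) (v j) (\<gamma> j m t)) {..<k}"
    by (rule T.finsum_smult_ldistr[symmetric]) (use sR v c tens_closed[OF M N] in auto)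
  also have "\<dots> = s \<odot>\<^bsub>?T m\<^esub> t" using decomp[OF t(1)] by simp
  finally show ?thesis using s w by (metis (no_types, lifting))
qed

section \<open>Functionals detecting cohomology\<close>

lemma finsum_submodule:
  assumes M: "Module.module R M" and S: "submodule S R M" and "finite A" "\<And>j. j \<in> A \<Longrightarrow> f j \<in> S"
  shows "finsum M f A \<in> S"
proof -
  interpret M: Module.module R M by fact
  show ?thesis using assms(3,4)
  proof (induction A rule: finite_induct)
    case empty then show ?case using submodule_zero[OF M S] by simp
  next
    case (insert i A)
    have "f i \<in> carrier M" "f \<in> A \<rightarrow> carrier M" using insert.prems M.submoduleE(1)[OF S] by auto
    then have "finsum M f (insert i A) = f i \<oplus>\<^bsub>M\<^esub> finsum M f A"
      using insert.hyps by (intro M.M.finsum_insert) auto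
    then show ?case using M.submoduleE(5)[OF S] insert by auto
  qed
qed

lemma scalar_hom:
  assumes M: "Module.module R M" and g: "g \<in> carrier M"
  shows "(\<lambda>r. r \<odot>\<^bsub>M\<^esub> g) \<in> mod_hom R (ring_mod R) M"
proof -
  interpret M: Module.module R M by fact
  show ?thesis by (rule mod_homI) (use g in \<open>auto simp: M.smult_l_distr M.smult_assoc1\<close>)
qed

lemma scalar_endo:
  assumes M: "Module.module R M" and s: "s \<in> carrier R"
  shows "(\<lambda>x. s \<odot>\<^bsub>M\<^esub> x) \<in> mod_hom R M M"
proof -
  interpret M: Module.module R M by fact
  show ?thesis
  proof (rule mod_homI)
    show "s \<odot>\<^bsub>M\<^esub> (a \<odot>\<^bsub>M\<^esub> x) = a \<odot>\<^bsub>M\<^esub> (s \<odot>\<^bsub>M\<^esub> x)" if "a \<in> carrier R" "x \<in> carrier M" for a x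
      using that s M.smult_assoc1[of s a x] M.smult_assoc1[of a s x] M.R.m_comm[of s a] by simp
  qed (use s in \<open>auto simp: M.smult_r_distr\<close>)
qed

lemma mod_hom_diff:
  assumes M: "Module.module R M" and L: "Module.module R L"
    and f: "f \<in> mod_hom R M L" and g: "g \<in> mod_hom R M L"
  shows "(\<lambda>x. f x \<ominus>\<^bsub>L\<^esub> g x) \<in> mod_hom R M L"
proof -
  interpret L: Module.module R L by fact
  show ?thesis
    by (rule mod_homI)
      (auto simp: mod_homD[OF f] mod_homD[OF g] a_minus_def L.M.minus_add L.M.a_ac
        L.smult_r_distr L.smult_r_minus)
qed

lemma submodule_add_cyclic:
  assumes M: "Module.module R M" and S: "submodule S R M" and g: "g \<in> carrier M"
  shows "submodule {y \<oplus>\<^bsub>M\<^esub> r \<odot>\<^bsub>M\<^esub> g |y r. y \<in> S \<and> r \<in> carrier R} R M" (is "submodule ?T R M")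
proof -
  interpret M: Module.module R M by fact
  note SE = M.submoduleE[OF S]
  have SM: "y \<in> carrier M" if "y \<in> S" for y using SE(1) that by auto
  have I: "y \<oplus>\<^bsub>M\<^esub> r \<odot>\<^bsub>M\<^esub> g \<in> ?T" if "y \<in> S" "r \<in> carrier R" for y r using that by blast
  show ?thesis
  proof (rule M.submoduleI)
    show "?T \<subseteq> carrier M" using SM g by auto
    have "\<zero>\<^bsub>M\<^esub> = \<zero>\<^bsub>M\<^esub> \<oplus>\<^bsub>M\<^esub> \<zero>\<^bsub>R\<^esub> \<odot>\<^bsub>M\<^esub> g" using g by simp
    also have "\<dots> \<in> ?T" by (rule I[OF submodule_zero[OF M S]]) simp
    finally show "\<zero>\<^bsub>M\<^esub> \<in> ?T" .
    show "a \<oplus>\<^bsub>M\<^esub> b \<in> ?T" if "a \<in> ?T" "b \<in> ?T" for a b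
    proof -
      from that(1) obtain y r where a: "a = y \<oplus>\<^bsub>M\<^esub> r \<odot>\<^bsub>M\<^esub> g" "y \<in> S" "r \<in> carrier R" by auto
      from that(2) obtain z t where b: "b = z \<oplus>\<^bsub>M\<^esub> t \<odot>\<^bsub>M\<^esub> g" "z \<in> S" "t \<in> carrier R" by auto
      have "a \<oplus>\<^bsub>M\<^esub> b = (y \<oplus>\<^bsub>M\<^esub> z) \<oplus>\<^bsub>M\<^esub> (r \<oplus>\<^bsub>R\<^esub> t) \<odot>\<^bsub>M\<^esub> g"
        unfolding a(1) b(1) using SM a b g by (simp add: M.smult_l_distr M.M.a_ac)
      then show ?thesis using I[OF SE(5)[OF a(2) b(2)]] a(3) b(3) by simp
    qed
    show sm: "a \<odot>\<^bsub>M\<^esub> x \<in> ?T" if "a \<in> carrier R" "x \<in> ?T" for a x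
    proof -
      from that(2) obtain y r where x: "x = y \<oplus>\<^bsub>M\<^esub> r \<odot>\<^bsub>M\<^esub> g" "y \<in> S" "r \<in> carrier R" by auto
      have "a \<odot>\<^bsub>M\<^esub> x = a \<odot>\<^bsub>M\<^esub> y \<oplus>\<^bsub>M\<^esub> (a \<otimes>\<^bsub>R\<^esub> r) \<odot>\<^bsub>M\<^esub> g"
        unfolding x(1) using SM x g that(1) by (simp add: M.smult_r_distr M.smult_assoc1)
      then show ?thesis using I[OF SE(4)[OF that(1) x(2)]] that(1) x(3) by simp
    qed
    show "\<ominus>\<^bsub>M\<^esub> a \<in> ?T" if "a \<in> ?T" for a
    proof -
      have "a \<in> carrier M" using that SM g by auto
      then have "\<ominus>\<^bsub>M\<^esub> a = (\<ominus>\<^bsub>R\<^esub> \<one>\<^bsub>R\<^esub>) \<odot>\<^bsub>M\<^esub> a" by (simp add: M.smult_l_minus)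
      then show ?thesis using sm[OF _ that, of "\<ominus>\<^bsub>R\<^esub> \<one>\<^bsub>R\<^esub>"] by simp
    qed
  qed
qed

text \<open>With \<open>s\<close> invertible at \<open>p\<close>, the quotient e/s is a projection
  of P^m onto the cocycles, so these are locally a direct summand.\<close>

definition local_retraction :: "('a, 'r) ring_scheme \<Rightarrow> 'a set \<Rightarrow> ('a, 'b) cpx \<Rightarrow> int \<Rightarrow> bool" where
  "local_retraction R p P m \<longleftrightarrow> (\<exists>s\<in>carrier R - p. \<exists>e\<in>mod_hom R (cx_mod P m) (cx_mod P m).
     (\<forall>x\<in>carrier (cx_mod P m). cx_diff P m (e x) = \<zero>\<^bsub>cx_mod P (m + 1)\<^esub>) \<and>
     (\<forall>x\<in>carrier (cocycles P m). e x = s \<odot>\<^bsub>cx_mod P m\<^esub> x))"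

text \<open>Locally at \<open>p\<close> the cocycles in degree m+1 are a summand of a free module,
  hence projective. Exactness in degree m+1 says that the differential maps P^m onto them, so it
  splits, and the splitting gives a projection of P^m onto its own cocycles.\<close>

lemma local_retraction_step:
  assumes p: "primeideal p R" and P: "is_cpx R P" and ff: "fin_free R (cx_mod P (m + 1))"
    and split: "local_retraction R p P (m + 1)" and ex: "locally_exact R p P (m + 1)"
  shows "local_retraction R p P m"
proof -
  let ?M = "cx_mod P m" and ?N = "cx_mod P (m + 1)"
  note M = is_cpxD(1)[OF P, of m] and N = is_cpxD(1)[OF P, of "m + 1"] and d = is_cpxD(2)[OF P, of m]
  interpret M: Module.module R ?M by (rule M)
  interpret N: Module.module R ?N by (rule N)
  obtain s e where s: "s \<in> carrier R - p" and e: "e \<in> mod_hom R ?N ?N"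
    and eZ: "\<And>x. x \<in> carrier ?N \<Longrightarrow> cx_diff P (m + 1) (e x) = \<zero>\<^bsub>cx_mod P (m + 1 + 1)\<^esub>"
    and es: "\<And>x. x \<in> carrier (cocycles P (m + 1)) \<Longrightarrow> e x = s \<odot>\<^bsub>?N\<^esub> x"
    using split unfolding local_retraction_def by blast
  obtain k :: nat and v \<pi> where v: "\<And>j. j < k \<Longrightarrow> v j \<in> carrier ?N"
    and \<pi>: "\<And>j. j < k \<Longrightarrow> \<pi> j \<in> mod_hom R ?N (ring_mod R)"
    and bas: "\<And>x. x \<in> carrier ?N \<Longrightarrow> x = finsum ?N (\<lambda>j. \<pi> j x \<odot>\<^bsub>?N\<^esub> v j) {..<k}"
    using fin_free_basis[OF ff] by blast
  have ev: "e (v j) \<in> carrier ?N" if "j < k" for j by (rule mod_homD(1)[OF e v[OF that]])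
  have "\<exists>t\<in>carrier R - p. \<forall>j\<in>{..<k}. t \<odot>\<^bsub>?N\<^esub> e (v j) \<in> coboundaries P (m + 1)"
  proof (rule common_denominator[OF p N coboundaries_submodule[OF P]])
    fix j assume "j \<in> {..<k}"
    then have "e (v j) \<in> carrier ?N" "cx_diff P (m + 1) (e (v j)) = \<zero>\<^bsub>cx_mod P (m + 1 + 1)\<^esub>"
      using ev eZ v by auto
    then show "\<exists>s\<in>carrier R - p. s \<odot>\<^bsub>?N\<^esub> e (v j) \<in> coboundaries P (m + 1)"
      using ex unfolding locally_exact_def by blast
  qed (use ev in auto)
  then obtain t where t: "t \<in> carrier R - p"
    and "\<forall>j<k. \<exists>y\<in>carrier ?M. t \<odot>\<^bsub>?N\<^esub> e (v j) = cx_diff P m y"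
    by (auto simp: coboundaries_def image_iff)
  then obtain y where y: "\<And>j. j < k \<Longrightarrow> y j \<in> carrier ?M"
    and ty: "\<And>j. j < k \<Longrightarrow> t \<odot>\<^bsub>?N\<^esub> e (v j) = cx_diff P m (y j)" by metis
  have tR: "t \<in> carrier R" and sR: "s \<in> carrier R" using t s by auto
  \<comment> \<open>Projectivity in coordinates: each \<open>e (v j)\<close> is a cocycle, so with a
    common denominator \<open>t\<close> it becomes the differential of some \<open>y j\<close>.
    Sending \<open>v j\<close> to \<open>y j\<close> lifts t e through the differential.\<close>
  define h where "h u = finsum ?M (\<lambda>j. \<pi> j u \<odot>\<^bsub>?M\<^esub> y j) {..<k}" for u
  have h: "h \<in> mod_hom R ?N ?M"
    unfolding h_def by (rule mod_hom_sum[OF N M]) (auto intro!: mod_hom_comp[OF \<pi> scalar_hom[OF M y]])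
  have \<pi>c: "\<pi> j u \<in> carrier R" if "j < k" "u \<in> carrier ?N" for j u using mod_homD(1)[OF \<pi>[OF that(1)] that(2)] by simp
  have dh: "cx_diff P m (h u) = t \<odot>\<^bsub>?N\<^esub> e u" if u: "u \<in> carrier ?N" for u
  proof -
    have "cx_diff P m (h u) = finsum ?N (\<lambda>j. cx_diff P m (\<pi> j u \<odot>\<^bsub>?M\<^esub> y j)) {..<k}"
      unfolding h_def by (rule mod_hom_finsum[OF M N d]) (use \<pi>c u y in auto)
    also have "\<dots> = finsum ?N (\<lambda>j. t \<odot>\<^bsub>?N\<^esub> e (\<pi> j u \<odot>\<^bsub>?N\<^esub> v j)) {..<k}"
    proof (rule N.M.finsum_cong')
      show "(\<lambda>j. t \<odot>\<^bsub>?N\<^esub> e (\<pi> j u \<odot>\<^bsub>?N\<^esub> v j)) \<in> {..<k} \<rightarrow> carrier ?N"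
        using tR \<pi>c u v mod_homD(1)[OF e] by auto
      fix j assume "j \<in> {..<k}"
      then have j: "j < k" by simp
      have "cx_diff P m (\<pi> j u \<odot>\<^bsub>?M\<^esub> y j) = \<pi> j u \<odot>\<^bsub>?N\<^esub> (t \<odot>\<^bsub>?N\<^esub> e (v j))"
        using mod_homD(3)[OF d \<pi>c[OF j u] y[OF j]] ty[OF j] by simp
      also have "\<dots> = t \<odot>\<^bsub>?N\<^esub> (\<pi> j u \<odot>\<^bsub>?N\<^esub> e (v j))"
        using mod_homD(3)[OF scalar_endo[OF N tR] \<pi>c[OF j u] ev[OF j]] by simp
      also have "\<pi> j u \<odot>\<^bsub>?N\<^esub> e (v j) = e (\<pi> j u \<odot>\<^bsub>?N\<^esub> v j)"
        using mod_homD(3)[OF e \<pi>c[OF j u] v[OF j]] by simp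
      finally show "cx_diff P m (\<pi> j u \<odot>\<^bsub>?M\<^esub> y j) = t \<odot>\<^bsub>?N\<^esub> e (\<pi> j u \<odot>\<^bsub>?N\<^esub> v j)" .
    qed simp
    also have "\<dots> = t \<odot>\<^bsub>?N\<^esub> e (finsum ?N (\<lambda>j. \<pi> j u \<odot>\<^bsub>?N\<^esub> v j) {..<k})"
      by (rule mod_hom_finsum[OF N N mod_hom_comp[OF e scalar_endo[OF N tR]], symmetric]) (use \<pi>c u v in auto)
    finally show ?thesis using bas[OF u] by simp
  qed
  have tsR: "t \<otimes>\<^bsub>R\<^esub> s \<in> carrier R" using tR sR by simp
  \<comment> \<open>The scalar t s minus h d. Its image consists of cocycles because
    \<open>e\<close> acts as \<open>s\<close> on the cocycle d x, and on cocycles it is the scalar t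
    s because the second term vanishes.\<close>
  define e' where "e' x = (t \<otimes>\<^bsub>R\<^esub> s) \<odot>\<^bsub>?M\<^esub> x \<ominus>\<^bsub>?M\<^esub> h (cx_diff P m x)" for x
  have e': "e' \<in> mod_hom R ?M ?M"
    unfolding e'_def by (rule mod_hom_diff[OF M M scalar_endo[OF M tsR] mod_hom_comp[OF d h]])
  have "cx_diff P m (e' x) = \<zero>\<^bsub>?N\<^esub>" if x: "x \<in> carrier ?M" for x
  proof -
    have dx: "cx_diff P m x \<in> carrier ?N" by (rule mod_homD(1)[OF d x])
    have e2: "m + 1 + 1 = m + 2" by simp
    have "cx_diff P m x \<in> carrier (cocycles P (m + 1))"
      unfolding cocycles_sel e2 using dx is_cpxD(3)[OF P x] by blast
    then have edx: "e (cx_diff P m x) = s \<odot>\<^bsub>?N\<^esub> cx_diff P m x" by (rule es)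
    have "cx_diff P m (e' x) = cx_diff P m ((t \<otimes>\<^bsub>R\<^esub> s) \<odot>\<^bsub>?M\<^esub> x) \<ominus>\<^bsub>?N\<^esub> cx_diff P m (h (cx_diff P m x))"
      unfolding e'_def by (rule mod_hom_minus[OF M N d]) (use tsR x mod_homD(1)[OF h dx] in auto)
    also have "\<dots> = (t \<otimes>\<^bsub>R\<^esub> s) \<odot>\<^bsub>?N\<^esub> cx_diff P m x \<ominus>\<^bsub>?N\<^esub> (t \<otimes>\<^bsub>R\<^esub> s) \<odot>\<^bsub>?N\<^esub> cx_diff P m x"
      using mod_homD(3)[OF d tsR x] dh[OF dx] edx N.smult_assoc1[OF tR sR dx] by simp
    also have "\<dots> = \<zero>\<^bsub>?N\<^esub>" using tsR dx by (simp add: a_minus_def N.M.r_neg)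
    finally show ?thesis .
  qed
  moreover have "e' x = (t \<otimes>\<^bsub>R\<^esub> s) \<odot>\<^bsub>?M\<^esub> x" if "x \<in> carrier (cocycles P m)" for x
    using that mod_hom_zero[OF N M h] tsR unfolding e'_def
    by (simp add: a_minus_def a_inv_zero[OF M.abelian_group_axioms])
  ultimately show ?thesis
    unfolding local_retraction_def using primeidealE(6)[OF p t s] e' by blast
qed

text \<open>The functional below is read off from the action of a local retraction \<open>e\<close> onto the cocycles:
  modulo coboundaries and a maximal possible number of the vectors \<open>e (v\<^sub>j)\<close>, the module of
  cocycles is locally a nonzero cyclic module, so that each \<open>e (v\<^sub>j)\<close> is a multiple of one of them.\<close>

lemma detecting_functional_at:
  assumes p: "primeideal p R" and P: "is_cpx R P" and ff: "fin_free R (cx_mod P a)"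
    and split: "local_retraction R p P a" and nex: "\<not> locally_exact R p P a"
  shows "\<exists>x\<in>carrier (cocycles P a). \<exists>\<alpha>\<in>mod_hom R (cx_mod P a) (ring_mod R).
     (\<forall>b\<in>coboundaries P a. \<alpha> b \<in> p) \<and> \<alpha> x \<notin> p"
proof -
  let ?M = "cx_mod P a" and ?B = "coboundaries P a"
  note M = is_cpxD(1)[OF P, of a]
  interpret M: Module.module R ?M by (rule M)
  note B = coboundaries_submodule[OF P, of a] and rm = ring_mod_is_module[OF M.is_cring]
  obtain s0 e where s0: "s0 \<in> carrier R - p" and e: "e \<in> mod_hom R ?M ?M"
    and eZ: "\<And>x. x \<in> carrier ?M \<Longrightarrow> cx_diff P a (e x) = \<zero>\<^bsub>cx_mod P (a + 1)\<^esub>"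
    and es: "\<And>x. x \<in> carrier (cocycles P a) \<Longrightarrow> e x = s0 \<odot>\<^bsub>?M\<^esub> x"
    using split unfolding local_retraction_def by blast
  obtain k :: nat and v \<pi> where v: "\<And>j. j < k \<Longrightarrow> v j \<in> carrier ?M"
    and \<pi>: "\<And>j. j < k \<Longrightarrow> \<pi> j \<in> mod_hom R ?M (ring_mod R)"
    and bas: "\<And>x. x \<in> carrier ?M \<Longrightarrow> x = finsum ?M (\<lambda>j. \<pi> j x \<odot>\<^bsub>?M\<^esub> v j) {..<k}"
    using fin_free_basis[OF ff] by blast
  \<comment> \<open>These vectors generate the cocycles locally, since \<open>e\<close> is
    \<open>s0\<close> times a projection onto the cocycles and the \<open>v j\<close> generate the
    whole module.\<close>
  define g where "g j = e (v j)" for j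
  have g: "g j \<in> carrier ?M" if "j < k" for j unfolding g_def by (rule mod_homD(1)[OF e v[OF that]])
  have \<pi>c: "\<pi> j u \<in> carrier R" if "j < k" "u \<in> carrier ?M" for j u using mod_homD(1)[OF \<pi>[OF that(1)] that(2)] by simp
  have ex: "e x = finsum ?M (\<lambda>j. \<pi> j x \<odot>\<^bsub>?M\<^esub> g j) {..<k}" if x: "x \<in> carrier ?M" for x
  proof -
    have "e x = e (finsum ?M (\<lambda>j. \<pi> j x \<odot>\<^bsub>?M\<^esub> v j) {..<k})" using bas[OF x] by simp
    also have "\<dots> = finsum ?M (\<lambda>j. e (\<pi> j x \<odot>\<^bsub>?M\<^esub> v j)) {..<k}"
      by (rule mod_hom_finsum[OF M M e]) (use \<pi>c x v in auto)
    also have "\<dots> = finsum ?M (\<lambda>j. \<pi> j x \<odot>\<^bsub>?M\<^esub> g j) {..<k}"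
      by (rule M.M.finsum_cong') (use \<pi>c x v g mod_homD(3)[OF e] in \<open>auto simp: g_def\<close>)
    finally show ?thesis .
  qed
  have sex: "s \<odot>\<^bsub>?M\<^esub> e x = finsum ?M (\<lambda>j. \<pi> j x \<odot>\<^bsub>?M\<^esub> (s \<odot>\<^bsub>?M\<^esub> g j)) {..<k}"
    if x: "x \<in> carrier ?M" and s: "s \<in> carrier R" for x s
  proof -
    have "s \<odot>\<^bsub>?M\<^esub> e x = finsum ?M (\<lambda>j. s \<odot>\<^bsub>?M\<^esub> (\<pi> j x \<odot>\<^bsub>?M\<^esub> g j)) {..<k}"
      unfolding ex[OF x] by (rule M.finsum_smult_ldistr) (use s \<pi>c x g in auto)
    also have "\<dots> = finsum ?M (\<lambda>j. \<pi> j x \<odot>\<^bsub>?M\<^esub> (s \<odot>\<^bsub>?M\<^esub> g j)) {..<k}"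
      by (rule M.M.finsum_cong') (use \<pi>c x g s mod_homD(3)[OF scalar_endo[OF M s]] in auto)
    finally show ?thesis .
  qed
  define S where "S J = submod_gen R ?M (?B \<union> g ` J)" for J
  have gen: "?B \<union> g ` J \<subseteq> carrier ?M" if "J \<subseteq> {..<k}" for J using that g M.submoduleE(1)[OF B] by auto
  have S: "submodule (S J) R ?M" "?B \<union> g ` J \<subseteq> S J" if "J \<subseteq> {..<k}" for J
    unfolding S_def using submod_gen_submodule[OF M gen[OF that]] by auto
  \<comment> \<open>\<open>bad J\<close> says that the coboundaries and the \<open>g j\<close> with
    \<open>j\<close> in \<open>J\<close> do not locally generate the cocycles. For empty
    \<open>J\<close> this is the failure of exactness, while a maximal bad \<open>J\<close> leaves a
    nonzero cyclic quotient generated by one further vector \<open>g i\<close>.\<close>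
  define bad where "bad J \<longleftrightarrow> (\<exists>j<k. \<not> (\<exists>s\<in>carrier R - p. s \<odot>\<^bsub>?M\<^esub> g j \<in> S J))" for J
  have "bad {}"
  proof (rule ccontr)
    assume "\<not> bad {}"
    then have "\<exists>s\<in>carrier R - p. \<forall>j\<in>{..<k}. s \<odot>\<^bsub>?M\<^esub> g j \<in> S {}"
      unfolding bad_def using g by (intro common_denominator[OF p M S(1)]) auto
    moreover have "S {} \<subseteq> ?B" unfolding S_def by (rule submod_gen_least[OF B]) simp
    ultimately obtain s where s: "s \<in> carrier R - p" "\<And>j. j < k \<Longrightarrow> s \<odot>\<^bsub>?M\<^esub> g j \<in> ?B" by blast
    have sR: "s \<in> carrier R" "s0 \<in> carrier R" using s s0 by auto
    have "locally_exact R p P a"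
      unfolding locally_exact_cocycles
    proof
      fix x assume x: "x \<in> carrier (cocycles P a)"
      then have xM: "x \<in> carrier ?M" by simp
      have "s \<odot>\<^bsub>?M\<^esub> e x \<in> ?B"
        unfolding sex[OF xM sR(1)]
        by (rule finsum_submodule[OF M B]) (use s(2) \<pi>c xM M.submoduleE(4)[OF B] in auto)
      then have "(s \<otimes>\<^bsub>R\<^esub> s0) \<odot>\<^bsub>?M\<^esub> x \<in> ?B" using es[OF x] sR xM by (simp add: M.smult_assoc1)
      then show "\<exists>s\<in>carrier R - p. s \<odot>\<^bsub>?M\<^esub> x \<in> ?B" using primeidealE(6)[OF p s(1) s0] by blast
    qed
    then show False using nex by contradiction
  qed
  then have "{} \<in> {J\<in>Pow {..<k}. bad J}" by simp
  moreover have "finite {J\<in>Pow {..<k}. bad J}" by simp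
  ultimately obtain J where J': "J \<in> {J\<in>Pow {..<k}. bad J}"
    and Jm: "\<forall>J'\<in>{J\<in>Pow {..<k}. bad J}. J \<subseteq> J' \<longrightarrow> J = J'"
    by (meson finite_has_maximal2)
  have J: "J \<subseteq> {..<k}" "bad J" using J' by auto
  have Jmax: "J = J'" if "J' \<subseteq> {..<k}" "bad J'" "J \<subseteq> J'" for J'
    using Jm that by (metis (mono_tags, lifting) PowI mem_Collect_eq)
  obtain i where i: "i < k" and ni: "\<And>s. s \<in> carrier R - p \<Longrightarrow> s \<odot>\<^bsub>?M\<^esub> g i \<notin> S J"
    using J(2) unfolding bad_def by blast
  note SJ = S(1)[OF J(1)] and SJ' = S(2)[OF J(1)]
  have scal: "r \<in> p" if "r \<in> carrier R" "r \<odot>\<^bsub>?M\<^esub> g i \<in> S J" for r using ni that by blast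
  have "\<one>\<^bsub>R\<^esub> \<odot>\<^bsub>?M\<^esub> g i \<notin> S J" using ni primeidealE(3)[OF p] by simp
  then have "i \<notin> J" using SJ' g[OF i] by auto
  let ?J = "insert i J"
  have J': "?J \<subseteq> {..<k}" using J i by auto
  have "\<not> bad ?J" using Jmax[OF J'] \<open>i \<notin> J\<close> by blast
  then have "\<exists>s\<in>carrier R - p. \<forall>j\<in>{..<k}. s \<odot>\<^bsub>?M\<^esub> g j \<in> S ?J"
    unfolding bad_def using g by (intro common_denominator[OF p M S(1)[OF J']]) auto
  moreover have "S ?J \<subseteq> {y \<oplus>\<^bsub>?M\<^esub> r \<odot>\<^bsub>?M\<^esub> g i |y r. y \<in> S J \<and> r \<in> carrier R}" (is "_ \<subseteq> ?T")
    unfolding S_def[of ?J]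
  proof (rule submod_gen_least[OF submodule_add_cyclic[OF M SJ g[OF i]]])
    have "y \<in> ?T" if y: "y \<in> S J" for y
    proof -
      have "y = y \<oplus>\<^bsub>?M\<^esub> \<zero>\<^bsub>R\<^esub> \<odot>\<^bsub>?M\<^esub> g i" using g[OF i] y M.submoduleE(1)[OF SJ] by auto
      then show ?thesis using y M.R.zero_closed by blast
    qed
    moreover have "g i \<in> ?T"
    proof -
      have "g i = \<zero>\<^bsub>?M\<^esub> \<oplus>\<^bsub>?M\<^esub> \<one>\<^bsub>R\<^esub> \<odot>\<^bsub>?M\<^esub> g i" using g[OF i] by simp
      then show ?thesis using submodule_zero[OF M SJ] M.R.one_closed by blast
    qed
    ultimately show "?B \<union> g ` ?J \<subseteq> ?T" using SJ' by auto
  qed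
  ultimately obtain s where s: "s \<in> carrier R - p"
    and "\<forall>j<k. \<exists>y r. s \<odot>\<^bsub>?M\<^esub> g j = y \<oplus>\<^bsub>?M\<^esub> r \<odot>\<^bsub>?M\<^esub> g i \<and> y \<in> S J \<and> r \<in> carrier R" by blast
  then obtain y c where sg: "\<And>j. j < k \<Longrightarrow> s \<odot>\<^bsub>?M\<^esub> g j = y j \<oplus>\<^bsub>?M\<^esub> c j \<odot>\<^bsub>?M\<^esub> g i"
    and y: "\<And>j. j < k \<Longrightarrow> y j \<in> S J" and c: "\<And>j. j < k \<Longrightarrow> c j \<in> carrier R" by metis
  have sR: "s \<in> carrier R" "s0 \<in> carrier R" using s s0 by auto
  have yM: "y j \<in> carrier ?M" if "j < k" for j using y[OF that] M.submoduleE(1)[OF SJ] by auto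
  \<comment> \<open>Modulo \<open>S J\<close>, the vector \<open>s \<odot> g j\<close> is the
    multiple of \<open>g i\<close> by \<open>c j\<close>; \<alpha> extends these coefficients
    linearly, so that s e(x) is congruent to \<alpha>(x) times \<open>g i\<close>. Because
    \<open>e\<close> is defined on the whole module and not only on cocycles, so is
    \<alpha>.\<close>
  define \<alpha> where "\<alpha> x = finsum (ring_mod R) (\<lambda>j. \<pi> j x \<otimes>\<^bsub>R\<^esub> c j) {..<k}" for x
  have \<alpha>: "\<alpha> \<in> mod_hom R ?M (ring_mod R)"
    unfolding \<alpha>_def
  proof (rule mod_hom_sum[OF M rm])
    fix j assume "j \<in> {..<k}"
    then have j: "j < k" by simp
    have "(\<lambda>r. r \<odot>\<^bsub>ring_mod R\<^esub> c j) \<in> mod_hom R (ring_mod R) (ring_mod R)"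
      by (rule scalar_hom[OF rm]) (simp add: c[OF j])
    from mod_hom_comp[OF \<pi>[OF j] this]
    show "(\<lambda>x. \<pi> j x \<otimes>\<^bsub>R\<^esub> c j) \<in> mod_hom R ?M (ring_mod R)" by simp
  qed simp
  have key: "\<exists>Y\<in>S J. s \<odot>\<^bsub>?M\<^esub> e x = Y \<oplus>\<^bsub>?M\<^esub> \<alpha> x \<odot>\<^bsub>?M\<^esub> g i" if x: "x \<in> carrier ?M" for x
  proof -
    have "s \<odot>\<^bsub>?M\<^esub> e x = finsum ?M (\<lambda>j. \<pi> j x \<odot>\<^bsub>?M\<^esub> y j \<oplus>\<^bsub>?M\<^esub> (\<pi> j x \<otimes>\<^bsub>R\<^esub> c j) \<odot>\<^bsub>?M\<^esub> g i) {..<k}"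
      unfolding sex[OF x sR(1)]
      by (rule M.M.finsum_cong')
        (use \<pi>c x yM c g[OF i] sg in \<open>auto simp: M.smult_r_distr M.smult_assoc1\<close>)
    also have "\<dots> = finsum ?M (\<lambda>j. \<pi> j x \<odot>\<^bsub>?M\<^esub> y j) {..<k} \<oplus>\<^bsub>?M\<^esub>
        finsum ?M (\<lambda>j. (\<pi> j x \<otimes>\<^bsub>R\<^esub> c j) \<odot>\<^bsub>?M\<^esub> g i) {..<k}"
      by (rule M.M.finsum_addf) (use \<pi>c x yM c g[OF i] in auto)
    also have "finsum ?M (\<lambda>j. (\<pi> j x \<otimes>\<^bsub>R\<^esub> c j) \<odot>\<^bsub>?M\<^esub> g i) {..<k} = \<alpha> x \<odot>\<^bsub>?M\<^esub> g i"
      unfolding \<alpha>_def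
      by (rule mod_hom_finsum[OF rm M scalar_hom[OF M g[OF i]], symmetric]) (use \<pi>c x c in auto)
    finally show ?thesis
      by (rule bexI) (rule finsum_submodule[OF M SJ], use y \<pi>c x M.submoduleE(4)[OF SJ] in auto)
  qed
  have \<alpha>c: "\<alpha> x \<in> carrier R" if "x \<in> carrier ?M" for x using mod_homD(1)[OF \<alpha> that] by simp
  have cancel: "w \<in> S J" if "Y \<in> S J" "z \<in> S J" "z = Y \<oplus>\<^bsub>?M\<^esub> w" "w \<in> carrier ?M" for Y z w
  proof -
    have Y: "Y \<in> carrier ?M" using that M.submoduleE(1)[OF SJ] by auto
    have "w = \<ominus>\<^bsub>?M\<^esub> Y \<oplus>\<^bsub>?M\<^esub> z" unfolding that(3) using Y that(4) by (simp add: M.M.r_neg1)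
    then show ?thesis using M.submoduleE(5)[OF SJ M.submoduleE(3)[OF SJ that(1)] that(2)] by simp
  qed
  \<comment> \<open>\<open>S J\<close> contains the coboundaries, so it contains s e(b) and
    therefore \<alpha>(b) times \<open>g i\<close>. Scalars that move \<open>g i\<close> into
    \<open>S J\<close> are in \<open>p\<close>, by the choice of \<open>i\<close>.\<close>
  have "\<alpha> b \<in> p" if b: "b \<in> ?B" for b
  proof -
    have bM: "b \<in> carrier ?M" and bZ: "b \<in> carrier (cocycles P a)" using coboundary_cocycle[OF P b] by auto
    have sb: "s \<odot>\<^bsub>?M\<^esub> e b \<in> S J"
      unfolding es[OF bZ] using b SJ' sR by (intro M.submoduleE(4)[OF SJ]) auto
    obtain Y where Y: "Y \<in> S J" "s \<odot>\<^bsub>?M\<^esub> e b = Y \<oplus>\<^bsub>?M\<^esub> \<alpha> b \<odot>\<^bsub>?M\<^esub> g i"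
      using key[OF bM] by (rule bexE)
    have "\<alpha> b \<odot>\<^bsub>?M\<^esub> g i \<in> S J"
      by (rule cancel[OF Y(1) sb Y(2) M.smult_closed[OF \<alpha>c[OF bM] g[OF i]]])
    then show ?thesis by (rule scal[OF \<alpha>c[OF bM]])
  qed
  moreover have gZ: "g i \<in> carrier (cocycles P a)" unfolding g_def using eZ v[OF i] g[OF i] by (simp add: g_def)
  moreover have "\<alpha> (g i) \<notin> p"
  proof
    assume *: "\<alpha> (g i) \<in> p"
    obtain Y where Y: "Y \<in> S J" "s \<odot>\<^bsub>?M\<^esub> (s0 \<odot>\<^bsub>?M\<^esub> g i) = Y \<oplus>\<^bsub>?M\<^esub> \<alpha> (g i) \<odot>\<^bsub>?M\<^esub> g i"
      using key[OF g[OF i]] unfolding es[OF gZ] by (rule bexE)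
    have Yc: "Y \<in> carrier ?M" using Y M.submoduleE(1)[OF SJ] by auto
    \<comment> \<open>\<open>g i\<close> is a cocycle, so \<open>e\<close> multiplies it by
      \<open>s0\<close>. The scalars s s0 and \<alpha>(g i) thus agree modulo \<open>p\<close>, and
      the first one is outside \<open>p\<close>.\<close>
    have "(s \<otimes>\<^bsub>R\<^esub> s0 \<ominus>\<^bsub>R\<^esub> \<alpha> (g i)) \<odot>\<^bsub>?M\<^esub> g i = s \<odot>\<^bsub>?M\<^esub> (s0 \<odot>\<^bsub>?M\<^esub> g i) \<ominus>\<^bsub>?M\<^esub> \<alpha> (g i) \<odot>\<^bsub>?M\<^esub> g i"
      using sR \<alpha>c[OF g[OF i]] g[OF i]
      by (simp add: a_minus_def M.smult_l_distr M.smult_l_minus M.smult_assoc1)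
    also have "\<dots> = Y" unfolding Y(2) using Yc \<alpha>c[OF g[OF i]] g[OF i] by (simp add: a_minus_def M.M.a_assoc M.M.r_neg)
    finally have "s \<otimes>\<^bsub>R\<^esub> s0 \<ominus>\<^bsub>R\<^esub> \<alpha> (g i) \<in> p" using Y(1) sR \<alpha>c[OF g[OF i]] by (intro scal) auto
    then have "(s \<otimes>\<^bsub>R\<^esub> s0 \<ominus>\<^bsub>R\<^esub> \<alpha> (g i)) \<oplus>\<^bsub>R\<^esub> \<alpha> (g i) \<in> p"
      by (rule M.R.idealE(3)[OF primeidealE(1)[OF p] _ *])
    then have "s \<otimes>\<^bsub>R\<^esub> s0 \<in> p" using sR \<alpha>c[OF g[OF i]] by (simp add: a_minus_def M.R.a_assoc M.R.l_neg)
    then show False using primeidealE(6)[OF p s s0] by simp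
  qed
  ultimately show ?thesis using \<alpha> by blast
qed

text \<open>The functional lives in the highest degree where local exactness fails. Above
  \<open>N\<close> the modules vanish and a local retraction is trivial; exactness in the degrees in
  between carries it down to the critical one.\<close>

lemma detecting_functional:
  assumes p: "primeideal p R" and P: "is_cpx R P" and ff: "\<And>n. fin_free R (cx_mod P n)"
    and N: "\<And>n. n > N \<Longrightarrow> carrier (cx_mod P n) = {\<zero>\<^bsub>cx_mod P n\<^esub>}"
    and nac: "\<not> locally_acyclic R p P"
  obtains a x \<alpha> where "x \<in> carrier (cocycles P a)" "\<alpha> \<in> mod_hom R (cx_mod P a) (ring_mod R)"
    "\<And>b. b \<in> coboundaries P a \<Longrightarrow> \<alpha> b \<in> p" "\<alpha> x \<notin> p"
proof -
  have one: "\<one>\<^bsub>R\<^esub> \<in> carrier R - p"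
  proof -
    interpret primeideal p R by (rule p)
    show ?thesis using primeidealE(3)[OF p] by simp
  qed
  have triv: "locally_exact R p P n \<and> local_retraction R p P n" if n: "n > N" for n
  proof -
    interpret M: Module.module R "cx_mod P n" by (rule is_cpxD(1)[OF P])
    have x0: "x = \<zero>\<^bsub>cx_mod P n\<^esub>" if "x \<in> carrier (cx_mod P n)" for x using N[OF n] that by blast
    have d0: "cx_diff P n \<zero>\<^bsub>cx_mod P n\<^esub> = \<zero>\<^bsub>cx_mod P (n + 1)\<^esub>"
      by (rule mod_hom_zero[OF is_cpxD(1)[OF P] is_cpxD(1)[OF P] is_cpxD(2)[OF P]])
    have "locally_exact R p P n"
      unfolding locally_exact_def
      using one x0 submodule_zero[OF is_cpxD(1)[OF P] coboundaries_submodule[OF P]] by (metis M.smult_one)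
    moreover have "local_retraction R p P n"
      unfolding local_retraction_def
    proof (intro bexI conjI ballI)
      show "cx_diff P n x = \<zero>\<^bsub>cx_mod P (n + 1)\<^esub>" if "x \<in> carrier (cx_mod P n)" for x
        using d0 x0[OF that] by simp
      show "x = \<one>\<^bsub>R\<^esub> \<odot>\<^bsub>cx_mod P n\<^esub> x" if "x \<in> carrier (cocycles P n)" for x using that by simp
    qed (use one mod_hom_id in auto)
    ultimately show ?thesis ..
  qed
  obtain m where m: "\<not> locally_exact R p P m" using nac by (auto simp: locally_acyclic_def)
  then have "m \<le> N" using triv by (meson not_le)
  then have "\<not> locally_exact R p P (N - int (nat (N - m)))" using m by simp
  \<comment> \<open>Degrees are counted downwards from \<open>N\<close>, so that the least
    \<open>l\<close> belongs to the highest degree in which exactness fails.\<close>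
  then obtain l where l: "\<not> locally_exact R p P (N - int l)"
    and lmin: "\<And>l'. l' < l \<Longrightarrow> locally_exact R p P (N - int l')"
    using exists_least_iff[of "\<lambda>l. \<not> locally_exact R p P (N - int l)"] by blast
  have "local_retraction R p P (N - int l')" if "l' \<le> l" for l'
    using that
  proof (induction l')
    case 0
    have "local_retraction R p P (N + 1) \<and> locally_exact R p P (N + 1)" using triv[of "N + 1"] by simp
    then show ?case using local_retraction_step[OF p P ff, of N] by simp
  next
    case (Suc l')
    have e: "N - int (Suc l') + 1 = N - int l'" by simp
    show ?case
      by (rule local_retraction_step[OF p P ff]; unfold e) (use Suc lmin in auto)
  qed
  from detecting_functional_at[OF p P ff this[OF order_refl] l] show thesis using that by blast
qed

section \<open>Total tensor products\<close>

lemma dsum_module_sel: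
  "z \<in> carrier (dsum_module M) \<longleftrightarrow> finite {i. z i \<noteq> \<zero>\<^bsub>M i\<^esub>} \<and> (\<forall>i. z i \<in> carrier (M i))"
  "\<zero>\<^bsub>dsum_module M\<^esub> = (\<lambda>i. \<zero>\<^bsub>M i\<^esub>)"
  "z \<oplus>\<^bsub>dsum_module M\<^esub> w = (\<lambda>i. z i \<oplus>\<^bsub>M i\<^esub> w i)"
  "a \<odot>\<^bsub>dsum_module M\<^esub> z = (\<lambda>i. a \<odot>\<^bsub>M i\<^esub> z i)"
  by (simp_all add: dsum_module_def)

lemma dsum_module_proj: "(\<lambda>z. z i) \<in> mod_hom R (dsum_module M) (M i)"
  by (rule mod_homI) (auto simp: dsum_module_sel)

lemma dsum_module_minus:
  assumes M: "\<And>i. Module.module R (M i)" and R: "cring R"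
    and z: "z \<in> carrier (dsum_module M)" and w: "w \<in> carrier (dsum_module M)"
  shows "(z \<ominus>\<^bsub>dsum_module M\<^esub> w) i = z i \<ominus>\<^bsub>M i\<^esub> w i"
  by (rule mod_hom_minus[OF dsum_module_is_module[OF M R] M dsum_module_proj z w])

lemma mod_hom_into_dsum:
  assumes f: "\<And>i. (\<lambda>z. f z i) \<in> mod_hom R L (M i)"
    and fin: "\<And>z. z \<in> carrier L \<Longrightarrow> finite {i. f z i \<noteq> \<zero>\<^bsub>M i\<^esub>}"
  shows "f \<in> mod_hom R L (dsum_module M)"
  by (rule mod_homI) (auto simp: dsum_module_sel fin mod_homD[OF f])

lemma mod_hom_add:
  assumes L: "Module.module R L" and f: "f \<in> mod_hom R M L" and g: "g \<in> mod_hom R M L"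
  shows "(\<lambda>x. f x \<oplus>\<^bsub>L\<^esub> g x) \<in> mod_hom R M L"
proof -
  interpret L: Module.module R L by fact
  show ?thesis
    by (rule mod_homI) (auto simp: mod_homD[OF f] mod_homD[OF g] L.M.a_ac L.smult_r_distr)
qed

lemma mod_hom_sign:
  assumes L: "Module.module R L" and f: "f \<in> mod_hom R M L"
  shows "(\<lambda>x. if c then f x else \<ominus>\<^bsub>L\<^esub> f x) \<in> mod_hom R M L"
proof -
  interpret L: Module.module R L by fact
  show ?thesis
    by (rule mod_homI) (auto simp: mod_homD[OF f] L.M.minus_add L.smult_r_minus)
qed

lemma dsum_single:
  assumes M: "\<And>i. Module.module R (M i)" and t: "t \<in> carrier (M j)"
  shows "(\<lambda>i. if i = j then t else \<zero>\<^bsub>M i\<^esub>) \<in> carrier (dsum_module M)"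
proof -
  have "\<zero>\<^bsub>M i\<^esub> \<in> carrier (M i)" for i
  proof -
    interpret Module.module R "M i" by (rule M)
    show ?thesis by (rule M.zero_closed)
  qed
  moreover have "finite {i. (if i = j then t else \<zero>\<^bsub>M i\<^esub>) \<noteq> \<zero>\<^bsub>M i\<^esub>}"
    by (rule finite_subset[of _ "{j}"]) auto
  ultimately show ?thesis using t by (auto simp: dsum_module_sel)
qed

lemma tensor_trivial:
  assumes M: "Module.module R M" and N: "Module.module R N" and M0: "carrier M = {\<zero>\<^bsub>M\<^esub>}"
    and t: "t \<in> carrier (tensor_module R M N)"
  shows "t = \<zero>\<^bsub>tensor_module R M N\<^esub>"
proof -
  note T = tensor_module_is_module[OF M N]
  interpret T: Module.module R "tensor_module R M N" by (rule T)
  have 0: "(\<lambda>t. \<zero>\<^bsub>tensor_module R M N\<^esub>) \<in> mod_hom R (tensor_module R M N) (tensor_module R M N)"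
    by (rule mod_homI) auto
  show ?thesis
  proof (rule tensor_hom_eqI[OF M N T mod_hom_id 0 _ t])
    fix x y assume "x \<in> carrier M" and y: "y \<in> carrier N"
    then show "tens R M N x y = \<zero>\<^bsub>tensor_module R M N\<^esub>"
      using mod_hom_zero[OF M T tens_hom_left[OF M N y]] M0 by auto
  qed
qed

text \<open>Modulo \<open>S\<close> the quotient projection and the zero map agree on pure tensors,
  hence everywhere.\<close>

lemma tensor_span:
  assumes M: "Module.module R M" and N: "Module.module R N" and S: "submodule S R (tensor_module R M N)"
    and gen: "\<And>x y. \<lbrakk>x \<in> carrier M; y \<in> carrier N\<rbrakk> \<Longrightarrow> tens R M N x y \<in> S"
    and t: "t \<in> carrier (tensor_module R M N)"
  shows "t \<in> S"
proof -
  note T = tensor_module_is_module[OF M N]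
  let ?Q = "quot_module (tensor_module R M N) S"
  note Q = quot_is_module[OF T S]
  interpret Q: Module.module R ?Q by (rule Q)
  have 0: "(\<lambda>t. \<zero>\<^bsub>?Q\<^esub>) \<in> mod_hom R (tensor_module R M N) ?Q" by (rule mod_homI) auto
  have "S +>\<^bsub>tensor_module R M N\<^esub> t = \<zero>\<^bsub>?Q\<^esub>"
    by (rule tensor_hom_eqI[OF M N Q quot_proj_hom[OF T S] 0 _ t])
      (use quot_eq_zero_iff[OF T S] tens_closed[OF M N] gen in blast)
  then show ?thesis using quot_eq_zero_iff[OF T S t] by simp
qed

section \<open>Differentials of the total complex\<close>

context
  fixes R :: "('a, 'r) ring_scheme" and P :: "('a, 'b) cpx" and Q :: "('a, 'c) cpx"
  assumes P: "is_cpx R P" and Q: "is_cpx R Q"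
begin

abbreviation (input) "TT i n \<equiv> tensor_module R (cx_mod P i) (cx_mod Q (n - i))"
abbreviation (input) "UU i n \<equiv> tensor_map R (cx_mod P i) (cx_mod Q (n + 1 - i)) (cx_diff P (i - 1)) (\<lambda>y. y)"
abbreviation (input) "VV i n \<equiv> tensor_map R (cx_mod P i) (cx_mod Q (n + 1 - i)) (\<lambda>x. x) (cx_diff Q (n - i))"

lemma tot_cring: "cring R"
proof -
  interpret Module.module R "cx_mod P 0" by (rule is_cpxD(1)[OF P])
  show ?thesis by (rule is_cring)
qed

lemma TT_module: "Module.module R (TT i n)"
  by (intro tensor_module_is_module is_cpxD(1)[OF P] is_cpxD(1)[OF Q])

lemma UU_hom: "UU i n \<in> mod_hom R (TT (i - 1) n) (TT i (n + 1))"
proof -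
  have e: "n - (i - 1) = n + 1 - i" by simp
  show ?thesis unfolding e
    by (rule tensor_map_hom[OF is_cpxD(1)[OF P] is_cpxD(1)[OF Q] is_cpxD(1)[OF P] is_cpxD(1)[OF Q] is_cpxD(4)[OF P] mod_hom_id])
qed

lemma UU_tens:
  "\<lbrakk>x \<in> carrier (cx_mod P (i - 1)); y \<in> carrier (cx_mod Q (n + 1 - i))\<rbrakk> \<Longrightarrow>
    UU i n (tens R (cx_mod P (i - 1)) (cx_mod Q (n + 1 - i)) x y) =
      tens R (cx_mod P i) (cx_mod Q (n + 1 - i)) (cx_diff P (i - 1) x) y"
  by (rule tensor_map_tens[OF is_cpxD(1)[OF P] is_cpxD(1)[OF Q] is_cpxD(1)[OF P] is_cpxD(1)[OF Q] is_cpxD(4)[OF P] mod_hom_id])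

lemma diff_shift: "cx_diff Q (n - i) \<in> mod_hom R (cx_mod Q (n - i)) (cx_mod Q (n + 1 - i))"
proof -
  have e: "n - i + 1 = n + 1 - i" by simp
  show ?thesis using is_cpxD(2)[OF Q, of "n - i"] unfolding e .
qed

lemma VV_hom: "VV i n \<in> mod_hom R (TT i n) (TT i (n + 1))"
  by (rule tensor_map_hom[OF is_cpxD(1)[OF P] is_cpxD(1)[OF Q] is_cpxD(1)[OF P] is_cpxD(1)[OF Q] mod_hom_id diff_shift])

lemma VV_tens:
  "\<lbrakk>x \<in> carrier (cx_mod P i); y \<in> carrier (cx_mod Q (n - i))\<rbrakk> \<Longrightarrow>
    VV i n (tens R (cx_mod P i) (cx_mod Q (n - i)) x y) =
      tens R (cx_mod P i) (cx_mod Q (n + 1 - i)) x (cx_diff Q (n - i) y)"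
  by (rule tensor_map_tens[OF is_cpxD(1)[OF P] is_cpxD(1)[OF Q] is_cpxD(1)[OF P] is_cpxD(1)[OF Q] mod_hom_id diff_shift])

lemma tot_sel:
  "cx_mod (tot_tensor R P Q) n = dsum_module (\<lambda>i. TT i n)"
  "cx_diff (tot_tensor R P Q) n z i = UU i n (z (i - 1)) \<oplus>\<^bsub>TT i (n + 1)\<^esub>
     (if even i then VV i n (z i) else \<ominus>\<^bsub>TT i (n + 1)\<^esub> VV i n (z i))"
  by (simp_all add: tot_tensor_def Let_def)

lemma tot_module: "Module.module R (cx_mod (tot_tensor R P Q) n)"
  unfolding tot_sel by (rule dsum_module_is_module[OF TT_module tot_cring])

lemma UU_zero: "UU i n \<zero>\<^bsub>TT (i - 1) n\<^esub> = \<zero>\<^bsub>TT i (n + 1)\<^esub>"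
  by (rule mod_hom_zero[OF TT_module TT_module UU_hom])

lemma VV_zero: "VV i n \<zero>\<^bsub>TT i n\<^esub> = \<zero>\<^bsub>TT i (n + 1)\<^esub>"
  by (rule mod_hom_zero[OF TT_module TT_module VV_hom])

lemma tot_diff_zero:
  assumes "z (i - 1) = \<zero>\<^bsub>TT (i - 1) n\<^esub>" "z i = \<zero>\<^bsub>TT i n\<^esub>"
  shows "cx_diff (tot_tensor R P Q) n z i = \<zero>\<^bsub>TT i (n + 1)\<^esub>"
proof -
  interpret Module.module R "TT i (n + 1)" by (rule TT_module)
  show ?thesis
    unfolding tot_sel assms UU_zero VV_zero by (simp add: a_inv_zero[OF abelian_group_axioms])
qed

lemma tot_diff_hom:
  "cx_diff (tot_tensor R P Q) n \<in> mod_hom R (cx_mod (tot_tensor R P Q) n) (cx_mod (tot_tensor R P Q) (n + 1))"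
  unfolding tot_sel(1)
proof (rule mod_hom_into_dsum)
  let ?D = "dsum_module (\<lambda>i. TT i n)"
  fix i
  have pU: "(\<lambda>z. UU i n (z (i - 1))) \<in> mod_hom R ?D (TT i (n + 1))"
    using mod_hom_comp[OF dsum_module_proj[of "i - 1" R "\<lambda>i. TT i n"] UU_hom] .
  have pV: "(\<lambda>z. VV i n (z i)) \<in> mod_hom R ?D (TT i (n + 1))"
    using mod_hom_comp[OF dsum_module_proj[of i R "\<lambda>i. TT i n"] VV_hom] .
  show "(\<lambda>z. cx_diff (tot_tensor R P Q) n z i) \<in> mod_hom R ?D (TT i (n + 1))"
    unfolding tot_sel(2) by (rule mod_hom_add[OF TT_module pU mod_hom_sign[OF TT_module pV]])
next
  fix z assume z: "z \<in> carrier (dsum_module (\<lambda>i. TT i n))"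
  let ?A = "{i. z i \<noteq> \<zero>\<^bsub>TT i n\<^esub>}"
  have "finite (?A \<union> (\<lambda>i. i + 1) ` ?A)" using z by (simp add: dsum_module_sel)
  moreover have "{i. cx_diff (tot_tensor R P Q) n z i \<noteq> \<zero>\<^bsub>TT i (n + 1)\<^esub>} \<subseteq> ?A \<union> (\<lambda>i. i + 1) ` ?A"
  proof
    fix i assume i: "i \<in> {i. cx_diff (tot_tensor R P Q) n z i \<noteq> \<zero>\<^bsub>TT i (n + 1)\<^esub>}"
    then have "z (i - 1) \<noteq> \<zero>\<^bsub>TT (i - 1) n\<^esub> \<or> z i \<noteq> \<zero>\<^bsub>TT i n\<^esub>" using tot_diff_zero[of z i n] by blast
    then show "i \<in> ?A \<union> (\<lambda>i. i + 1) ` ?A"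
      by (auto intro: image_eqI[of i "\<lambda>i. i + 1" "i - 1"])
  qed
  ultimately show "finite {i. cx_diff (tot_tensor R P Q) n z i \<noteq> \<zero>\<^bsub>TT i (n + 1)\<^esub>}"
    by (rule finite_subset[rotated])
qed

text \<open>d d = 0 is pulled back from \<open>Z\<close> along the injective maps
  \<open>\<phi> n\<close>; this takes the place of the sign computation with d \<otimes> 1 and 1
  \<otimes> d.\<close>

lemma tot_is_cpx:
  assumes Z: "is_cpx R Z" and iso: "cpx_iso R (tot_tensor R P Q) Z \<phi>"
  shows "is_cpx R (tot_tensor R P Q)"
proof -
  let ?X = "tot_tensor R P Q"
  have ch: "chain_map R ?X Z \<phi>" and mi: "\<phi> n \<in> mod_iso R (cx_mod ?X n) (cx_mod Z n)" for n
    using iso by (auto simp: cpx_iso_def)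
  have "cx_diff ?X (n + 1) (cx_diff ?X n x) = \<zero>\<^bsub>cx_mod ?X (n + 2)\<^esub>" if x: "x \<in> carrier (cx_mod ?X n)" for n x
  proof -
    interpret X: Module.module R "cx_mod ?X (n + 2)" by (rule tot_module)
    have e: "n + 1 + 1 = n + 2" by simp
    have dx: "cx_diff ?X n x \<in> carrier (cx_mod ?X (n + 1))" by (rule mod_homD(1)[OF tot_diff_hom x])
    have ddx: "cx_diff ?X (n + 1) (cx_diff ?X n x) \<in> carrier (cx_mod ?X (n + 2))"
      using mod_homD(1)[OF tot_diff_hom dx] unfolding e .
    have "\<phi> (n + 2) (cx_diff ?X (n + 1) (cx_diff ?X n x)) = cx_diff Z (n + 1) (cx_diff Z n (\<phi> n x))"
      using chain_mapD(2)[OF ch dx] chain_mapD(2)[OF ch x] unfolding e by simp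
    also have "\<dots> = \<zero>\<^bsub>cx_mod Z (n + 2)\<^esub>" by (rule is_cpxD(3)[OF Z mod_homD(1)[OF mod_isoD(1)[OF mi] x]])
    also have "\<dots> = \<phi> (n + 2) \<zero>\<^bsub>cx_mod ?X (n + 2)\<^esub>"
      by (rule mod_hom_zero[OF tot_module is_cpxD(1)[OF Z] mod_isoD(1)[OF mi], symmetric])
    finally show ?thesis using inj_on_eq_iff[OF mod_isoD(2)[OF mi] ddx X.M.zero_closed] by simp
  qed
  then show ?thesis unfolding is_cpx_def using tot_module tot_diff_hom by blast
qed

text \<open>If \<open>Q\<close> is locally acyclic, a cocycle of the total complex whose components vanish below
  \<open>i\<^sub>0\<close> is moved, by a coboundary, to one whose components vanish below \<open>i\<^sub>0 + 1\<close>.\<close>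

lemma tot_locally_acyclic:
  assumes p: "primeideal p R" and ff: "\<And>n. fin_free R (cx_mod P n)"
    and N: "\<And>n. n > N \<Longrightarrow> carrier (cx_mod P n) = {\<zero>\<^bsub>cx_mod P n\<^esub>}"
    and L: "locally_acyclic R p Q" and X: "is_cpx R (tot_tensor R P Q)"
  shows "locally_acyclic R p (tot_tensor R P Q)"
proof -
  let ?X = "tot_tensor R P Q"
  interpret R: cring R by (rule tot_cring)
  have T0: "Module.module R (TT i n)" for i n by (rule TT_module)
  \<comment> \<open>Increasing \<open>k\<close> weakens the vanishing assumption. For
    \<open>k\<close> = 0 the components up to \<open>N\<close> vanish by assumption and the others
    because P^i is zero above \<open>N\<close>; the induction step clears the lowest possible
    component \<open>j\<close>.\<close>
  have main: "\<exists>s\<in>carrier R - p. s \<odot>\<^bsub>cx_mod ?X n\<^esub> z \<in> coboundaries ?X n"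
    if "z \<in> carrier (cocycles ?X n)" "\<And>i. i < N + 1 - int k \<Longrightarrow> z i = \<zero>\<^bsub>TT i n\<^esub>" for z n k
    using that
  proof (induction k arbitrary: z)
    case 0
    interpret X: Module.module R "cx_mod ?X n" by (rule tot_module)
    have z: "z \<in> carrier (cx_mod ?X n)" using 0(1) by simp
    have "z i = \<zero>\<^bsub>TT i n\<^esub>" for i
    proof (cases "i < N + 1")
      case True then show ?thesis using 0(2)[of i] by simp
    next
      case False
      moreover have "z i \<in> carrier (TT i n)" using z by (simp add: tot_sel dsum_module_sel)
      ultimately show ?thesis using tensor_trivial[OF is_cpxD(1)[OF P] is_cpxD(1)[OF Q] N[of i]] by simp
    qed
    then have "z = \<zero>\<^bsub>cx_mod ?X n\<^esub>" by (auto simp: tot_sel dsum_module_sel)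
    then have "\<one>\<^bsub>R\<^esub> \<odot>\<^bsub>cx_mod ?X n\<^esub> z \<in> coboundaries ?X n"
      using submodule_zero[OF tot_module coboundaries_submodule[OF X]] by simp
    then show ?case using primeidealE(3)[OF p] by blast
  next
    case (Suc k)
    interpret X: Module.module R "cx_mod ?X n" by (rule tot_module)
    define j where "j = N + 1 - int (Suc k)"
    have z: "z \<in> carrier (cx_mod ?X n)" and dz: "cx_diff ?X n z = \<zero>\<^bsub>cx_mod ?X (n + 1)\<^esub>" using Suc.prems(1) by auto
    have zlow: "z i = \<zero>\<^bsub>TT i n\<^esub>" if "i < j" for i using Suc.prems(2) that unfolding j_def by blast
    have zj: "z j \<in> carrier (TT j n)" using z by (simp add: tot_sel dsum_module_sel)
    interpret T: Module.module R "TT j n" by (rule T0)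
    interpret T1: Module.module R "TT j (n + 1)" by (rule T0)
    have e: "n - j + 1 = n + 1 - j" "n - 1 + 1 = n" "n - j - 1 = n - 1 - j" by auto
    \<comment> \<open>The component of \<open>z\<close> below \<open>j\<close> vanishes, so the j-th
      component of the cocycle condition involves \<open>z j\<close> alone: it is a cocycle of the
      complex P^j \<otimes> Q.\<close>
    have "UU j n (z (j - 1)) = \<zero>\<^bsub>TT j (n + 1)\<^esub>" using zlow[of "j - 1"] UU_zero by simp
    moreover have "cx_diff ?X n z j = \<zero>\<^bsub>TT j (n + 1)\<^esub>" unfolding dz by (simp add: tot_sel dsum_module_sel)
    moreover have Vz: "VV j n (z j) \<in> carrier (TT j (n + 1))" by (rule mod_homD(1)[OF VV_hom zj])
    ultimately have V0: "VV j n (z j) = \<zero>\<^bsub>TT j (n + 1)\<^esub>"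
      using a_inv_eq_zero_iff[OF T1.abelian_group_axioms Vz] unfolding tot_sel(2) by (auto split: if_splits)
    have "locally_exact R p Q (n - j)" using L by (simp add: locally_acyclic_def)
    from free_tensor_locally_exact[OF p ff Q this zj, unfolded e, OF V0]
    obtain s w where s: "s \<in> carrier R - p" and w: "w \<in> carrier (TT j (n - 1))"
      and sw: "s \<odot>\<^bsub>TT j n\<^esub> z j = tensor_map R (cx_mod P j) (cx_mod Q (n - j)) (\<lambda>x. x) (cx_diff Q (n - 1 - j)) w"
      by blast
    have sw': "s \<odot>\<^bsub>TT j n\<^esub> z j = VV j (n - 1) w" using sw unfolding e .
    have sR: "s \<in> carrier R" using s by simp
    interpret T': Module.module R "TT j (n - 1)" by (rule T0)
    \<comment> \<open>The sign cancels the factor (-1)^j with which the differential of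
      \<open>Q\<close> enters the total differential, so that component \<open>j\<close> of the
      differential of \<open>W\<close> is exactly \<open>s\<close> times \<open>z j\<close>.\<close>
    define W where "W i = (if i = j then (if even j then w else \<ominus>\<^bsub>TT j (n - 1)\<^esub> w) else \<zero>\<^bsub>TT i (n - 1)\<^esub>)" for i
    have W: "W \<in> carrier (cx_mod ?X (n - 1))"
      using dsum_single[OF T0[of _ "n - 1"], where t = "if even j then w else \<ominus>\<^bsub>TT j (n - 1)\<^esub> w" and j = j] w
      unfolding tot_sel W_def[abs_def] by auto
    have DW: "cx_diff ?X (n - 1) W \<in> coboundaries ?X n" using W by (auto simp: coboundaries_def)
    have DWc: "cx_diff ?X (n - 1) W \<in> carrier (cx_mod ?X n)" "cx_diff ?X n (cx_diff ?X (n - 1) W) = \<zero>\<^bsub>cx_mod ?X (n + 1)\<^esub>"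
      using coboundary_cocycle[OF X DW] by auto
    have Wz: "W i = \<zero>\<^bsub>TT i (n - 1)\<^esub>" if "i \<noteq> j" for i using that by (simp add: W_def)
    have DWlow: "cx_diff ?X (n - 1) W i = \<zero>\<^bsub>TT i n\<^esub>" if "i < j" for i
      using tot_diff_zero[of W i "n - 1"] Wz that unfolding e by simp
    have DWj: "cx_diff ?X (n - 1) W j = s \<odot>\<^bsub>TT j n\<^esub> z j"
    proof -
      have U0: "UU j (n - 1) (W (j - 1)) = \<zero>\<^bsub>TT j n\<^esub>" using UU_zero[of j "n - 1"] Wz[of "j - 1"] unfolding e by simp
      have V: "VV j (n - 1) \<in> mod_hom R (TT j (n - 1)) (TT j n)" using VV_hom[of j "n - 1"] unfolding e .
      have Vw: "VV j (n - 1) w \<in> carrier (TT j n)" by (rule mod_homD(1)[OF V w])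
      have Vm: "VV j (n - 1) (\<ominus>\<^bsub>TT j (n - 1)\<^esub> w) = \<ominus>\<^bsub>TT j n\<^esub> VV j (n - 1) w"
        by (rule mod_hom_a_inv[OF T0 T0 V w])
      have "(if even j then VV j (n - 1) (W j) else \<ominus>\<^bsub>TT j n\<^esub> VV j (n - 1) (W j)) = VV j (n - 1) w"
      proof (cases "even j")
        case True then show ?thesis by (simp add: W_def)
      next
        case False
        then have "W j = \<ominus>\<^bsub>TT j (n - 1)\<^esub> w" by (simp add: W_def)
        then show ?thesis using False Vm Vw by (simp only: if_False T.M.minus_minus)
      qed
      then show ?thesis
        using tot_sel(2)[of "n - 1" W j] U0 Vw sw' unfolding e by simp
    qed
    define z' where "z' = s \<odot>\<^bsub>cx_mod ?X n\<^esub> z \<ominus>\<^bsub>cx_mod ?X n\<^esub> cx_diff ?X (n - 1) W"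
    have sz: "s \<odot>\<^bsub>cx_mod ?X n\<^esub> z \<in> carrier (cx_mod ?X n)" using sR z by simp
    have z': "z' \<in> carrier (cx_mod ?X n)" unfolding z'_def using sz DWc(1) by simp
    interpret X1: Module.module R "cx_mod ?X (n + 1)" by (rule tot_module)
    have "cx_diff ?X n (s \<odot>\<^bsub>cx_mod ?X n\<^esub> z) = \<zero>\<^bsub>cx_mod ?X (n + 1)\<^esub>"
      using mod_homD(3)[OF tot_diff_hom sR z] dz sR by simp
    then have "cx_diff ?X n z' = \<zero>\<^bsub>cx_mod ?X (n + 1)\<^esub>"
      unfolding z'_def mod_hom_minus[OF tot_module tot_module tot_diff_hom sz DWc(1)] DWc(2)
      by (simp add: a_minus_def a_inv_zero[OF X1.abelian_group_axioms])
    then have "z' \<in> carrier (cocycles ?X n)" using z' by simp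
    moreover have "z' i = \<zero>\<^bsub>TT i n\<^esub>" if i: "i < N + 1 - int k" for i
    proof -
      interpret Ti: Module.module R "TT i n" by (rule T0)
      have "z' i = (s \<odot>\<^bsub>cx_mod ?X n\<^esub> z) i \<ominus>\<^bsub>TT i n\<^esub> cx_diff ?X (n - 1) W i"
        unfolding z'_def tot_sel(1)
        by (rule dsum_module_minus[where M = "\<lambda>i. TT i n",
              OF T0 tot_cring sz[unfolded tot_sel(1)] DWc(1)[unfolded tot_sel(1)]])
      moreover have "(s \<odot>\<^bsub>cx_mod ?X n\<^esub> z) i = s \<odot>\<^bsub>TT i n\<^esub> z i" by (simp add: tot_sel dsum_module_sel)
      moreover have "i < j \<or> i = j" using i unfolding j_def by auto
      ultimately show ?thesis
        using zlow[of i] DWlow[of i] DWj sR zj Ti.M.r_neg a_inv_zero[OF Ti.abelian_group_axioms]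
        by (auto simp: a_minus_def)
    qed
    ultimately obtain t where t: "t \<in> carrier R - p" "t \<odot>\<^bsub>cx_mod ?X n\<^esub> z' \<in> coboundaries ?X n"
      using Suc.IH by blast
    have tR: "t \<in> carrier R" using t(1) by simp
    note sub = tot_module coboundaries_submodule[OF X, of n]
    have "s \<odot>\<^bsub>cx_mod ?X n\<^esub> z = z' \<oplus>\<^bsub>cx_mod ?X n\<^esub> cx_diff ?X (n - 1) W"
      unfolding z'_def using sz DWc(1) by (simp add: a_minus_def X.M.a_assoc X.M.l_neg)
    then have "t \<odot>\<^bsub>cx_mod ?X n\<^esub> (s \<odot>\<^bsub>cx_mod ?X n\<^esub> z) =
        t \<odot>\<^bsub>cx_mod ?X n\<^esub> z' \<oplus>\<^bsub>cx_mod ?X n\<^esub> t \<odot>\<^bsub>cx_mod ?X n\<^esub> cx_diff ?X (n - 1) W"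
      using X.smult_r_distr[OF tR z' DWc(1)] by simp
    also have "\<dots> \<in> coboundaries ?X n"
      by (intro X.submoduleE(5)[OF sub(2)] t(2) X.submoduleE(4)[OF sub(2) tR DW])
    finally have "(t \<otimes>\<^bsub>R\<^esub> s) \<odot>\<^bsub>cx_mod ?X n\<^esub> z \<in> coboundaries ?X n"
      using tR sR z by (simp add: X.smult_assoc1)
    then show ?case using primeidealE(6)[OF p t(1) s] by blast
  qed
  show ?thesis
    unfolding locally_acyclic_def locally_exact_cocycles
  proof (intro allI ballI)
    fix n z assume z: "z \<in> carrier (cocycles ?X n)"
    then have fin: "finite {i. z i \<noteq> \<zero>\<^bsub>TT i n\<^esub>}" by (simp add: tot_sel dsum_module_sel)
    obtain b where b: "\<And>i. i < b \<Longrightarrow> z i = \<zero>\<^bsub>TT i n\<^esub>"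
    proof (cases "{i. z i \<noteq> \<zero>\<^bsub>TT i n\<^esub>} = {}")
      case True then show ?thesis using that by blast
    next
      case False
      show ?thesis
        by (rule that[of "Min {i. z i \<noteq> \<zero>\<^bsub>TT i n\<^esub>}"]) (use Min_le[OF fin] in fastforce)
    qed
    \<comment> \<open>The bound is at most \<open>b\<close> in either case: it equals
      \<open>b\<close> if b \<le> N + 1, and otherwise \<open>nat\<close> cuts off at zero and it is
      N + 1 < b.\<close>
    have "z i = \<zero>\<^bsub>TT i n\<^esub>" if "i < N + 1 - int (nat (N + 1 - b))" for i
      by (rule b) (use that in linarith)
    then show "\<exists>s\<in>carrier R - p. s \<odot>\<^bsub>cx_mod ?X n\<^esub> z \<in> coboundaries ?X n" by (rule main[OF z])
  qed
qed

text \<open>Functionals \<open>\<alpha>\<close> and \<open>\<beta>\<close> detecting cohomology of \<open>P\<close> and \<open>Q\<close> give the functional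
  \<open>\<alpha> \<otimes> \<beta>\<close> detecting cohomology of the total complex.\<close>

lemma tot_not_locally_acyclic:
  assumes p: "primeideal p R" and ffP: "\<And>n. fin_free R (cx_mod P n)" and ffQ: "\<And>n. fin_free R (cx_mod Q n)"
    and NP: "\<And>n. n > N \<Longrightarrow> carrier (cx_mod P n) = {\<zero>\<^bsub>cx_mod P n\<^esub>}"
    and NQ: "\<And>n. n > N' \<Longrightarrow> carrier (cx_mod Q n) = {\<zero>\<^bsub>cx_mod Q n\<^esub>}"
    and L: "locally_acyclic R p (tot_tensor R P Q)"
  shows "locally_acyclic R p P \<or> locally_acyclic R p Q"
proof (rule ccontr)
  let ?X = "tot_tensor R P Q"
  interpret R: cring R by (rule tot_cring)
  note rm = ring_mod_is_module[OF tot_cring]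
  assume "\<not> ?thesis"
  then have nP: "\<not> locally_acyclic R p P" and nQ: "\<not> locally_acyclic R p Q" by auto
  from detecting_functional[OF p P ffP NP nP]
  obtain a x \<alpha> where x: "x \<in> carrier (cocycles P a)" and \<alpha>: "\<alpha> \<in> mod_hom R (cx_mod P a) (ring_mod R)"
    and \<alpha>B: "\<And>b. b \<in> coboundaries P a \<Longrightarrow> \<alpha> b \<in> p" and \<alpha>x: "\<alpha> x \<notin> p" by metis
  from detecting_functional[OF p Q ffQ NQ nQ]
  obtain b y \<beta> where y: "y \<in> carrier (cocycles Q b)" and \<beta>: "\<beta> \<in> mod_hom R (cx_mod Q b) (ring_mod R)"
    and \<beta>B: "\<And>c. c \<in> coboundaries Q b \<Longrightarrow> \<beta> c \<in> p" and \<beta>y: "\<beta> y \<notin> p" by metis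
  define n where "n = a + b"
  have e: "n - a = b" "n + 1 - (a + 1) = b" "n - 1 + 1 = n" "n - 1 - a = b - 1" "n - 1 - (a - 1) = b" "a + 1 - 1 = a"
    by (auto simp: n_def)
  note MP = is_cpxD(1)[OF P] and MQ = is_cpxD(1)[OF Q]
  have T0: "Module.module R (TT i n)" for i n by (rule TT_module)
  have xP: "x \<in> carrier (cx_mod P a)" and dx: "cx_diff P a x = \<zero>\<^bsub>cx_mod P (a + 1)\<^esub>" using x by auto
  have yQ: "y \<in> carrier (cx_mod Q b)" and dy: "cx_diff Q b y = \<zero>\<^bsub>cx_mod Q (b + 1)\<^esub>" using y by auto
  let ?Ta = "tensor_module R (cx_mod P a) (cx_mod Q b)"
  let ?xy = "tens R (cx_mod P a) (cx_mod Q b) x y"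
  have xy: "?xy \<in> carrier ?Ta" by (rule tens_closed[OF MP MQ xP yQ])
  \<comment> \<open>The element x \<otimes> y placed in component \<open>a\<close>. Its differential
    can be nonzero only in the components \<open>a\<close> and a + 1, where the cocycle conditions
    for \<open>y\<close> and \<open>x\<close> make it vanish.\<close>
  define z where "z i = (if i = a then ?xy else \<zero>\<^bsub>TT i n\<^esub>)" for i
  have xy': "?xy \<in> carrier (TT a n)" using xy unfolding e .
  have z: "z \<in> carrier (cx_mod ?X n)"
    unfolding tot_sel(1) z_def[abs_def] by (rule dsum_single[where M = "\<lambda>i. TT i n", OF T0 xy'])
  have z0: "z i = \<zero>\<^bsub>TT i n\<^esub>" if "i \<noteq> a" for i using that by (simp add: z_def)
  have "cx_diff ?X n z i = \<zero>\<^bsub>TT i (n + 1)\<^esub>" for i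
  proof -
    consider "i = a" | "i = a + 1" | "i \<noteq> a" "i - 1 \<noteq> a" by force
    then show ?thesis
    proof cases
      case 1
      interpret T1: Module.module R "TT a (n + 1)" by (rule T0)
      have e1: "n + 1 - a = b + 1" by (simp add: n_def)
      have "VV a n ?xy = \<zero>\<^bsub>TT a (n + 1)\<^esub>"
        using VV_tens[of x a y n] xP yQ dy
          mod_hom_zero[OF MQ tensor_module_is_module[OF MP MQ] tens_hom_right[OF MP MQ xP]]
        unfolding e e1 by simp
      moreover have "UU a n (z (a - 1)) = \<zero>\<^bsub>TT a (n + 1)\<^esub>" using z0[of "a - 1"] UU_zero[of a n] by simp
      moreover have "z a = ?xy" by (simp add: z_def)
      ultimately show ?thesis
        unfolding 1 tot_sel(2) using a_inv_zero[OF T1.abelian_group_axioms] by simp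
    next
      case 2
      interpret T1: Module.module R "TT (a + 1) (n + 1)" by (rule T0)
      have "UU (a + 1) n ?xy = \<zero>\<^bsub>TT (a + 1) (n + 1)\<^esub>"
        using UU_tens[of x "a + 1" y n] xP yQ dx
          mod_hom_zero[OF MP tensor_module_is_module[OF MP MQ] tens_hom_left[OF MP MQ yQ]]
        unfolding e by simp
      moreover have "z (a + 1 - 1) = ?xy" unfolding e by (simp add: z_def)
      moreover have "VV (a + 1) n (z (a + 1)) = \<zero>\<^bsub>TT (a + 1) (n + 1)\<^esub>" using z0[of "a + 1"] VV_zero[of "a + 1" n] by simp
      ultimately show ?thesis
        unfolding 2 tot_sel(2)
        using a_inv_zero[OF T1.abelian_group_axioms] T1.M.l_zero[OF T1.M.zero_closed] by simp
    next
      case 3 then show ?thesis by (intro tot_diff_zero z0)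
    qed
  qed
  then have dz: "cx_diff ?X n z = \<zero>\<^bsub>cx_mod ?X (n + 1)\<^esub>" unfolding tot_sel(1) dsum_module_sel by blast
  have "locally_exact R p ?X n" using L by (simp add: locally_acyclic_def)
  then obtain s where s: "s \<in> carrier R - p" "s \<odot>\<^bsub>cx_mod ?X n\<^esub> z \<in> coboundaries ?X n"
    using z dz by (rule locally_exactE)
  then obtain w where w: "w \<in> carrier (cx_mod ?X (n - 1))" "s \<odot>\<^bsub>cx_mod ?X n\<^esub> z = cx_diff ?X (n - 1) w"
    by (auto simp: coboundaries_def)
  have sR: "s \<in> carrier R" using s by simp
  have bil: "bilinear_map R (cx_mod P a) (cx_mod Q b) (ring_mod R) (\<lambda>x y. \<alpha> x \<odot>\<^bsub>ring_mod R\<^esub> \<beta> y)"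
    by (rule bilinear_map_comp[OF scalar_bilinear[OF rm mod_hom_id] \<alpha> \<beta>])
  obtain G where G: "G \<in> mod_hom R ?Ta (ring_mod R)"
    and Gt: "\<And>x y. \<lbrakk>x \<in> carrier (cx_mod P a); y \<in> carrier (cx_mod Q b)\<rbrakk> \<Longrightarrow>
      G (tens R (cx_mod P a) (cx_mod Q b) x y) = \<alpha> x \<odot>\<^bsub>ring_mod R\<^esub> \<beta> y"
    by (rule tensor_lift[OF MP MQ rm bil]) blast
  note pE = R.idealE[OF primeidealE(1)[OF p]] and psub = ideal_submodule[OF tot_cring primeidealE(1)[OF p]]
  have \<alpha>c: "\<alpha> u \<in> carrier R" if "u \<in> carrier (cx_mod P a)" for u using mod_homD(1)[OF \<alpha> that] by simp
  have \<beta>c: "\<beta> u \<in> carrier R" if "u \<in> carrier (cx_mod Q b)" for u using mod_homD(1)[OF \<beta> that] by simp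
  have wc: "w i \<in> carrier (TT i (n - 1))" for i using w(1) by (simp add: tot_sel dsum_module_sel)
  have U: "UU a (n - 1) \<in> mod_hom R (tensor_module R (cx_mod P (a - 1)) (cx_mod Q b)) ?Ta"
    using UU_hom[of a "n - 1"] unfolding e .
  have V: "VV a (n - 1) \<in> mod_hom R (tensor_module R (cx_mod P a) (cx_mod Q (b - 1))) ?Ta"
    using VV_hom[of a "n - 1"] unfolding e .
  \<comment> \<open>On pure tensors \<open>G\<close> gives \<alpha>(d u) \<beta>(v), which is in
    \<open>p\<close> because \<alpha> sends coboundaries into \<open>p\<close>;
    \<open>tensor_span\<close> extends this to all elements. \<open>GV\<close> is the same argument
    with \<beta>.\<close>
  have GU: "G (UU a (n - 1) t) \<in> p" if t: "t \<in> carrier (tensor_module R (cx_mod P (a - 1)) (cx_mod Q b))" for t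
  proof -
    have "t \<in> {t\<in>carrier (tensor_module R (cx_mod P (a - 1)) (cx_mod Q b)). G (UU a (n - 1) t) \<in> p}"
    proof (rule tensor_span[OF MP MQ _ _ t])
      show "submodule {t\<in>carrier (tensor_module R (cx_mod P (a - 1)) (cx_mod Q b)). G (UU a (n - 1) t) \<in> p} R
          (tensor_module R (cx_mod P (a - 1)) (cx_mod Q b))"
        by (rule mod_hom_preimage_submodule[OF tensor_module_is_module[OF MP MQ] rm mod_hom_comp[OF U G] psub])
      fix u v assume u: "u \<in> carrier (cx_mod P (a - 1))" and v: "v \<in> carrier (cx_mod Q b)"
      have "cx_diff P (a - 1) u \<in> coboundaries P a" using u by (auto simp: coboundaries_def)
      then have "\<alpha> (cx_diff P (a - 1) u) \<otimes>\<^bsub>R\<^esub> \<beta> v \<in> p" by (intro pE(6) \<alpha>B \<beta>c v)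
      moreover have "UU a (n - 1) (tens R (cx_mod P (a - 1)) (cx_mod Q b) u v) =
          tens R (cx_mod P a) (cx_mod Q b) (cx_diff P (a - 1) u) v"
        using UU_tens[of u a v "n - 1"] u v unfolding e by simp
      ultimately show "tens R (cx_mod P (a - 1)) (cx_mod Q b) u v \<in>
          {t\<in>carrier (tensor_module R (cx_mod P (a - 1)) (cx_mod Q b)). G (UU a (n - 1) t) \<in> p}"
        using Gt[OF mod_homD(1)[OF is_cpxD(4)[OF P] u] v] tens_closed[OF MP MQ u v] by simp
    qed
    then show ?thesis by simp
  qed
  have GV: "G (VV a (n - 1) t) \<in> p" if t: "t \<in> carrier (tensor_module R (cx_mod P a) (cx_mod Q (b - 1)))" for t
  proof -
    have "t \<in> {t\<in>carrier (tensor_module R (cx_mod P a) (cx_mod Q (b - 1))). G (VV a (n - 1) t) \<in> p}"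
    proof (rule tensor_span[OF MP MQ _ _ t])
      show "submodule {t\<in>carrier (tensor_module R (cx_mod P a) (cx_mod Q (b - 1))). G (VV a (n - 1) t) \<in> p} R
          (tensor_module R (cx_mod P a) (cx_mod Q (b - 1)))"
        by (rule mod_hom_preimage_submodule[OF tensor_module_is_module[OF MP MQ] rm mod_hom_comp[OF V G] psub])
      fix u v assume u: "u \<in> carrier (cx_mod P a)" and v: "v \<in> carrier (cx_mod Q (b - 1))"
      have "cx_diff Q (b - 1) v \<in> coboundaries Q b" using v by (auto simp: coboundaries_def)
      then have "\<alpha> u \<otimes>\<^bsub>R\<^esub> \<beta> (cx_diff Q (b - 1) v) \<in> p" by (intro pE(5) \<beta>B \<alpha>c u)
      moreover have "VV a (n - 1) (tens R (cx_mod P a) (cx_mod Q (b - 1)) u v) =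
          tens R (cx_mod P a) (cx_mod Q b) u (cx_diff Q (b - 1) v)"
        using VV_tens[of u a v "n - 1"] u v unfolding e by simp
      ultimately show "tens R (cx_mod P a) (cx_mod Q (b - 1)) u v \<in>
          {t\<in>carrier (tensor_module R (cx_mod P a) (cx_mod Q (b - 1))). G (VV a (n - 1) t) \<in> p}"
        using Gt[OF u mod_homD(1)[OF is_cpxD(4)[OF Q] v]] tens_closed[OF MP MQ u v] by simp
    qed
    then show ?thesis by simp
  qed
  note Ta = tensor_module_is_module[OF MP[of a] MQ[of b]]
  interpret Ta: Module.module R ?Ta by (rule Ta)
  have wU: "w (a - 1) \<in> carrier (tensor_module R (cx_mod P (a - 1)) (cx_mod Q b))" using wc[of "a - 1"] unfolding e .
  have wV: "w a \<in> carrier (tensor_module R (cx_mod P a) (cx_mod Q (b - 1)))" using wc[of a] unfolding e .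
  let ?S = "{t\<in>carrier ?Ta. G t \<in> p}"
  have S: "submodule ?S R ?Ta" by (rule mod_hom_preimage_submodule[OF Ta rm G psub])
  have inU: "UU a (n - 1) (w (a - 1)) \<in> ?S" using GU[OF wU] mod_homD(1)[OF U wU] by simp
  have inV: "VV a (n - 1) (w a) \<in> ?S" using GV[OF wV] mod_homD(1)[OF V wV] by simp
  \<comment> \<open>Only component \<open>a\<close> of the relation is inspected. Applying
    \<open>G\<close> yields a product of \<open>s\<close>, \<alpha>(x) and \<beta>(y) in
    \<open>p\<close>, none of whose factors is in \<open>p\<close>.\<close>
  have "s \<odot>\<^bsub>?Ta\<^esub> ?xy = (s \<odot>\<^bsub>cx_mod ?X n\<^esub> z) a" unfolding tot_sel(1) dsum_module_sel e by (simp add: z_def)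
  also have "\<dots> = UU a (n - 1) (w (a - 1)) \<oplus>\<^bsub>?Ta\<^esub>
      (if even a then VV a (n - 1) (w a) else \<ominus>\<^bsub>?Ta\<^esub> VV a (n - 1) (w a))"
    unfolding w(2) tot_sel(2) e ..
  also have "\<dots> \<in> ?S"
    by (rule Ta.submoduleE(5)[OF S inU]) (use inV Ta.submoduleE(3)[OF S inV] in \<open>simp only: split: if_split\<close>, blast)
  finally have "G (s \<odot>\<^bsub>?Ta\<^esub> ?xy) \<in> p" by simp
  then have "s \<otimes>\<^bsub>R\<^esub> (\<alpha> x \<otimes>\<^bsub>R\<^esub> \<beta> y) \<in> p" using mod_homD(3)[OF G sR xy] Gt[OF xP yQ] by simp
  then show False
    using primeidealE(5)[OF p] s(1) \<alpha>x \<beta>y \<alpha>c[OF xP] \<beta>c[OF yQ] by (metis DiffE R.m_closed)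
qed

end

section \<open>Local acyclicity of derived tensor products\<close>

lemma derived_tensorE:
  assumes "derived_tensor R X Y Z"
  obtains P f Q g \<phi> where "free_resolution R P f X" "free_resolution R Q g Y"
    "cpx_iso R (tot_tensor R P Q) Z \<phi>" "X \<in> Dminus_ob R" "Y \<in> Dminus_ob R" "Z \<in> Dminus_ob R"
  using assms unfolding derived_tensor_def by blast

lemma free_resolutionD:
  assumes "free_resolution R P f X"
  shows "is_cpx R P" "fin_free R (cx_mod P n)" "\<exists>N. \<forall>n>N. carrier (cx_mod P n) = {\<zero>\<^bsub>cx_mod P n\<^esub>}"
    "quasi_iso R P X f"
  using assms by (auto simp: free_resolution_def)

text \<open>Local acyclicity is transported along the two resolutions and along the identification
  of \<open>Z\<close> with the total complex. The ideal property is stated for the right factor, as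
  in \<open>thick_tensor_ideal\<close>; there \<open>P\<close> is the free factor and
  \<open>Q\<close> the acyclic one.\<close>

lemma derived_tensor_locally_acyclic:
  assumes p: "primeideal p R" and t: "derived_tensor R X Y Z"
  shows "locally_acyclic R p Y \<Longrightarrow> locally_acyclic R p Z"
    "locally_acyclic R p Z \<Longrightarrow> locally_acyclic R p X \<or> locally_acyclic R p Y"
proof -
  obtain P f Q g \<phi> where fP: "free_resolution R P f X" and fQ: "free_resolution R Q g Y"
    and iso: "cpx_iso R (tot_tensor R P Q) Z \<phi>" and ob: "X \<in> Dminus_ob R" "Y \<in> Dminus_ob R" "Z \<in> Dminus_ob R"
    using t by (rule derived_tensorE)
  note P = free_resolutionD[OF fP] and Q = free_resolutionD[OF fQ]
  note X' = Dminus_obD(1)[OF ob(1)] and Y' = Dminus_obD(1)[OF ob(2)] and Z' = Dminus_obD(1)[OF ob(3)]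
  obtain N where N: "\<And>n. n > N \<Longrightarrow> carrier (cx_mod P n) = {\<zero>\<^bsub>cx_mod P n\<^esub>}" using P(3) by blast
  obtain N' where N': "\<And>n. n > N' \<Longrightarrow> carrier (cx_mod Q n) = {\<zero>\<^bsub>cx_mod Q n\<^esub>}" using Q(3) by blast
  have PX: "locally_acyclic R p P \<longleftrightarrow> locally_acyclic R p X" by (rule quasi_iso_locally_acyclic[OF P(1) X' P(4)])
  have QY: "locally_acyclic R p Q \<longleftrightarrow> locally_acyclic R p Y" by (rule quasi_iso_locally_acyclic[OF Q(1) Y' Q(4)])
  have TZ: "locally_acyclic R p (tot_tensor R P Q) \<longleftrightarrow> locally_acyclic R p Z"
    by (rule cpx_iso_locally_acyclic[OF tot_module[OF P(1) Q(1)] mod_homD(1)[OF tot_diff_hom[OF P(1) Q(1)]] Z' iso])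
  show "locally_acyclic R p Z" if "locally_acyclic R p Y"
    using tot_locally_acyclic[OF P(1) Q(1) p P(2) N _ tot_is_cpx[OF P(1) Q(1) Z' iso]] that QY TZ by blast
  show "locally_acyclic R p X \<or> locally_acyclic R p Y" if "locally_acyclic R p Z"
    using tot_not_locally_acyclic[OF P(1) Q(1) p P(2) Q(2) N N'] that PX QY TZ by blast
qed

section \<open>Sums of shifted cyclic modules\<close>

text \<open>R/I is recorded through a generator and its annihilator. This description survives the
  passage to the small model, whose carrier consists of fibres and is awkward to compute
  with.\<close>

lemma cyclic_module_small_model:
  fixes R :: "('a, 'r) ring_scheme"
  assumes R: "cring R" and I: "ideal I R"
  shows "\<exists>(N :: ('a, 'a elt) module) c. fg_module R N \<and> c \<in> carrier N \<and>
     (\<forall>x\<in>carrier N. \<exists>r\<in>carrier R. x = r \<odot>\<^bsub>N\<^esub> c) \<and> (\<forall>r\<in>carrier R. r \<odot>\<^bsub>N\<^esub> c = \<zero>\<^bsub>N\<^esub> \<longleftrightarrow> r \<in> I)"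
proof -
  interpret R: cring R by fact
  note rm = ring_mod_is_module[OF R] and Isub = ideal_submodule[OF R I]
  let ?Q = "quot_module (ring_mod R) I"
  note Q = quot_is_module[OF rm Isub]
  interpret Q: Module.module R ?Q by (rule Q)
  define c where "c = I +>\<^bsub>ring_mod R\<^esub> \<one>\<^bsub>R\<^esub>"
  have c: "c \<in> carrier ?Q" unfolding c_def quot_carrier[OF rm Isub] by simp
  have rc: "r \<odot>\<^bsub>?Q\<^esub> c = I +>\<^bsub>ring_mod R\<^esub> r" if "r \<in> carrier R" for r
    unfolding c_def using quot_smult[OF rm Isub that, of "\<one>\<^bsub>R\<^esub>"] that by simp
  have gen: "\<exists>r\<in>carrier R. x = r \<odot>\<^bsub>?Q\<^esub> c" if "x \<in> carrier ?Q" for x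
    using that rc unfolding quot_carrier[OF rm Isub] by auto
  have ann: "r \<odot>\<^bsub>?Q\<^esub> c = \<zero>\<^bsub>?Q\<^esub> \<longleftrightarrow> r \<in> I" if "r \<in> carrier R" for r
    unfolding rc[OF that] using quot_eq_zero_iff[OF rm Isub] that by simp
  note sg = submod_gen_submodule[OF Q, of "{c}"]
  have "carrier ?Q \<subseteq> submod_gen R ?Q {c}"
  proof
    fix x assume "x \<in> carrier ?Q"
    then obtain r where "r \<in> carrier R" "x = r \<odot>\<^bsub>?Q\<^esub> c" using gen by blast
    then show "x \<in> submod_gen R ?Q {c}" using Q.submoduleE(4)[OF sg(1)] sg(2) c by auto
  qed
  moreover have "submod_gen R ?Q {c} \<subseteq> carrier ?Q" by (rule submod_gen_least[OF Q.carrier_is_submodule]) (use c in auto)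
  ultimately have "fg_module R ?Q" unfolding fg_module_def using Q c by blast
  then obtain N :: "('a, 'a elt) module" and F where N: "fg_module R N" and F: "F \<in> mod_iso R ?Q N"
    by (rule fg_module_small_model)
  note F' = mod_isoD[OF F]
  have Nm: "Module.module R N" using N by (simp add: fg_module_def)
  have "\<exists>r\<in>carrier R. x = r \<odot>\<^bsub>N\<^esub> F c" if x: "x \<in> carrier N" for x
  proof -
    obtain u where u: "u \<in> carrier ?Q" "x = F u" using x F'(3) by auto
    obtain r where "r \<in> carrier R" "u = r \<odot>\<^bsub>?Q\<^esub> c" using gen[OF u(1)] by blast
    then show ?thesis using mod_homD(3)[OF F'(1) _ c] u(2) by blast
  qed
  moreover have "r \<odot>\<^bsub>N\<^esub> F c = \<zero>\<^bsub>N\<^esub> \<longleftrightarrow> r \<in> I" if r: "r \<in> carrier R" for r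
  proof -
    have "r \<odot>\<^bsub>N\<^esub> F c = \<zero>\<^bsub>N\<^esub> \<longleftrightarrow> F (r \<odot>\<^bsub>?Q\<^esub> c) = F \<zero>\<^bsub>?Q\<^esub>"
      using mod_homD(3)[OF F'(1) r c] mod_hom_zero[OF Q Nm F'(1)] by simp
    also have "\<dots> \<longleftrightarrow> r \<in> I"
      using inj_on_eq_iff[OF F'(2) Q.smult_closed[OF r c] Q.M.zero_closed] ann[OF r] by simp
    finally show ?thesis .
  qed
  ultimately show ?thesis using N mod_homD(1)[OF F'(1) c] by blast
qed

text \<open>The complex with zero differentials and \<open>R / J\<^sub>n\<close> in degree \<open>n\<close>.\<close>

lemma sum_of_shifted_cyclic_modules:
  fixes R :: "('a, 'r) ring_scheme" and J :: "int \<Rightarrow> 'a set"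
  assumes R: "cring R" and J: "\<And>n. ideal (J n) R" and J0: "\<And>n. n > 0 \<Longrightarrow> J n = carrier R"
  shows "\<exists>X\<in>Dminus_ob R. \<forall>p. locally_acyclic R p X \<longleftrightarrow> (\<forall>n. \<not> J n \<subseteq> p)"
proof -
  interpret R: cring R by fact
  have "\<forall>n. \<exists>(N :: ('a, 'a elt) module) c. fg_module R N \<and> c \<in> carrier N \<and>
     (\<forall>x\<in>carrier N. \<exists>r\<in>carrier R. x = r \<odot>\<^bsub>N\<^esub> c) \<and> (\<forall>r\<in>carrier R. r \<odot>\<^bsub>N\<^esub> c = \<zero>\<^bsub>N\<^esub> \<longleftrightarrow> r \<in> J n)"
    using cyclic_module_small_model[OF R J] by blast
  then obtain N :: "int \<Rightarrow> ('a, 'a elt) module" and c where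
    Nc: "\<forall>n. fg_module R (N n) \<and> c n \<in> carrier (N n) \<and>
     (\<forall>x\<in>carrier (N n). \<exists>r\<in>carrier R. x = r \<odot>\<^bsub>N n\<^esub> c n) \<and>
     (\<forall>r\<in>carrier R. r \<odot>\<^bsub>N n\<^esub> c n = \<zero>\<^bsub>N n\<^esub> \<longleftrightarrow> r \<in> J n)"
    by metis
  have fg: "fg_module R (N n)" and c: "c n \<in> carrier (N n)"
    and gen: "x \<in> carrier (N n) \<Longrightarrow> \<exists>r\<in>carrier R. x = r \<odot>\<^bsub>N n\<^esub> c n"
    and ann: "r \<in> carrier R \<Longrightarrow> r \<odot>\<^bsub>N n\<^esub> c n = \<zero>\<^bsub>N n\<^esub> \<longleftrightarrow> r \<in> J n" for n x r
    using Nc by auto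
  have Nm: "Module.module R (N n)" for n using fg by (simp add: fg_module_def)
  define X where "X = \<lparr>cx_mod = N, cx_diff = (\<lambda>n x. \<zero>\<^bsub>N (n + 1)\<^esub>)\<rparr>"
  have X_sel: "cx_mod X n = N n" "cx_diff X n x = \<zero>\<^bsub>N (n + 1)\<^esub>" for n x by (simp_all add: X_def)
  have X: "is_cpx R X"
    unfolding is_cpx_def
  proof (intro conjI allI ballI)
    fix n
    interpret M: Module.module R "N (n + 1)" by (rule Nm)
    show "Module.module R (cx_mod X n)" unfolding X_sel by (rule Nm)
    show "cx_diff X n \<in> mod_hom R (cx_mod X n) (cx_mod X (n + 1))" by (rule mod_homI) (auto simp: X_sel)
    fix x
    have e: "n + 1 + 1 = n + 2" by simp
    show "cx_diff X (n + 1) (cx_diff X n x) = \<zero>\<^bsub>cx_mod X (n + 2)\<^esub>" unfolding X_sel e ..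
  qed
  have cob: "coboundaries X n = {\<zero>\<^bsub>N n\<^esub>}" for n
    using c[of "n - 1"] by (auto simp: coboundaries_def X_sel)
  have coc: "carrier (cocycles X n) = carrier (N n)" for n by (auto simp: X_sel)
  have "carrier (N n) = {\<zero>\<^bsub>N n\<^esub>}" if n: "n > 0" for n
  proof -
    interpret M: Module.module R "N n" by (rule Nm)
    \<comment> \<open>In positive degrees the annihilator of the generator is all of R, so the
      module is zero and the complex is right bounded.\<close>
    have "c n = \<zero>\<^bsub>N n\<^esub>" using ann[of "\<one>\<^bsub>R\<^esub>" n] J0[OF n] c[of n] by simp
    then have "x = \<zero>\<^bsub>N n\<^esub>" if "x \<in> carrier (N n)" for x using gen[OF that] by auto
    then show ?thesis using M.M.zero_closed by blast
  qed
  then have "\<forall>n>0. carrier (cohomology X n) = {\<zero>\<^bsub>cohomology X n\<^esub>}"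
    unfolding cohomology_trivial_iff[OF X] coc cob by simp
  moreover have "fg_module R (cx_mod X n)" for n unfolding X_sel by (rule fg)
  ultimately have "X \<in> Dminus_ob R" using X unfolding Dminus_ob_def by blast
  moreover have "locally_acyclic R p X \<longleftrightarrow> (\<forall>n. \<not> J n \<subseteq> p)" for p
  proof -
    have "locally_exact R p X n \<longleftrightarrow> \<not> J n \<subseteq> p" for n
    proof
      assume "locally_exact R p X n"
      then obtain s where "s \<in> carrier R - p" "s \<odot>\<^bsub>N n\<^esub> c n = \<zero>\<^bsub>N n\<^esub>"
        using c[of n] unfolding locally_exact_cocycles coc cob X_sel by blast
      then show "\<not> J n \<subseteq> p" using ann by blast
    next
      assume "\<not> J n \<subseteq> p"
      then obtain s where s: "s \<in> J n" "s \<notin> p" by blast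
      then have sR: "s \<in> carrier R" using R.idealE(1)[OF J] by blast
      interpret M: Module.module R "N n" by (rule Nm)
      \<comment> \<open>A scalar that kills the generator kills the cyclic module, so one
        \<open>s\<close> serves for all cocycles.\<close>
      have "s \<odot>\<^bsub>N n\<^esub> x = \<zero>\<^bsub>N n\<^esub>" if x: "x \<in> carrier (N n)" for x
      proof -
        obtain r where r: "r \<in> carrier R" "x = r \<odot>\<^bsub>N n\<^esub> c n" using gen[OF x] by blast
        have "s \<odot>\<^bsub>N n\<^esub> x = r \<odot>\<^bsub>N n\<^esub> (s \<odot>\<^bsub>N n\<^esub> c n)"
          unfolding r(2) by (rule mod_homD(3)[OF scalar_endo[OF Nm sR] r(1) c])
        also have "s \<odot>\<^bsub>N n\<^esub> c n = \<zero>\<^bsub>N n\<^esub>" using ann[OF sR] s(1) by blast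
        finally show ?thesis using r(1) by simp
      qed
      then show "locally_exact R p X n"
        unfolding locally_exact_cocycles coc cob X_sel using sR s(2) by blast
    qed
    then show ?thesis by (simp add: locally_acyclic_def)
  qed
  ultimately show ?thesis by blast
qed

text \<open>\<open>X\<close> witnesses that the kernel is nonempty and \<open>Y\<close> that it is
  proper.\<close>

lemma local_kernel_prime:
  assumes p: "primeideal p R" and X: "X \<in> local_kernel R p" and Y: "Y \<in> Dminus_ob R" "Y \<notin> local_kernel R p"
  shows "local_kernel R p \<in> Spc (Dminus R)"
proof -
  have "thick_tensor_ideal (Dminus R) (local_kernel R p)"
    unfolding thick_tensor_ideal_def
  proof (intro conjI ballI impI)
    show "thick_subcat (Dminus R) (local_kernel R p)" using local_kernel_thick[OF p] X by blast
    show "Z \<in> local_kernel R p" if "A \<in> Ob (Dminus R)" "X \<in> local_kernel R p" "Z \<in> Ob (Dminus R)"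
      "Tns (Dminus R) A X Z" for A X Z
      using derived_tensor_locally_acyclic(1)[OF p, of A X Z] that by (simp add: local_kernel_def)
  qed
  moreover have "A \<in> local_kernel R p \<or> B \<in> local_kernel R p"
    if "A \<in> Dminus_ob R" "B \<in> Dminus_ob R" "derived_tensor R A B Z" "Z \<in> local_kernel R p" for A B Z
    using derived_tensor_locally_acyclic(2)[OF p, of A B Z] that by (simp add: local_kernel_def)
  ultimately show ?thesis unfolding Spc_def prime_tensor_ideal_def using Y by auto
qed

theorem theorem1p2:
  fixes R :: "('a, 'r) ring_scheme"
  assumes "cring R" and "noetherian_ring R"
    and "noetherian_space (Spc_top (Dminus R))"
  shows "finite {p. primeideal p R}"
proof (rule ccontr)
  interpret noetherian_cring R
    using assms(1,2) by (simp add: noetherian_cring_def)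
  assume "infinite {p. primeideal p R}"
  from infinite_antichain_of_primes[OF this]
  obtain H where H: "infinite H \<and> (\<forall>p\<in>H. primeideal p R) \<and> (\<forall>p\<in>H. \<forall>p'\<in>H. p \<subseteq> p' \<longrightarrow> p = p')" ..
  then have Hp: "\<forall>p\<in>H. primeideal p R" and Ha: "\<forall>p\<in>H. \<forall>p'\<in>H. p \<subseteq> p' \<longrightarrow> p = p'" by simp_all
  from H obtain f :: "nat \<Rightarrow> 'a set" where inj: "inj f" and fH: "range f \<subseteq> H"
    using infinite_countable_subset[of H] by auto
  have f: "primeideal (f m) R" for m using Hp fH by blast
  have "f i \<in> H" for i using fH by blast
  then have anti: "f i \<subseteq> f m \<longleftrightarrow> i = m" for i m using Ha injD[OF inj, of i m] by blast
  \<comment> \<open>Degree -i of the k-th complex carries the quotient by \<open>f i\<close> for i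
    \<ge> k. All other degrees get the quotient by R, which is zero. In particular degree -m carries
    R/\<open>f m\<close> if k \<le> m, and this does not vanish at \<open>f m\<close>.\<close>
  define J where "J k n = (if n \<le> 0 \<and> k \<le> nat (- n) then f (nat (- n)) else carrier R)" for k :: nat and n :: int
  have Ji: "ideal (J k n) R" for k n using primeidealE(1)[OF f] oneideal by (simp add: J_def)
  have "\<forall>k. \<exists>X\<in>Dminus_ob R. \<forall>p. locally_acyclic R p X \<longleftrightarrow> (\<forall>n. \<not> J k n \<subseteq> p)"
    using sum_of_shifted_cyclic_modules[OF assms(1) Ji] by (simp add: J_def)
  then obtain X where X: "\<And>k. X k \<in> Dminus_ob R"
    and lac: "\<And>k p. locally_acyclic R p (X k) \<longleftrightarrow> (\<forall>n. \<not> J k n \<subseteq> p)" by metis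
  have not_sub: "\<not> carrier R \<subseteq> f m" for m using primeidealE(3)[OF f] by blast
  have mem: "X k \<in> local_kernel R (f m) \<longleftrightarrow> m < k" for k m
  proof -
    have "(\<forall>n. \<not> J k n \<subseteq> f m) \<longleftrightarrow> m < k"
    proof
      assume "\<forall>n. \<not> J k n \<subseteq> f m"
      then have "\<not> J k (- int m) \<subseteq> f m" by blast
      then show "m < k" by (simp add: J_def split: if_splits)
    next
      assume "m < k"
      then show "\<forall>n. \<not> J k n \<subseteq> f m" using not_sub anti by (auto simp: J_def)
    qed
    then show ?thesis using X lac by (simp add: local_kernel_def)
  qed
  \<comment> \<open>\<open>X (Suc m)\<close> omits the prime \<open>f m\<close> and is in the
    kernel; \<open>X 0\<close> involves all the chosen primes and is not.\<close>
  have S: "local_kernel R (f m) \<in> Spc (Dminus R)" for m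
    using local_kernel_prime[OF f, of "X (Suc m)" m "X 0"] X mem by simp
  have U: "local_kernel R (f m) \<in> Spc_U (Dminus R) (X k) \<longleftrightarrow> m < k" for m k
    using S mem by (simp add: Spc_U_def)
  let ?T = "Spc_top (Dminus R)"
  \<comment> \<open>The sets U(X_k) are compared only at the points given by the \<open>f m\<close>;
    taking unions makes the complements descend on the whole spectrum. The point of
    \<open>f n\<close> lies in \<open>C n\<close> but not in \<open>C (Suc n)\<close>, as X_(n+1) is
    the first complex in its kernel.\<close>
  define C where "C n = topspace ?T - (\<Union>k\<le>n. Spc_U (Dminus R) (X k))" for n :: nat
  have op: "openin ?T (Spc_U (Dminus R) (X k))" for k
    unfolding Spc_top_def using X by (intro topology_generated_by_Basis) auto
  have "closedin ?T (C n)" for n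
    unfolding C_def by (intro closedin_diff closedin_topspace openin_Union) (use op in auto)
  moreover have "C (Suc n) \<subseteq> C n" for n by (auto simp: C_def)
  ultimately obtain n where n: "\<And>m. m \<ge> n \<Longrightarrow> C m = C n"
    using assms(3) unfolding noetherian_space_def by metis
  have "local_kernel R (f n) \<in> topspace ?T"
    using openin_subset[OF op[of "Suc n"]] U by blast
  then have "local_kernel R (f n) \<in> C n" using U by (auto simp: C_def)
  moreover have "local_kernel R (f n) \<notin> C (Suc n)" using U[of n "Suc n"] by (auto simp: C_def)
  ultimately show False using n[of "Suc n"] by simp
qed

end
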